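(* Assume that $0\le k\le N-2$, that for any $v\in\mathcal X$ and any hyperplane $\Pi\subset\mathbb R^N$ containing the origin one has $v_{\Pi^+},v_{\Pi^-}\in\mathcal X$ (assumption A1), and that problem $(\mathcal P)$ admits minimizers in $\mathcal X$ and any minimizer is a $C^1$ function on $\Omega$ (assumption A2). Let $u\in\mathcal X$ be a minimizer for problem $(\mathcal P)$. Then there exists a $k$-dimensional vector subspace $V$ of $\mathbb R^N$ such that $u$ is radially symmetric with respect to $V$.
   Context: **Setting.** $\Omega\subset\mathbb R^N$ is an open set invariant under rotations centered at the origin (not assumed connected or bounded), and $A_\Omega=\{|x| : x\in\Omega\}$. $\mathcal X$ is a given function space (a set of functions $v:\Omega\to\mathbb R^n$, with a.e. equal functions identified) whose elements are locally integrable with locally integrable weak gradient $\nabla v$; $|\nabla v|$ is the Euclidean norm of $\nabla v$. A statement that an element of $\mathcal X$ is $C^1$ means it has a $C^1$ representative, which is then used. $F,G_1,\dots,G_k$ are real-valued functions on $A_\Omega\times\mathbb R^n\times[0,\infty)$ such that for every $v\in\mathcal X$ the functions $x\mapsto F(|x|,v(x),|\nabla v(x)|)$ and $x\mapsto G_j(|x|,v(x),|\nabla v(x)|)$, $1\le j\le k$, belong to $L^1(\Omega)$. **Problem $(\mathcal P)$.** Given $\lambda_1,\dots,\lambda_k\in\mathbb R$: minimize $E(u)=\int_\Omega F(|x|,u(x),|\nabla u(x)|)\,dx$ over $u\in\mathcal X$ under the $k$ constraints $Q_j(u)=\int_\Omega G_j(|x|,u(x),|\nabla u(x)|)\,dx=\lambda_j$,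 $j=1,\dots,k$ (no constraints if $k=0$). A minimizer is a $u\in\mathcal X$ satisfying the constraints with $E(u)\le E(v)$ for all $v\in\mathcal X$ satisfying the constraints. **Reflections.** For a hyperplane $\Pi$, let $\Pi^+,\Pi^-$ be the two open half-spaces it determines and $s_\Pi$ the reflection across $\Pi$. For $\Pi$ containing the origin and $f$ defined on $\Omega$, set $f_{\Pi^+}(x)=f(x)$ if $x\in\Pi^+\cup\Pi$ and $f_{\Pi^+}(x)=f(s_\Pi(x))$ if $x\in\Pi^-$; set $f_{\Pi^-}(x)=f(x)$ if $x\in\Pi^-\cup\Pi$ and $f_{\Pi^-}(x)=f(s_\Pi(x))$ if $x\in\Pi^+$. **Radial symmetry.** For an affine subspace $V$ of $\mathbb R^N$ let $p_V$ be the orthogonal projection onto $V$. A function $f$ on $\Omega$ is radially symmetric with respect to $V$ if there is a function $\tilde f$ on $V\times[0,\infty)$ such that $f(x)=\tilde f(p_V(x),|x-p_V(x)|)$ for all $x\in\Omega$. *)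

theory Defs
  imports "HOL-Analysis.Analysis"
begin

section \<open>Differentiability classes\<close>

text \<open>\<open>Ck_on k \<Omega> f\<close> is only meant for open \<open>\<Omega>\<close>: all iterated directional derivatives of \<open>f\<close>
  up to order \<open>k\<close> exist (as Frechet derivatives) and are continuous on \<open>\<Omega>\<close>.\<close>

fun Ck_on :: "nat \<Rightarrow> 'a::euclidean_space set \<Rightarrow> ('a \<Rightarrow> 'b::real_normed_vector) \<Rightarrow> bool" where
  "Ck_on 0 \<Omega> f \<longleftrightarrow> continuous_on \<Omega> f"
| "Ck_on (Suc k) \<Omega> f \<longleftrightarrow>
     (\<forall>x\<in>\<Omega>. f differentiable (at x)) \<and>
     (\<forall>h. Ck_on k \<Omega> (\<lambda>x. frechet_derivative f (at x) h))"

text \<open>\<open>C\<^sub>c\<^sup>\<infinity>(\<Omega>)\<close>, with functions extended by zero outside \<open>\<Omega>\<close>.\<close>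

definition test_function :: "'a::euclidean_space set \<Rightarrow> ('a \<Rightarrow> real) \<Rightarrow> bool" where
  "test_function \<Omega> \<phi> \<longleftrightarrow>
     (\<forall>k. Ck_on k UNIV \<phi>) \<and> (\<exists>K. compact K \<and> K \<subseteq> \<Omega> \<and> (\<forall>x. x \<notin> K \<longrightarrow> \<phi> x = 0))"

section \<open>Weak gradients\<close>

definition ae_eq_on :: "'a::euclidean_space set \<Rightarrow> ('a \<Rightarrow> 'b) \<Rightarrow> ('a \<Rightarrow> 'b) \<Rightarrow> bool" where
  "ae_eq_on \<Omega> v w \<longleftrightarrow> (AE x in lebesgue. x \<in> \<Omega> \<longrightarrow> v x = w x)"

definition locally_integrable_on ::
    "'a::euclidean_space set \<Rightarrow> ('a \<Rightarrow> 'b::euclidean_space) \<Rightarrow> bool" where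
  "locally_integrable_on \<Omega> v \<longleftrightarrow>
     (\<forall>K. compact K \<and> K \<subseteq> \<Omega> \<longrightarrow> set_integrable lebesgue K v)"

text \<open>The entry \<open>D x $ i $ j\<close> is the weak derivative \<open>\<partial>v\<^sub>i/\<partial>x\<^sub>j\<close> at \<open>x\<close>. The library norm of
  the matrix \<open>D x\<close> is its Euclidean (Frobenius) norm.\<close>

definition has_weak_gradient ::
    "(real^'N) set \<Rightarrow> (real^'N \<Rightarrow> real^'n) \<Rightarrow> (real^'N \<Rightarrow> real^'N^'n) \<Rightarrow> bool" where
  "has_weak_gradient \<Omega> v D \<longleftrightarrow>
     locally_integrable_on \<Omega> v \<and> locally_integrable_on \<Omega> D \<and>
     (\<forall>\<phi> i j. test_function \<Omega> \<phi> \<longrightarrow>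
        (LINT x:\<Omega>|lebesgue. v x $ i * frechet_derivative \<phi> (at x) (axis j 1)) =
        - (LINT x:\<Omega>|lebesgue. D x $ i $ j * \<phi> x))"

text \<open>Weak gradients are unique almost everywhere on \<open>\<Omega>\<close>, so the choice of representative
  is immaterial for the integrals below.\<close>

definition weak_gradient ::
    "(real^'N) set \<Rightarrow> (real^'N \<Rightarrow> real^'n) \<Rightarrow> real^'N \<Rightarrow> real^'N^'n" where
  "weak_gradient \<Omega> v = (SOME D. has_weak_gradient \<Omega> v D)"

text \<open>A space of functions on \<open>\<Omega>\<close> modulo almost everywhere equality is given by the set of all
  representatives of its classes, extended arbitrarily outside \<open>\<Omega>\<close>.\<close>

definition function_space :: "(real^'N) set \<Rightarrow> (real^'N \<Rightarrow> real^'n) set \<Rightarrow> bool" where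
  "function_space \<Omega> X \<longleftrightarrow>
     (\<forall>v\<in>X. \<exists>D. has_weak_gradient \<Omega> v D) \<and>
     (\<forall>v\<in>X. \<forall>w. ae_eq_on \<Omega> v w \<longrightarrow> w \<in> X)"

definition C1_representative ::
    "(real^'N) set \<Rightarrow> (real^'N \<Rightarrow> real^'n) \<Rightarrow> (real^'N \<Rightarrow> real^'n) \<Rightarrow> bool" where
  "C1_representative \<Omega> v w \<longleftrightarrow> ae_eq_on \<Omega> v w \<and> Ck_on 1 \<Omega> w"

section \<open>The minimization problem\<close>

text \<open>The integrands are total functions here; only their values on
  \<open>A\<^sub>\<Omega> \<times> \<real>\<^sup>n \<times> [0,\<infinity>)\<close> enter.\<close>

definition integrand ::
    "(real^'N) set \<Rightarrow> (real \<Rightarrow> real^'n \<Rightarrow> real \<Rightarrow> real) \<Rightarrow> (real^'N \<Rightarrow> real^'n) \<Rightarrow> real^'N \<Rightarrow> real" where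
  "integrand \<Omega> F v x = F (norm x) (v x) (norm (weak_gradient \<Omega> v x))"

definition functional ::
    "(real^'N) set \<Rightarrow> (real \<Rightarrow> real^'n \<Rightarrow> real \<Rightarrow> real) \<Rightarrow> (real^'N \<Rightarrow> real^'n) \<Rightarrow> real" where
  "functional \<Omega> F v = (LINT x:\<Omega>|lebesgue. integrand \<Omega> F v x)"

definition admissible ::
    "(real^'N) set \<Rightarrow> (real^'N \<Rightarrow> real^'n) set \<Rightarrow> nat \<Rightarrow>
     (nat \<Rightarrow> real \<Rightarrow> real^'n \<Rightarrow> real \<Rightarrow> real) \<Rightarrow> (nat \<Rightarrow> real) \<Rightarrow> (real^'N \<Rightarrow> real^'n) set" where
  "admissible \<Omega> X k G lam = {v \<in> X. \<forall>j\<in>{1..k}. functional \<Omega> (G j) v = lam j}"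

definition minimizer ::
    "(real^'N) set \<Rightarrow> (real^'N \<Rightarrow> real^'n) set \<Rightarrow> (real \<Rightarrow> real^'n \<Rightarrow> real \<Rightarrow> real) \<Rightarrow> nat \<Rightarrow>
     (nat \<Rightarrow> real \<Rightarrow> real^'n \<Rightarrow> real \<Rightarrow> real) \<Rightarrow> (nat \<Rightarrow> real) \<Rightarrow> (real^'N \<Rightarrow> real^'n) \<Rightarrow> bool" where
  "minimizer \<Omega> X F k G lam u \<longleftrightarrow>
     u \<in> admissible \<Omega> X k G lam \<and>
     (\<forall>v\<in>admissible \<Omega> X k G lam. functional \<Omega> F u \<le> functional \<Omega> F v)"

section \<open>Rotations, reflections and radial symmetry\<close>

definition rotation_invariant :: "(real^'N) set \<Rightarrow> bool" where
  "rotation_invariant \<Omega> \<longleftrightarrow> (\<forall>Q. rotation_matrix Q \<longrightarrow> (\<lambda>x. Q *v x) ` \<Omega> = \<Omega>)"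

text \<open>A hyperplane through the origin is \<open>\<Pi> = {x. a \<bullet> x = 0}\<close> with a normal vector \<open>a \<noteq> 0\<close>, and
  \<open>\<Pi>\<^sup>+\<close>, \<open>\<Pi>\<^sup>-\<close> are \<open>{x. a \<bullet> x > 0}\<close>, \<open>{x. a \<bullet> x < 0}\<close>. The function \<open>hyperplane_reflection a\<close> is
  \<open>s\<^sub>\<Pi>\<close>, and \<open>reflect_plus a f\<close>, \<open>reflect_minus a f\<close> are the symmetrizations of \<open>f\<close> that keep its
  values on \<open>\<Pi>\<^sup>+\<close>, \<open>\<Pi>\<^sup>-\<close> respectively.\<close>

definition hyperplane_reflection :: "'a::euclidean_space \<Rightarrow> 'a \<Rightarrow> 'a" where
  "hyperplane_reflection a x = x - (2 * (a \<bullet> x) / (a \<bullet> a)) *\<^sub>R a"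

definition reflect_plus :: "'a::euclidean_space \<Rightarrow> ('a \<Rightarrow> 'b) \<Rightarrow> 'a \<Rightarrow> 'b" where
  "reflect_plus a f x = (if a \<bullet> x \<ge> 0 then f x else f (hyperplane_reflection a x))"

definition reflect_minus :: "'a::euclidean_space \<Rightarrow> ('a \<Rightarrow> 'b) \<Rightarrow> 'a \<Rightarrow> 'b" where
  "reflect_minus a f x = (if a \<bullet> x \<le> 0 then f x else f (hyperplane_reflection a x))"

text \<open>Intended for nonempty affine \<open>V\<close>, for which the point described exists and is unique.\<close>

definition orth_proj :: "'a::euclidean_space set \<Rightarrow> 'a \<Rightarrow> 'a" where
  "orth_proj V x = (THE p. p \<in> V \<and> (\<forall>y\<in>V. orthogonal (x - p) (y - p)))"

definition radially_symmetric_on ::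
    "'a::euclidean_space set \<Rightarrow> 'a set \<Rightarrow> ('a \<Rightarrow> 'b) \<Rightarrow> bool" where
  "radially_symmetric_on \<Omega> V f \<longleftrightarrow>
     (\<exists>ft :: 'a \<Rightarrow> real \<Rightarrow> 'b. \<forall>x\<in>\<Omega>. f x = ft (orth_proj V x) (norm (x - orth_proj V x)))"

end

theory Submission
  imports Defs "HOL-Homology.Invariance_of_Domain"
begin

text \<open>
  Call \<open>e \<noteq> 0\<close> splitting for \<open>f\<close> if the hyperplane orthogonal to \<open>e\<close> cuts every constraint integral
  of \<open>f\<close> in two equal halves. By the Borsuk-Ulam theorem every subspace of dimension \<open>k + 1\<close>
  contains a splitting direction, and then both symmetrizations of a minimizer \<open>f\<close> across that
  hyperplane are minimizers. As they are \<open>C\<^sup>1\<close>, the normal derivative of \<open>f\<close> vanishes on the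
  hyperplane.

  If \<open>f\<close> is already symmetric across \<open>N - k\<close> orthogonal hyperplanes, then every direction in the
  span of their normals is splitting, the differential of \<open>f\<close> is radial along this span, and \<open>f\<close> is
  radially symmetric. If \<open>f\<close> has fewer orthogonal symmetries, choose a splitting \<open>e\<close> orthogonal to
  their normals. By downward induction \<open>f\<close> agrees on the two half-spaces with functions invariant
  under the rotations of subspaces \<open>P\<^sub>1\<close> and \<open>P\<^sub>2\<close> containing \<open>e\<close>. To reconcile them, take a second
  splitting direction \<open>e'\<close> neither parallel nor orthogonal to \<open>e\<close>: in the four regions cut out by the
  two hyperplanes, \<open>f\<close> is invariant under two rotation groups whose subspaces are not orthogonal,
  which forces its differential to be radial along their sum. On the hyperplane orthogonal to \<open>e\<close>
  the differential is thus radial along \<open>P\<^sub>1 + P\<^sub>2\<close>. So \<open>f\<close> is rotation invariant along \<open>P\<^sub>1 + P\<^sub>2\<close> on this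
  hyperplane, and then everywhere, because every orbit meets the hyperplane.
\<close>

section \<open>The Borsuk-Ulam theorem\<close>

text \<open>The obstacle is that a splitting direction makes both symmetrizations minimizers without
  making \<open>f\<close> itself symmetric. The two halves may carry different rotation subspaces,
  and differentiability across the hyperplane is the only link between them. Regularity is therefore
  applied to symmetrizations of symmetrizations, and the induction runs over all minimizers. The
  codimension N - k is at least 2 so that spheres in the subspaces found are connected and arcs of
  great circles join their points. For Borsuk-Ulam, degrees are compared: an odd self-map of a
  sphere that preserves the equator has on the sphere and on the equator degrees of equal parity. A
  general odd map does not preserve the equator and is first deformed into one that does. The
  deformation needs a point outside the image of a sphere of smaller dimension, which
  differentiability guarantees and continuity does not. So continuous functions are reached last,
  through polynomial approximation.\<close>

lemma nsphere_top_of_set: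
  "nsphere n = top_of_set {x. (\<Sum>i\<le>n. (x i)\<^sup>2) = 1 \<and> (\<forall>i>n. x i = 0)}"
  by (simp add: nsphere euclidean_product_topology)

section \<open>Normalized maps into spheres and their Brouwer degree\<close>

definition sphere_normalize :: "nat \<Rightarrow> (nat \<Rightarrow> real) \<Rightarrow> nat \<Rightarrow> real" where
  "sphere_normalize n y = (\<lambda>i. if i \<le> n then y i / sqrt (\<Sum>j\<le>n. (y j)\<^sup>2) else 0)"

lemma sum_squares_pos:
  fixes y :: "nat \<Rightarrow> real"
  assumes "\<exists>i\<le>n. y i \<noteq> 0"
  shows "(\<Sum>j\<le>n. (y j)\<^sup>2) > 0"
proof -
  obtain i where "i \<le> n" "y i \<noteq> 0" using assms by blast
  then show ?thesis by (intro sum_pos2[of _ i]) auto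
qed

lemma sphere_normalize_in_nsphere:
  assumes "\<exists>i\<le>n. y i \<noteq> 0"
  shows "sphere_normalize n y \<in> topspace (nsphere n)"
proof -
  have "(\<Sum>i\<le>n. (sphere_normalize n y i)\<^sup>2) = (\<Sum>i\<le>n. (y i)\<^sup>2 / (\<Sum>j\<le>n. (y j)\<^sup>2))"
    by (intro sum.cong) (auto simp: sphere_normalize_def power_divide sum_nonneg)
  also have "\<dots> = 1"
    using sum_squares_pos[OF assms] by (simp add: sum_divide_distrib[symmetric])
  finally show ?thesis
    by (simp add: nsphere_top_of_set sphere_normalize_def)
qed

lemma continuous_on_sphere_normalize:
  assumes "\<And>i. i \<le> n \<Longrightarrow> continuous_on S (\<lambda>x. g x i)"
    and "\<And>x. x \<in> S \<Longrightarrow> \<exists>i\<le>n. g x i \<noteq> 0"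
  shows "continuous_on S (\<lambda>x. sphere_normalize n (g x))"
proof (rule continuous_on_coordinatewise_then_product)
  fix i
  have "sqrt (\<Sum>j\<le>n. (g x j)\<^sup>2) \<noteq> 0" if "x \<in> S" for x
    using sum_squares_pos[OF assms(2)[OF that]] by simp
  then show "continuous_on S (\<lambda>x. sphere_normalize n (g x) i)"
    by (cases "i \<le> n") (auto simp: sphere_normalize_def intro!: continuous_intros assms(1))
qed

lemma sphere_normalize_uminus: "sphere_normalize n (\<lambda>i. - y i) = (\<lambda>i. - sphere_normalize n y i)"
  by (auto simp: sphere_normalize_def)

lemma sphere_normalize_cong:
  "(\<And>i. i \<le> n \<Longrightarrow> y i = z i) \<Longrightarrow> sphere_normalize n y = sphere_normalize n z"
  by (auto simp: sphere_normalize_def)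

lemma nsphere_mono: "x \<in> topspace (nsphere n) \<Longrightarrow> x \<in> topspace (nsphere (Suc n))"
  by (auto simp: nsphere_top_of_set intro: Suc_lessD)

text \<open>Homotopies can thus be written down in Euclidean space; it only has to be checked that
  their components have no common zero.\<close>

lemma Brouwer_degree2_normalized_homotopy:
  fixes h :: "real \<Rightarrow> (nat \<Rightarrow> real) \<Rightarrow> nat \<Rightarrow> real"
  assumes cont: "\<And>i. i \<le> n \<Longrightarrow>
      continuous_on ({0..1} \<times> topspace (nsphere n)) (\<lambda>p. h (fst p) (snd p) i)"
    and nz: "\<And>t x. t \<in> {0..1} \<Longrightarrow> x \<in> topspace (nsphere n) \<Longrightarrow> \<exists>i\<le>n. h t x i \<noteq> 0"
  shows "Brouwer_degree2 n (\<lambda>x. sphere_normalize n (h 0 x)) =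
         Brouwer_degree2 n (\<lambda>x. sphere_normalize n (h 1 x))"
proof (rule Brouwer_degree2_homotopic)
  let ?H = "\<lambda>p. sphere_normalize n (h (fst p) (snd p))"
  have "continuous_on ({0..1} \<times> topspace (nsphere n)) ?H"
    using nz by (intro continuous_on_sphere_normalize cont) auto
  moreover have "?H ` ({0..1} \<times> topspace (nsphere n)) \<subseteq> topspace (nsphere n)"
    using sphere_normalize_in_nsphere nz by fastforce
  ultimately have "continuous_map (prod_topology (top_of_set {0..1}) (nsphere n)) (nsphere n) ?H"
    by (simp add: nsphere_top_of_set image_subset_iff_funcset)
  then show "homotopic_with (\<lambda>x. True) (nsphere n) (nsphere n)
      (\<lambda>x. sphere_normalize n (h 0 x)) (\<lambda>x. sphere_normalize n (h 1 x))"
    unfolding homotopic_with_def by (intro exI[of _ ?H]) auto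
qed

text \<open>An odd self-map of the two-point sphere is the identity or the antipodal map, hence an
  involution, and the square of its degree is 1.\<close>

lemma Brouwer_degree2_odd_0:
  assumes cf: "continuous_map (nsphere 0) (nsphere 0) f"
    and odd: "\<And>x. x \<in> topspace (nsphere 0) \<Longrightarrow> f (\<lambda>i. - x i) = (\<lambda>i. - f x i)"
  shows "odd (Brouwer_degree2 0 f)"
proof -
  define p :: "nat \<Rightarrow> real" where "p = (\<lambda>i. if i = 0 then 1 else 0)"
  have S: "x = p \<or> x = (\<lambda>i. - p i)" if "x \<in> topspace (nsphere 0)" for x
  proof -
    have "(x 0)\<^sup>2 = 1" "\<forall>i>0. x i = 0" using that by (auto simp: nsphere_top_of_set)
    then show ?thesis by (auto simp: p_def power2_eq_1_iff fun_eq_iff)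
  qed
  have p: "p \<in> topspace (nsphere 0)"
    by (simp add: nsphere_top_of_set p_def)
  have fp: "f p \<in> topspace (nsphere 0)"
    using cf p continuous_map_image_subset_topspace by blast
  have "f (f x) = x" if "x \<in> topspace (nsphere 0)" for x
    using S[OF that] S[OF fp] odd[OF p] by (auto simp: )
  then have "Brouwer_degree2 0 (f \<circ> f) = 1"
    by (metis Brouwer_degree2_eq Brouwer_degree2_id comp_apply id_apply)
  then show ?thesis
    using Brouwer_degree2_compose[OF cf cf] by (metis dvd_mult odd_one)
qed

text \<open>Stretching a point with \<open>norm (f x) = 1\<close> slightly moves it out of the
  convex set \<open>{x. norm (f x) \<le> 1}\<close>. So these points lie in the frontier of a convex
  set, which is null.\<close>

lemma negligible_cylinder:
  fixes f :: "'a::euclidean_space \<Rightarrow> 'b::real_normed_vector"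
  assumes "linear f"
  shows "negligible {x. norm (f x) = 1}"
proof (rule negligible_subset[OF negligible_convex_frontier])
  interpret linear f by fact
  have "{x. norm (f x) \<le> 1} = f -` cball 0 1" by auto
  then show "convex {x. norm (f x) \<le> 1}"
    using convex_linear_vimage[OF assms convex_cball] by simp
  show "{x. norm (f x) = 1} \<subseteq> frontier {x. norm (f x) \<le> 1}"
  proof
    fix x assume "x \<in> {x. norm (f x) = 1}"
    then have x: "norm (f x) = 1" by simp
    show "x \<in> frontier {x. norm (f x) \<le> 1}"
      unfolding frontier_straddle
    proof (intro allI impI conjI)
      fix e :: real assume "0 < e"
      show "\<exists>y\<in>{x. norm (f x) \<le> 1}. dist x y < e"
        using x \<open>0 < e\<close> by (intro bexI[of _ x]) auto
      define d where "d = e / (2 * (norm x + 1))"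
      have d: "d > 0" using \<open>0 < e\<close> by (simp add: d_def add_nonneg_pos)
      have "norm (f ((1 + d) *\<^sub>R x)) = 1 + d"
        using x d by (simp add: scale)
      moreover have "dist x ((1 + d) *\<^sub>R x) = d * norm x"
        using d by (simp add: dist_norm scaleR_add_left)
      moreover have "d * norm x < e"
      proof -
        have "d * norm x \<le> d * (norm x + 1)" using d by simp
        also have "\<dots> = e / 2"
          by (simp add: d_def field_simps add_nonneg_eq_0_iff)
        finally show ?thesis using \<open>0 < e\<close> by simp
      qed
      ultimately show "\<exists>y. y \<notin> {x. norm (f x) \<le> 1} \<and> dist x y < e"
        using d by (intro exI[of _ "(1 + d) *\<^sub>R x"]) auto
    qed
  qed
qed

section \<open>Odd maps of spheres: general position and parity of the degree\<close>

locale basis_enumeration =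
  fixes bs :: "nat \<Rightarrow> 'a::euclidean_space"
  assumes bs: "bij_betw bs {..<DIM('a)} Basis"
begin

text \<open>The spheres that carry a degree consist of real sequences, while differentiability is a
  matter of Euclidean spaces; \<open>embed\<close> translates.\<close>

definition embed :: "(nat \<Rightarrow> real) \<Rightarrow> 'a" where
  "embed x = (\<Sum>i<DIM('a). x i *\<^sub>R bs i)"

lemma bs_inner: "i < DIM('a) \<Longrightarrow> j < DIM('a) \<Longrightarrow> bs i \<bullet> bs j = (if i = j then 1 else 0)"
  using bij_betwE[OF bs] bij_betw_imp_inj_on[OF bs] by (auto simp: inner_Basis dest: inj_onD)

lemma embed_inner: "j < DIM('a) \<Longrightarrow> embed x \<bullet> bs j = x j"
  by (simp add: embed_def inner_sum_left bs_inner if_distrib cong: if_cong)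

lemma embed_uminus: "embed (\<lambda>i. - x i) = - embed x"
  by (simp add: embed_def sum_negf)

lemma continuous_on_embed: "continuous_on S embed"
  unfolding embed_def
  by (intro continuous_intros continuous_on_product_then_coordinatewise[OF continuous_on_id])

text \<open>The excluded \<open>c\<close> form the image of a sphere under a differentiable map into a space of larger
  dimension. To stay within one type, both are multiplied by the orthogonal complement.\<close>

lemma general_position:
  fixes \<Phi> :: "nat \<Rightarrow> 'a \<Rightarrow> real"
  assumes m: "Suc m < DIM('a)"
    and diff: "\<And>i x. i \<le> Suc m \<Longrightarrow> \<Phi> i differentiable (at x)"
    and nz: "\<And>x. x \<in> topspace (nsphere m) \<Longrightarrow> \<exists>i\<le>Suc m. \<Phi> i (embed x) \<noteq> 0"
  obtains c where "\<And>x. x \<in> topspace (nsphere m) \<Longrightarrow>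
    \<exists>i\<le>m. \<Phi> i (embed x) - c i * \<Phi> (Suc m) (embed x) \<noteq> 0"
proof -
  define \<pi> where "\<pi> x = (\<Sum>i\<le>m. (x \<bullet> bs i) *\<^sub>R bs i)" for x :: 'a
  have lin: "linear \<pi>"
    unfolding \<pi>_def by (rule linearI) (auto simp: inner_left_distrib scaleR_left_distrib sum.distrib scaleR_sum_right)
  define S where "S = {x. norm (\<pi> x) = 1 \<and> \<Phi> (Suc m) (\<pi> x) \<noteq> 0}"
  define \<psi> where "\<psi> x = (\<Sum>i\<le>m. (\<Phi> i (\<pi> x) / \<Phi> (Suc m) (\<pi> x)) *\<^sub>R bs i) +
      (\<Sum>i\<in>{m<..<DIM('a)}. (x \<bullet> bs i) *\<^sub>R bs i)" for x
  have "negligible S"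
    by (rule negligible_subset[OF negligible_cylinder[OF lin]]) (auto simp: S_def)
  moreover have "\<psi> differentiable_on S"
  proof -
    have d: "(\<lambda>x. \<Phi> i (\<pi> x)) differentiable (at x within S)" if "i \<le> Suc m" for i x
    proof -
      have "\<pi> differentiable (at x)"
        using lin linear_imp_differentiable by blast
      then have "(\<Phi> i \<circ> \<pi>) differentiable (at x)"
        using diff[OF that] differentiable_chain_at by blast
      then show ?thesis
        by (simp add: o_def differentiable_at_withinI)
    qed
    show ?thesis
      unfolding differentiable_on_def \<psi>_def
      by (intro ballI differentiable_add differentiable_sum differentiable_scaleR
          differentiable_divide d differentiable_inner differentiable_const differentiable_ident)
         (auto simp: S_def)
  qed
  ultimately have "negligible (\<psi> ` S)"
    by (intro negligible_differentiable_image_negligible) auto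
  then obtain y where y: "y \<notin> \<psi> ` S"
    using non_negligible_UNIV by (metis UNIV_eq_I)
  show thesis
  proof (rule that[of "\<lambda>i. y \<bullet> bs i"], rule ccontr)
    fix x assume x: "x \<in> topspace (nsphere m)"
      and "\<not> (\<exists>i\<le>m. \<Phi> i (embed x) - (y \<bullet> bs i) * \<Phi> (Suc m) (embed x) \<noteq> 0)"
    then have eq: "\<Phi> i (embed x) = (y \<bullet> bs i) * \<Phi> (Suc m) (embed x)" if "i \<le> m" for i
      using that by auto
    have n0: "\<Phi> (Suc m) (embed x) \<noteq> 0"
      using eq nz[OF x] by (metis le_Suc_eq mult_zero_right)
    have x2: "(\<Sum>i\<le>m. (x i)\<^sup>2) = 1" "\<And>i. i > m \<Longrightarrow> x i = 0"
      using x by (auto simp: nsphere_top_of_set)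
    \<comment> \<open>The coordinates of x up to m and those of y beyond, so that \<psi> maps z to
      y.\<close>
    define z where "z = embed x + (\<Sum>i\<in>{m<..<DIM('a)}. (y \<bullet> bs i) *\<^sub>R bs i)"
    have zb: "z \<bullet> bs j = (if j \<le> m then x j else y \<bullet> bs j)" if "j < DIM('a)" for j
    proof -
      have "(\<Sum>i\<in>{m<..<DIM('a)}. (y \<bullet> bs i) * (bs i \<bullet> bs j)) =
            (\<Sum>i\<in>{m<..<DIM('a)}. if i = j then y \<bullet> bs j else 0)"
        using that by (intro sum.cong) (auto simp: bs_inner)
      then show ?thesis
        using that x2(2)[of j]
        by (auto simp: z_def inner_add_left inner_sum_left embed_inner)
    qed
    have emb: "embed x = (\<Sum>i\<le>m. x i *\<^sub>R bs i)"
      unfolding embed_def using m x2(2) by (intro sum.mono_neutral_right) auto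
    have pz: "\<pi> z = embed x"
      unfolding \<pi>_def emb using m by (intro sum.cong) (auto simp: zb)
    have "(norm (embed x))\<^sup>2 = 1"
    proof -
      have "embed x \<bullet> embed x = (\<Sum>i\<le>m. x i * (embed x \<bullet> bs i))"
        by (subst (2) emb) (simp add: inner_sum_right)
      also have "\<dots> = 1"
        using m x2(1) by (simp add: embed_inner power2_eq_square)
      finally show ?thesis by (simp add: power2_norm_eq_inner)
    qed
    then have "z \<in> S"
      using n0 by (simp add: S_def pz power2_eq_1_iff) (metis abs_norm_cancel abs_numeral(1) norm_ge_zero power2_eq_1_iff abs_1 abs_minus_cancel)
    moreover have "\<psi> z = y"
    proof -
      have "\<psi> z = (\<Sum>i\<le>m. (y \<bullet> bs i) *\<^sub>R bs i) + (\<Sum>i\<in>{m<..<DIM('a)}. (y \<bullet> bs i) *\<^sub>R bs i)"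
        unfolding \<psi>_def pz using n0 m by (intro arg_cong2[where f="(+)"] sum.cong) (auto simp: eq zb)
      also have "\<dots> = (\<Sum>i\<in>{..m} \<union> {m<..<DIM('a)}. (y \<bullet> bs i) *\<^sub>R bs i)"
        by (rule sum.union_disjoint[symmetric]) auto
      also have "{..m} \<union> {m<..<DIM('a)} = {..<DIM('a)}" using m by auto
      also have "(\<Sum>i<DIM('a). (y \<bullet> bs i) *\<^sub>R bs i) = (\<Sum>b\<in>Basis. (y \<bullet> b) *\<^sub>R b)"
        by (rule sum.reindex_bij_betw[OF bs])
      also have "\<dots> = y" by (rule euclidean_representation)
      finally show ?thesis .
    qed
    ultimately show False using y by blast
  qed
qed

text \<open>The map is deformed into an odd map that preserves the equator. Its degree has the
  parity of the degree of its restriction to the equator, which is odd by induction.\<close>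

lemma odd_map_degree_odd:
  fixes \<Phi> :: "nat \<Rightarrow> 'a \<Rightarrow> real"
  assumes "n < DIM('a)"
    and "\<And>i x. i \<le> n \<Longrightarrow> \<Phi> i differentiable (at x)"
    and "\<And>i x. i \<le> n \<Longrightarrow> \<Phi> i (- x) = - \<Phi> i x"
    and "\<And>x. x \<in> topspace (nsphere n) \<Longrightarrow> \<exists>i\<le>n. \<Phi> i (embed x) \<noteq> 0"
  shows "odd (Brouwer_degree2 n (\<lambda>x. sphere_normalize n (\<lambda>i. \<Phi> i (embed x))))"
  using assms
proof (induction n arbitrary: \<Phi>)
  case 0
  have c: "continuous_on S (\<lambda>x. \<Phi> 0 (embed x))" for S
  proof -
    have "continuous_on UNIV (\<Phi> 0)"
      using 0(2) by (simp add: continuous_on_eq_continuous_at differentiable_imp_continuous_within)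
    then show ?thesis
      using continuous_on_compose2[OF _ continuous_on_embed] by blast
  qed
  show ?case
  proof (rule Brouwer_degree2_odd_0)
    have "continuous_on (topspace (nsphere 0)) (\<lambda>x. sphere_normalize 0 (\<lambda>i. \<Phi> i (embed x)))"
      using 0(4) c by (intro continuous_on_sphere_normalize) auto
    moreover have "(\<lambda>x. sphere_normalize 0 (\<lambda>i. \<Phi> i (embed x))) ` topspace (nsphere 0) \<subseteq> topspace (nsphere 0)"
      using 0(4) sphere_normalize_in_nsphere by (force simp del: topspace_euclidean_subtopology)
    ultimately show "continuous_map (nsphere 0) (nsphere 0) (\<lambda>x. sphere_normalize 0 (\<lambda>i. \<Phi> i (embed x)))"
      by (simp add: nsphere_top_of_set image_subset_iff_funcset)
    fix x
    show "sphere_normalize 0 (\<lambda>i. \<Phi> i (embed (\<lambda>i. - x i))) = (\<lambda>i. - sphere_normalize 0 (\<lambda>i. \<Phi> i (embed x)) i)"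
      using 0(3) by (subst sphere_normalize_uminus[symmetric], intro sphere_normalize_cong) (simp add: embed_uminus)
  qed
next
  case (Suc m)
  have m: "Suc m < DIM('a)" by fact
  have nzm: "\<exists>i\<le>Suc m. \<Phi> i (embed x) \<noteq> 0" if "x \<in> topspace (nsphere m)" for x
    using Suc.prems(4) nsphere_mono[OF that] by blast
  obtain c where c: "\<And>x. x \<in> topspace (nsphere m) \<Longrightarrow>
      \<exists>i\<le>m. \<Phi> i (embed x) - c i * \<Phi> (Suc m) (embed x) \<noteq> 0"
    using general_position[OF m Suc.prems(2) nzm] by blast
  define \<Psi> where "\<Psi> i x = \<Phi> i x - c i * \<Phi> (Suc m) x" for i x
  have oddm: "odd (Brouwer_degree2 m (\<lambda>x. sphere_normalize m (\<lambda>i. \<Psi> i (embed x))))"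
  proof (rule Suc.IH)
    show "\<Psi> i differentiable at x" if "i \<le> m" for i x
      unfolding \<Psi>_def using that by (intro differentiable_diff differentiable_mult differentiable_const Suc.prems(2)) auto
    show "\<Psi> i (- x) = - \<Psi> i x" if "i \<le> m" for i x
      using that by (simp add: \<Psi>_def Suc.prems(3))
  qed (use m c in \<open>auto simp: \<Psi>_def\<close>)
  \<comment> \<open>At t = 1 the last component carries the factor
    \<open>\<bar>x (Suc m)\<bar>\<close>, which vanishes on the equator and, being even, preserves
    oddness. The other components are then those of \<Psi>.\<close>
  define h where "h t x i = (if i \<le> m then \<Phi> i (embed x) - t * c i * \<Phi> (Suc m) (embed x)
      else (1 - t + t * \<bar>x (Suc m)\<bar>) * \<Phi> (Suc m) (embed x))" for t :: real and x i
  define f where "f x = sphere_normalize (Suc m) (h 1 x)" for x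
  \<comment> \<open>The factor of the last component is zero only for t = 1 on the equator, where
    the choice of c helps. Elsewhere a common zero of h would be a common zero of all
    \<Phi>.\<close>
  have nz: "\<exists>i\<le>Suc m. h t x i \<noteq> 0" if t: "t \<in> {0..1}" and x: "x \<in> topspace (nsphere (Suc m))" for t x
  proof (cases "t = 1 \<and> x (Suc m) = 0")
    case True
    then have "x \<in> topspace (nsphere m)"
      using topspace_nsphere_minus1[OF x] by simp
    then obtain i where "i \<le> m" "\<Phi> i (embed x) - c i * \<Phi> (Suc m) (embed x) \<noteq> 0"
      using c by blast
    then show ?thesis using True by (intro exI[of _ i]) (auto simp: h_def)
  next
    case False
    then have pos: "1 - t + t * \<bar>x (Suc m)\<bar> > 0"
      using t by (cases "t = 1") (auto intro: add_pos_nonneg)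
    show ?thesis
    proof (rule ccontr)
      assume *: "\<not> ?thesis"
      then have "h t x (Suc m) = 0" by auto
      then have "\<Phi> (Suc m) (embed x) = 0" using pos by (simp add: h_def)
      moreover have "\<Phi> i (embed x) = 0" if "i \<le> m" for i
        using * that calculation by (auto simp: h_def dest: spec[of _ i])
      ultimately show False using Suc.prems(4)[OF x] le_Suc_eq by metis
    qed
  qed
  have cont\<Phi>: "continuous_on S (\<lambda>p. \<Phi> i (embed (g p)))"
    if "i \<le> Suc m" "continuous_on S g" for i S and g :: "'b::topological_space \<Rightarrow> _"
  proof -
    have "continuous_on UNIV (\<Phi> i)"
      using Suc.prems(2)[OF that(1)]
      by (simp add: continuous_on_eq_continuous_at differentiable_imp_continuous_within)
    moreover have "continuous_on S (\<lambda>p. embed (g p))"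
      using continuous_on_compose2[OF continuous_on_embed that(2)] by blast
    ultimately show ?thesis
      using continuous_on_compose2 by blast
  qed
  have conth: "continuous_on S (\<lambda>p. h (fst p) (snd p) i)" if "i \<le> Suc m" for i S
    unfolding h_def
    by (cases "i \<le> m")
       (auto intro!: continuous_intros cont\<Phi> continuous_on_product_then_coordinatewise[OF continuous_on_snd[OF continuous_on_id]])
  have "Brouwer_degree2 (Suc m) (\<lambda>x. sphere_normalize (Suc m) (\<lambda>i. \<Phi> i (embed x))) =
        Brouwer_degree2 (Suc m) (\<lambda>x. sphere_normalize (Suc m) (h 0 x))"
    by (intro arg_cong[where f="Brouwer_degree2 (Suc m)"] ext sphere_normalize_cong)
       (auto simp: h_def le_Suc_eq)
  also have "\<dots> = Brouwer_degree2 (Suc m) f"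
    unfolding f_def using nz by (intro Brouwer_degree2_normalized_homotopy conth) auto
  finally have deg: "Brouwer_degree2 (Suc m) (\<lambda>x. sphere_normalize (Suc m) (\<lambda>i. \<Phi> i (embed x))) =
        Brouwer_degree2 (Suc m) f" .
  have f0: "f x = sphere_normalize m (\<lambda>i. \<Psi> i (embed x))" if "x \<in> topspace (nsphere m)" for x
  proof -
    have "x (Suc m) = 0" using that by (auto simp: nsphere_top_of_set)
    then show ?thesis by (auto simp: f_def sphere_normalize_def h_def \<Psi>_def)
  qed
  have "even (Brouwer_degree2 (Suc m) f - Brouwer_degree2 (Suc m - Suc 0) f)"
  proof (rule Borsuk_odd_mapping_degree_step)
    have "continuous_on (topspace (nsphere (Suc m))) f"
    proof -
      have "continuous_on (topspace (nsphere (Suc m))) (\<lambda>x. h 1 x i)" if "i \<le> Suc m" for i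
      proof -
        have "continuous_on (topspace (nsphere (Suc m))) (\<lambda>x. (1::real, x))"
          by (intro continuous_intros)
        then show ?thesis
          using continuous_on_compose2[OF conth[OF that, of UNIV]] by fastforce
      qed
      then show ?thesis
        unfolding f_def using nz by (intro continuous_on_sphere_normalize) auto
    qed
    moreover have "f ` topspace (nsphere (Suc m)) \<subseteq> topspace (nsphere (Suc m))"
      unfolding f_def using nz[of 1] sphere_normalize_in_nsphere by force
    ultimately show "continuous_map (nsphere (Suc m)) (nsphere (Suc m)) f"
      by (simp add: nsphere_top_of_set image_subset_iff_funcset)
    show "(f \<circ> (\<lambda>x i. - x i)) u = ((\<lambda>x i. - x i) \<circ> f) u" for u
      unfolding o_def f_def
      by (subst sphere_normalize_uminus[symmetric], intro sphere_normalize_cong)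
         (auto simp: h_def embed_uminus Suc.prems(3))
    show "f \<in> topspace (nsphere (Suc m - Suc 0)) \<rightarrow> topspace (nsphere (Suc m - Suc 0))"
      using c by (auto simp: f0 \<Psi>_def simp del: topspace_euclidean_subtopology intro!: sphere_normalize_in_nsphere)
  qed
  moreover have "Brouwer_degree2 m f = Brouwer_degree2 m (\<lambda>x. sphere_normalize m (\<lambda>i. \<Psi> i (embed x)))"
    by (rule Brouwer_degree2_eq) (rule f0)
  ultimately show ?case
    using oddm deg by simp
qed

text \<open>Without a common zero the normalized map would send the sphere into its equator. Missing
  a pole, it has degree 0, whereas its restriction to the equator has odd degree; but the parities
  must agree.\<close>

lemma odd_differentiable_common_zero:
  fixes \<Phi> :: "nat \<Rightarrow> 'a \<Rightarrow> real"
  assumes k: "k < DIM('a)"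
    and diff: "\<And>i x. i < k \<Longrightarrow> \<Phi> i differentiable (at x)"
    and odd: "\<And>i x. i < k \<Longrightarrow> \<Phi> i (- x) = - \<Phi> i x"
  shows "\<exists>x\<in>topspace (nsphere k). \<forall>i<k. \<Phi> i (embed x) = 0"
proof (cases k)
  case 0
  then show ?thesis using in_topspace_nsphere by auto
next
  case (Suc m)
  show ?thesis
  proof (rule ccontr)
    assume "\<not> ?thesis"
    then have nz: "\<exists>i\<le>m. \<Phi> i (embed x) \<noteq> 0" if "x \<in> topspace (nsphere (Suc m))" for x
      using that Suc less_Suc_eq_le by auto
    define f where "f x = sphere_normalize m (\<lambda>i. \<Phi> i (embed x))" for x
    have fin: "f x \<in> topspace (nsphere m)" if "x \<in> topspace (nsphere (Suc m))" for x
      unfolding f_def using nz[OF that] by (rule sphere_normalize_in_nsphere)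
    have "continuous_on (topspace (nsphere (Suc m))) f"
      unfolding f_def
    proof (rule continuous_on_sphere_normalize)
      fix i assume "i \<le> m"
      then have "continuous_on UNIV (\<Phi> i)"
        using diff[of i] Suc
        by (simp add: continuous_on_eq_continuous_at differentiable_imp_continuous_within)
      then show "continuous_on (topspace (nsphere (Suc m))) (\<lambda>x. \<Phi> i (embed x))"
        using continuous_on_compose2[OF _ continuous_on_embed] by blast
    qed (rule nz)
    moreover have "f ` topspace (nsphere (Suc m)) \<subseteq> topspace (nsphere (Suc m))"
      using fin nsphere_mono by blast
    ultimately have cf: "continuous_map (nsphere (Suc m)) (nsphere (Suc m)) f"
      by (simp add: nsphere_top_of_set image_subset_iff_funcset)
    have "even (Brouwer_degree2 (Suc m) f - Brouwer_degree2 (Suc m - Suc 0) f)"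
    proof (rule Borsuk_odd_mapping_degree_step[OF cf])
      show "(f \<circ> (\<lambda>x i. - x i)) u = ((\<lambda>x i. - x i) \<circ> f) u" for u
        unfolding o_def f_def
        by (subst sphere_normalize_uminus[symmetric], intro sphere_normalize_cong)
           (auto simp: embed_uminus odd Suc)
      show "f \<in> topspace (nsphere (Suc m - Suc 0)) \<rightarrow> topspace (nsphere (Suc m - Suc 0))"
        using fin nsphere_mono by auto
    qed
    moreover have "Brouwer_degree2 (Suc m) f = 0"
    proof -
      define q :: "nat \<Rightarrow> real" where "q i = (if i = Suc m then 1 else 0)" for i
      have "q \<in> topspace (nsphere (Suc m))"
        by (simp add: nsphere_top_of_set q_def)
      moreover have "q \<notin> f ` topspace (nsphere (Suc m))"
      proof
        assume "q \<in> f ` topspace (nsphere (Suc m))"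
        then obtain x where "q = f x" by blast
        then have "q (Suc m) = 0" by (simp add: f_def sphere_normalize_def)
        then show False by (simp add: q_def)
      qed
      ultimately have "f ` topspace (nsphere (Suc m)) \<noteq> topspace (nsphere (Suc m))"
        by blast
      then show ?thesis
        using nullhomotopic_nonsurjective_sphere_map[OF cf] Brouwer_degree2_nullhomotopic by metis
    qed
    moreover have "odd (Brouwer_degree2 m f)"
      unfolding f_def
    proof (rule odd_map_degree_odd)
      fix x assume "x \<in> topspace (nsphere m)"
      then show "\<exists>i\<le>m. \<Phi> i (embed x) \<noteq> 0" using nz nsphere_mono by blast
    qed (use k Suc diff odd in auto)
    ultimately show False by simp
  qed
qed

end

text \<open>By compactness a failure would be quantitative: the sum of the absolute values stays
  above a positive minimum. Polynomials close enough to the \<phi> then contradict this, because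
  their odd parts are differentiable and have a common zero.\<close>

theorem Borsuk_Ulam:
  fixes A :: "'a::euclidean_space set" and \<phi> :: "nat \<Rightarrow> 'a \<Rightarrow> real"
  assumes A: "subspace A" "k < dim A"
    and cont: "\<And>j. j < k \<Longrightarrow> continuous_on (A \<inter> sphere 0 1) (\<phi> j)"
    and odd: "\<And>j x. j < k \<Longrightarrow> x \<in> A \<Longrightarrow> norm x = 1 \<Longrightarrow> \<phi> j (- x) = - \<phi> j x"
  shows "\<exists>x\<in>A. norm x = 1 \<and> (\<forall>j<k. \<phi> j x = 0)"
proof -
  obtain bs :: "nat \<Rightarrow> 'a" where bs: "bij_betw bs {..<DIM('a)} Basis"
    using ex_bij_betw_nat_finite[of "Basis :: 'a set"] by (auto simp: lessThan_atLeast0)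
  interpret basis_enumeration bs by unfold_locales (rule bs)
  obtain B where B: "B \<subseteq> A" "pairwise orthogonal B" "\<And>x. x \<in> B \<Longrightarrow> norm x = 1"
    "independent B" "card B = dim A" "span B = A"
    using orthonormal_basis_subspace[OF A(1)] by metis
  obtain b where b: "bij_betw b {..<dim A} B"
    using ex_bij_betw_nat_finite[of B] B(4,5) independent_bound[of B] by (auto simp: lessThan_atLeast0)
  have bB: "b i \<in> B" if "i \<le> k" for i
    using b A(2) that by (auto simp: bij_betw_def)
  have borth: "b i \<bullet> b j = (if i = j then 1 else 0)" if "i \<le> k" "j \<le> k" for i j
  proof (cases "i = j")
    case True then show ?thesis using B(3)[OF bB[OF that(1)]] by (simp add: norm_eq_1)
  next
    case False
    then have "b i \<noteq> b j"
      using inj_on_eq_iff[OF bij_betw_imp_inj_on[OF b]] that A(2) by simp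
    then show ?thesis
      using B(2) bB that False by (auto simp: pairwise_def orthogonal_def)
  qed
  have kd: "k < DIM('a)"
    using A(2) dim_subset_UNIV[of A] by simp
  define L where "L y = (\<Sum>i\<le>k. (y \<bullet> bs i) *\<^sub>R b i)" for y
  have linL: "linear L"
    unfolding L_def by (rule linearI) (auto simp: inner_left_distrib scaleR_left_distrib sum.distrib scaleR_sum_right)
  have LA: "L (embed x) \<in> A \<inter> sphere 0 1" if x: "x \<in> topspace (nsphere k)" for x
  proof -
    have L: "L (embed x) = (\<Sum>i\<le>k. x i *\<^sub>R b i)"
      unfolding L_def using kd by (intro sum.cong) (auto simp: embed_inner)
    have "L (embed x) \<in> A"
      unfolding L using bB B(1) A(1) by (intro subspace_sum subspace_scale) auto
    moreover have "L (embed x) \<bullet> L (embed x) = 1"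
    proof -
      have "L (embed x) \<bullet> L (embed x) = (\<Sum>i\<le>k. \<Sum>j\<le>k. if i = j then x i * x j else 0)"
        unfolding L inner_sum_left inner_sum_right by (intro sum.cong refl) (auto simp: borth)
      also have "\<dots> = 1"
        using x by (simp add: nsphere_top_of_set power2_eq_square)
      finally show ?thesis .
    qed
    ultimately show ?thesis by (simp add: norm_eq_1)
  qed
  have cpt: "compact (A \<inter> sphere 0 1)"
    by (intro closed_Int_compact closed_subspace A compact_sphere)
  have "A \<inter> sphere 0 1 \<noteq> {}"
    using LA[OF in_topspace_nsphere] by blast
  moreover have "continuous_on (A \<inter> sphere 0 1) (\<lambda>x. \<Sum>j<k. \<bar>\<phi> j x\<bar>)"
    by (intro continuous_intros cont) auto
  ultimately obtain z where z: "z \<in> A \<inter> sphere 0 1"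
    "\<And>y. y \<in> A \<inter> sphere 0 1 \<Longrightarrow> (\<Sum>j<k. \<bar>\<phi> j z\<bar>) \<le> (\<Sum>j<k. \<bar>\<phi> j y\<bar>)"
    using continuous_attains_inf[OF cpt] by blast
  have "(\<Sum>j<k. \<bar>\<phi> j z\<bar>) = 0"
  proof (rule ccontr)
    assume ne: "(\<Sum>j<k. \<bar>\<phi> j z\<bar>) \<noteq> 0"
    then have k0: "k > 0" by (intro gr0I) auto
    \<comment> \<open>The average of the absolute values at the minimum point z: a point where all
      of them are below e would undercut the minimum.\<close>
    define e where "e = (\<Sum>j<k. \<bar>\<phi> j z\<bar>) / k"
    have "(\<Sum>j<k. \<bar>\<phi> j z\<bar>) \<ge> 0" by (rule sum_nonneg) simp
    with ne have pos: "(\<Sum>j<k. \<bar>\<phi> j z\<bar>) > 0" by linarith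
    then have e: "e > 0" unfolding e_def using k0 by (intro divide_pos_pos) auto
    have "\<exists>g. polynomial_function g \<and> (\<forall>x\<in>A \<inter> sphere 0 1. norm (\<phi> j x - g x) < e)" if "j < k" for j
      using Stone_Weierstrass_polynomial_function[OF cpt cont[OF that] e] .
    then have "\<exists>g. \<forall>j\<in>{..<k}. polynomial_function (g j) \<and> (\<forall>x\<in>A \<inter> sphere 0 1. norm (\<phi> j x - g j x) < e)"
      by (intro bchoice) auto
    then obtain g where "\<forall>j\<in>{..<k}. polynomial_function (g j) \<and> (\<forall>x\<in>A \<inter> sphere 0 1. norm (\<phi> j x - g j x) < e)"
      by blast
    then have g: "\<And>j. j < k \<Longrightarrow> polynomial_function (g j)"
      "\<And>j x. j < k \<Longrightarrow> x \<in> A \<inter> sphere 0 1 \<Longrightarrow> \<bar>\<phi> j x - g j x\<bar> < e"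
      by auto
    \<comment> \<open>The odd part of \<open>g j\<close> along \<open>L\<close>. Where it vanishes,
      \<open>g j\<close> takes equal values at two antipodes and \<open>\<phi> j\<close> opposite
      ones; the two approximation errors together give
      \<open>\<bar>\<phi> j\<bar> < e\<close>.\<close>
    define \<Phi> where "\<Phi> j y = (g j (L y) - g j (- L y)) / 2" for j y
    have "\<exists>x\<in>topspace (nsphere k). \<forall>j<k. \<Phi> j (embed x) = 0"
    proof (rule odd_differentiable_common_zero[OF kd])
      fix j y assume j: "j < k"
      have dL: "L differentiable (at y)" using linL by (rule linear_imp_differentiable)
      have "(g j \<circ> L) differentiable (at y)" "(g j \<circ> (\<lambda>y. - L y)) differentiable (at y)"
        using dL g(1)[OF j] differentiable_at_polynomial_function
        by (auto intro!: differentiable_chain_at differentiable_minus)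
      then show "\<Phi> j differentiable (at y)"
        unfolding \<Phi>_def by (auto simp: o_def intro!: differentiable_divide differentiable_diff)
      show "\<Phi> j (- y) = - \<Phi> j y"
        by (simp add: \<Phi>_def linear_neg[OF linL] field_simps)
    qed
    then obtain x where x: "x \<in> topspace (nsphere k)" "\<And>j. j < k \<Longrightarrow> \<Phi> j (embed x) = 0" by blast
    let ?y = "L (embed x)"
    have y: "?y \<in> A \<inter> sphere 0 1" "- ?y \<in> A \<inter> sphere 0 1"
      using LA[OF x(1)] A(1) by (auto simp: subspace_neg)
    have "\<bar>\<phi> j ?y\<bar> < e" if j: "j < k" for j
    proof -
      have "\<phi> j (- ?y) = - \<phi> j ?y" using odd[OF j] y by simp
      moreover have "g j ?y = g j (- ?y)" using x(2)[OF j] by (simp add: \<Phi>_def)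
      ultimately show ?thesis
        using g(2)[OF j y(1)] g(2)[OF j y(2)] by linarith
    qed
    then have "(\<Sum>j<k. \<bar>\<phi> j ?y\<bar>) < (\<Sum>j<k. e)"
      using k0 by (intro sum_strict_mono) auto
    also have "\<dots> = (\<Sum>j<k. \<bar>\<phi> j z\<bar>)" using k0 by (simp add: e_def)
    finally show False using z(2)[OF y(1)] by simp
  qed
  then have "\<forall>j<k. \<phi> j z = 0"
    by (simp add: sum_nonneg_eq_0_iff)
  then show ?thesis using z(1) by auto
qed

section \<open>Reflections\<close>

lemma hyperplane_reflection_eq: "hyperplane_reflection a x = x - ((2 / (a \<bullet> a)) * (a \<bullet> x)) *\<^sub>R a"
  by (simp add: hyperplane_reflection_def)

lemma linear_hyperplane_reflection: "linear (hyperplane_reflection a)"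
  by (rule linearI) (auto simp: hyperplane_reflection_eq inner_right_distrib algebra_simps add_divide_distrib)

lemma bounded_linear_hyperplane_reflection: "bounded_linear (hyperplane_reflection a)"
  using linear_hyperplane_reflection linear_conv_bounded_linear by blast

lemma inner_hyperplane_reflection:
  "hyperplane_reflection a x \<bullet> y = x \<bullet> hyperplane_reflection a y"
  by (simp add: hyperplane_reflection_eq inner_diff_left inner_diff_right inner_commute)

lemma inner_self_hyperplane_reflection: "a \<bullet> hyperplane_reflection a x = - (a \<bullet> x)"
  by (cases "a = 0") (auto simp: hyperplane_reflection_eq inner_diff_right)

lemma hyperplane_reflection_involution [simp]:
  "hyperplane_reflection a (hyperplane_reflection a x) = x"
proof -
  have "hyperplane_reflection a (hyperplane_reflection a x) =
      hyperplane_reflection a x + (2 / (a \<bullet> a) * (a \<bullet> x)) *\<^sub>R a"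
    by (subst hyperplane_reflection_eq) (simp add: inner_self_hyperplane_reflection)
  then show ?thesis by (simp add: hyperplane_reflection_eq)
qed

lemma norm_hyperplane_reflection [simp]: "norm (hyperplane_reflection a x) = norm x"
  by (simp add: norm_eq_sqrt_inner inner_hyperplane_reflection)

lemma hyperplane_reflection_orthogonal [simp]: "a \<bullet> x = 0 \<Longrightarrow> hyperplane_reflection a x = x"
  by (simp add: hyperplane_reflection_eq)

lemma hyperplane_reflection_self: "hyperplane_reflection a a = - a"
  by (cases "a = 0") (auto simp: hyperplane_reflection_eq algebra_simps scaleR_2)

text \<open>As the norms agree, the hyperplane through the origin orthogonal to x - y bisects the
  segment from x to y. For x = y the reflection along 0 is the identity.\<close>

lemma hyperplane_reflection_swap:
  assumes "norm x = norm y"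
  shows "hyperplane_reflection (x - y) x = y"
proof (cases "x = y")
  case False
  have "x \<bullet> x = y \<bullet> y" using assms by (simp add: norm_eq)
  then have "(x - y) \<bullet> (x - y) = 2 * ((x - y) \<bullet> x)"
    by (simp add: inner_diff_left inner_diff_right inner_commute)
  moreover have "(x - y) \<bullet> (x - y) \<noteq> 0" using False by simp
  ultimately show ?thesis by (simp add: hyperplane_reflection_def field_simps)
qed (simp add: hyperplane_reflection_def)

lemma reflect_plus_reflection [simp]:
  "reflect_plus a f (hyperplane_reflection a x) = reflect_plus a f x"
  by (cases "a \<bullet> x = 0") (auto simp: reflect_plus_def inner_self_hyperplane_reflection)

section \<open>Reflections preserve Lebesgue measure\<close>

lemma continuous_hyperplane_reflection: "continuous_on S (hyperplane_reflection a)"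
  using bounded_linear_hyperplane_reflection linear_continuous_on by blast

lemma measurable_hyperplane_reflection [measurable]: "hyperplane_reflection a \<in> borel \<rightarrow>\<^sub>M borel"
  by (intro borel_measurable_continuous_onI continuous_hyperplane_reflection)

lemma vimage_hyperplane_reflection_ball:
  "hyperplane_reflection a -` ball x r = ball (hyperplane_reflection a x) r"
proof -
  have "dist x (hyperplane_reflection a y) = dist (hyperplane_reflection a x) y" for y
    unfolding dist_norm
    using norm_hyperplane_reflection[of a "x - hyperplane_reflection a y"]
    by (simp add: linear_diff[OF linear_hyperplane_reflection])
  then show ?thesis by auto
qed

text \<open>By Vitali's covering theorem an open set is, up to a null set, a disjoint union of
  balls, and reflections map balls to balls of the same radius.\<close>

lemma emeasure_vimage_hyperplane_reflection_open:
  fixes U :: "'a::euclidean_space set"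
  assumes U: "open U"
  shows "emeasure lebesgue (hyperplane_reflection a -` U) = emeasure lebesgue U"
proof -
  let ?s = "hyperplane_reflection a"
  define K where "K = {p. 0 < snd p \<and> ball (fst p) (snd p) \<subseteq> U}"
  have "\<exists>i. i \<in> K \<and> x \<in> ball (fst i) (snd i) \<and> snd i < d" if x: "x \<in> U" "0 < d" for x d
  proof -
    obtain e where e: "e > 0" "ball x e \<subseteq> U"
      using U x(1) open_contains_ball by metis
    then have "ball x (min e (d / 2)) \<subseteq> U" by auto
    then show ?thesis
      using e(1) x(2) by (intro exI[of _ "(x, min e (d / 2))"]) (auto simp: K_def)
  qed
  then obtain C where C: "countable C" "C \<subseteq> K"
     "pairwise (\<lambda>i j. disjnt (ball (fst i) (snd i)) (ball (fst j) (snd j))) C"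
     "negligible (U - (\<Union>i \<in> C. ball (fst i) (snd i)))"
    by (rule Vitali_covering_theorem_balls[of U K fst snd]) blast
  let ?B = "\<lambda>i. ball (fst i) (snd i)"
  have BU: "(\<Union>i\<in>C. ?B i) \<subseteq> U" using C(2) by (auto simp: K_def)
  have disj: "disjoint_family_on ?B C"
    using C(3) by (auto simp: disjoint_family_on_def pairwise_def disjnt_def)
  have eqU: "emeasure lebesgue W = emeasure lebesgue B"
    if "negligible (W - B)" "B \<subseteq> W" "B \<in> sets lebesgue" for W B :: "'a set"
  proof -
    have "W = B \<union> (W - B)" using that(2) by blast
    then show ?thesis
      using emeasure_Un_null_set[OF that(3)] that(1) negligible_iff_null_sets by metis
  qed
  have "emeasure lebesgue U = emeasure lebesgue (\<Union>i\<in>C. ?B i)"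
    using C(1) by (intro eqU C(4) BU sets.countable_UN'') auto
  also have "\<dots> = (\<integral>\<^sup>+i. emeasure lebesgue (?B i) \<partial>count_space C)"
    using disj C(1) by (intro emeasure_UN_countable) auto
  also have "\<dots> = (\<integral>\<^sup>+i. emeasure lebesgue (?s -` ?B i) \<partial>count_space C)"
  proof (rule nn_integral_cong)
    fix i assume "i \<in> space (count_space C)"
    then have "snd i \<ge> 0" using C(2) by (auto simp: K_def)
    then show "emeasure lebesgue (?B i) = emeasure lebesgue (?s -` ?B i)"
      using emeasure_lebesgue_ball_conv_unit_ball[of "snd i" "fst i"]
        emeasure_lebesgue_ball_conv_unit_ball[of "snd i" "?s (fst i)"]
      by (simp add: vimage_hyperplane_reflection_ball)
  qed
  also have "\<dots> = emeasure lebesgue (\<Union>i\<in>C. ?s -` ?B i)"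
  proof (rule emeasure_UN_countable[symmetric])
    show "disjoint_family_on (\<lambda>i. ?s -` ?B i) C"
      using disj unfolding disjoint_family_on_def by (metis vimage_Int vimage_empty)
  qed (use C(1) in \<open>auto simp: vimage_hyperplane_reflection_ball\<close>)
  also have "\<dots> = emeasure lebesgue (?s -` U)"
  proof (rule eqU[symmetric])
    have "negligible (?s ` (U - (\<Union>i\<in>C. ?B i)))"
      using C(4) linear_hyperplane_reflection
      by (intro negligible_differentiable_image_negligible linear_imp_differentiable_on) auto
    moreover have "?s -` U - (\<Union>i\<in>C. ?s -` ?B i) \<subseteq> ?s ` (U - (\<Union>i\<in>C. ?B i))"
    proof
      fix x assume "x \<in> ?s -` U - (\<Union>i\<in>C. ?s -` ?B i)"
      then have "?s x \<in> U - (\<Union>i\<in>C. ?B i)" by auto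
      then show "x \<in> ?s ` (U - (\<Union>i\<in>C. ?B i))"
        by (metis hyperplane_reflection_involution imageI)
    qed
    ultimately show "negligible (?s -` U - (\<Union>i\<in>C. ?s -` ?B i))"
      using negligible_subset by blast
    show "(\<Union>i\<in>C. ?s -` ?B i) \<in> sets lebesgue"
      using C(1) by (intro sets.countable_UN'') (auto simp: vimage_hyperplane_reflection_ball)
  qed (use BU in auto)
  finally show ?thesis by simp
qed

text \<open>Lebesgue measure is determined by its values on boxes, so invariance on open sets is
  enough.\<close>

lemma distr_lborel_hyperplane_reflection:
  "distr lborel borel (hyperplane_reflection (a :: 'a::euclidean_space)) = lborel"
proof (rule lborel_eqI[symmetric])
  fix l u :: 'a assume lu: "\<And>b. b \<in> Basis \<Longrightarrow> l \<bullet> b \<le> u \<bullet> b"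
  have "hyperplane_reflection a -` box l u \<in> sets borel"
    using measurable_sets[OF measurable_hyperplane_reflection, of "box l u" a] by simp
  then have "emeasure (distr lborel borel (hyperplane_reflection a)) (box l u) =
      emeasure lebesgue (hyperplane_reflection a -` box l u)"
    by (simp add: emeasure_distr)
  also have "\<dots> = emeasure lborel (box l u)"
    using emeasure_vimage_hyperplane_reflection_open[OF open_box] by auto
  finally show "emeasure (distr lborel borel (hyperplane_reflection a)) (box l u) = ennreal (\<Prod>b\<in>Basis. (u - l) \<bullet> b)"
    using lu by (simp add: emeasure_lborel_box)
qed simp

lemma
  shows measurable_lebesgue_hyperplane_reflection:
      "hyperplane_reflection (a :: 'a::euclidean_space) \<in> lebesgue \<rightarrow>\<^sub>M lebesgue"
    and distr_lebesgue_hyperplane_reflection: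
      "distr lebesgue lebesgue (hyperplane_reflection a) = lebesgue"
proof -
  have d: "distr lebesgue lborel (hyperplane_reflection a) = lborel"
    by (simp add: distr_completion distr_lborel_hyperplane_reflection cong: distr_cong)
  then show "hyperplane_reflection a \<in> lebesgue \<rightarrow>\<^sub>M lebesgue"
    by (simp add: completion.measurable_completion2 measurable_completion)
  have "distr lebesgue lebesgue (hyperplane_reflection a) = completion (distr lebesgue lborel (hyperplane_reflection a))"
    by (rule completion.completion_distr_eq[symmetric]) (auto simp: d measurable_completion)
  then show "distr lebesgue lebesgue (hyperplane_reflection a) = lebesgue"
    by (simp add: d)
qed

lemma integral_hyperplane_reflection:
  fixes f :: "'a::euclidean_space \<Rightarrow> 'b::{banach, second_countable_topology}"
  shows "(LINT x|lebesgue. f (hyperplane_reflection a x)) = (LINT x|lebesgue. f x)"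
proof -
  have inv: "integrable lebesgue (\<lambda>x. g (hyperplane_reflection a x))" if "integrable lebesgue g"
    for g :: "'a \<Rightarrow> 'b"
    by (rule integrable_distr[OF measurable_lebesgue_hyperplane_reflection])
       (use that in \<open>simp only: distr_lebesgue_hyperplane_reflection\<close>)
  show ?thesis
  proof (cases "integrable lebesgue f")
    case True
    have "(LINT x|distr lebesgue lebesgue (hyperplane_reflection a). f x) =
        (LINT x|lebesgue. f (hyperplane_reflection a x))"
      by (rule integral_distr[OF measurable_lebesgue_hyperplane_reflection borel_measurable_integrable[OF True]])
    then show ?thesis by (simp only: distr_lebesgue_hyperplane_reflection)
  next
    case False
    \<comment> \<open>Integrability is itself invariant under the involution, so both integrals take
      the default value 0.\<close>
    then have "\<not> integrable lebesgue (\<lambda>x. f (hyperplane_reflection a x))"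
      using inv[of "\<lambda>x. f (hyperplane_reflection a x)"] by auto
    then show ?thesis using False by (simp add: not_integrable_integral_eq)
  qed
qed

lemma integrable_hyperplane_reflection:
  fixes f :: "'a::euclidean_space \<Rightarrow> 'b::{banach, second_countable_topology}"
  assumes "integrable lebesgue f"
  shows "integrable lebesgue (\<lambda>x. f (hyperplane_reflection a x))"
  by (rule integrable_distr[OF measurable_lebesgue_hyperplane_reflection])
     (use assms in \<open>simp only: distr_lebesgue_hyperplane_reflection\<close>)

text \<open>From dimension 2 on, rotations act transitively on spheres. So \<Omega> is a union of
  full spheres and is invariant under reflections as well, although these are not rotations.\<close>

lemma rotation_invariant_norm_eq:
  fixes \<Omega> :: "(real^'N) set"
  assumes "rotation_invariant \<Omega>" "2 \<le> CARD('N)" "x \<in> \<Omega>" "norm x = norm y"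
  shows "y \<in> \<Omega>"
proof -
  obtain f :: "real^'N \<Rightarrow> real^'N" where f: "orthogonal_transformation f" "det (matrix f) = 1" "f x = y"
    using rotation_exists[OF assms(2,4)] by blast
  then have "rotation_matrix (matrix f)"
    by (simp add: rotation_matrix_def orthogonal_transformation_matrix)
  then have "(\<lambda>x. matrix f *v x) ` \<Omega> = \<Omega>"
    using assms(1) by (simp add: rotation_invariant_def)
  moreover have "matrix f *v x = y"
    using f(3) fun_cong[OF matrix_vector_mul(2)[OF orthogonal_transformation_linear[OF f(1)]], of x] by simp
  ultimately show ?thesis using assms(3) by blast
qed

section \<open>The fundamental lemma of the calculus of variations\<close>

text \<open>Up to affine substitutions, finite sums and products, the functions \<open>p(1/t) exp(-1/t)\<close> form
  an algebra closed under differentiation.\<close>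

definition exp_bump :: "real poly \<Rightarrow> real \<Rightarrow> real" where
  "exp_bump p t = (if t > 0 then poly p (1 / t) * exp (- (1 / t)) else 0)"

lemma poly_times_exp_tendsto_0:
  fixes p :: "real poly"
  shows "((\<lambda>y. poly p y * exp (- y)) \<longlongrightarrow> 0) at_top"
proof -
  have "((\<lambda>y. \<Sum>i\<le>Polynomial.degree p. Polynomial.coeff p i * (y ^ i / exp y)) \<longlongrightarrow> (\<Sum>i\<le>Polynomial.degree p. Polynomial.coeff p i * 0)) at_top"
    by (intro tendsto_intros tendsto_power_div_exp_0)
  moreover have "(\<lambda>y. \<Sum>i\<le>Polynomial.degree p. Polynomial.coeff p i * (y ^ i / exp y)) = (\<lambda>y. poly p y * exp (- y))"
    by (simp add: poly_altdef sum_distrib_right exp_minus divide_inverse mult.assoc)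
  ultimately show ?thesis by simp
qed

text \<open>With s = 1/t, the derivative of p(s) exp(-s) with respect to t is s^2 (p(s) - p'(s))
  exp(-s); \<open>[:0, 0, 1:]\<close> is the factor s^2.\<close>

lemma exp_bump_has_derivative:
  "(exp_bump p has_real_derivative exp_bump ([:0, 0, 1:] * (p - pderiv p)) t) (at t)"
proof -
  consider "t > 0" | "t < 0" | "t = 0" by linarith
  then show ?thesis
  proof cases
    case 1
    have "((\<lambda>t. poly p (1 / t) * exp (- (1 / t))) has_real_derivative
        exp_bump ([:0, 0, 1:] * (p - pderiv p)) t) (at t)"
      using 1 by (auto simp: exp_bump_def power2_eq_square field_simps
          intro!: derivative_eq_intros DERIV_chain'[of "\<lambda>t. 1 / t" _ _ _ "poly p" _, OF _ poly_DERIV])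
    moreover have "eventually (\<lambda>s. s > 0) (nhds t)"
      using 1 eventually_nhds_in_open[of "{0<..}" t] by simp
    then have "\<forall>\<^sub>F s in nhds t. exp_bump p s = poly p (1 / s) * exp (- (1 / s))"
      by (rule eventually_mono) (simp add: exp_bump_def)
    ultimately show ?thesis
      using DERIV_cong_ev[OF refl, of "exp_bump p" "\<lambda>t. poly p (1 / t) * exp (- (1 / t))" t] by blast
  next
    case 2
    have "eventually (\<lambda>s. s < 0) (nhds t)"
      using 2 eventually_nhds_in_open[of "{..<0}" t] by simp
    then have "\<forall>\<^sub>F s in nhds t. exp_bump p s = 0"
      by (rule eventually_mono) (simp add: exp_bump_def)
    moreover have "exp_bump ([:0, 0, 1:] * (p - pderiv p)) t = 0"
      using 2 by (simp add: exp_bump_def)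
    ultimately show ?thesis
      using DERIV_cong_ev[OF refl, of "exp_bump p" "\<lambda>_. 0" t 0 0] DERIV_const by metis
  next
    case 3
    have "((\<lambda>h. exp_bump p h / h) \<longlongrightarrow> 0) (at_right 0)"
    proof -
      \<comment> \<open>The difference quotient at 0 has the same shape: dividing by h multiplies
        the polynomial in 1/h by \<open>[:0, 1:]\<close>.\<close>
      have "((\<lambda>h. poly ([:0, 1:] * p) (1 / h) * exp (- (1 / h))) \<longlongrightarrow> 0) (at_right 0)"
        using filterlim_compose[OF poly_times_exp_tendsto_0 filterlim_inverse_at_top_right, of "[:0, 1:] * p"]
        by (simp add: inverse_eq_divide)
      moreover have "\<forall>\<^sub>F h in at_right (0::real). poly ([:0, 1:] * p) (1 / h) * exp (- (1 / h)) = exp_bump p h / h"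
        by (auto simp: eventually_at_filter exp_bump_def field_simps)
      ultimately show ?thesis
        by (rule Lim_transform_eventually)
    qed
    moreover have "((\<lambda>h. exp_bump p h / h) \<longlongrightarrow> 0) (at_left 0)"
      by (rule tendsto_eventually) (auto simp: eventually_at_filter exp_bump_def)
    ultimately have "((\<lambda>h. exp_bump p h / h) \<longlongrightarrow> 0) (at 0)"
      by (intro filterlim_split_at_real)
    then show ?thesis
      using 3 by (simp add: DERIV_def exp_bump_def)
  qed
qed

inductive bump_algebra :: "('a::euclidean_space \<Rightarrow> real) \<Rightarrow> bool" where
  bump: "bump_algebra (\<lambda>x. exp_bump p (x \<bullet> b + c))"
| const: "bump_algebra (\<lambda>x. c)"
| add: "bump_algebra f \<Longrightarrow> bump_algebra g \<Longrightarrow> bump_algebra (\<lambda>x. f x + g x)"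
| mult: "bump_algebra f \<Longrightarrow> bump_algebra g \<Longrightarrow> bump_algebra (\<lambda>x. f x * g x)"

lemma bump_algebra_derivative:
  "bump_algebra f \<Longrightarrow> \<exists>f'. (\<forall>x. (f has_derivative f' x) (at x)) \<and> (\<forall>h. bump_algebra (\<lambda>x. f' x h))"
proof (induction rule: bump_algebra.induct)
  case (bump p b c)
  let ?q = "[:0, 0, 1:] * (p - pderiv p)"
  have "((\<lambda>x. exp_bump p (x \<bullet> b + c)) has_derivative (\<lambda>h. exp_bump ?q (x \<bullet> b + c) * (h \<bullet> b))) (at x)" for x
  proof (rule has_derivative_compose[of "\<lambda>x. x \<bullet> b + c" "\<lambda>h. h \<bullet> b" x UNIV "exp_bump p"])
    show "((\<lambda>x. x \<bullet> b + c) has_derivative (\<lambda>h. h \<bullet> b)) (at x)"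
      by (auto intro!: derivative_eq_intros)
    show "(exp_bump p has_derivative (*) (exp_bump ?q (x \<bullet> b + c))) (at (x \<bullet> b + c))"
      using exp_bump_has_derivative by (simp only: has_field_derivative_def)
  qed
  then show ?case
    by (intro exI[of _ "\<lambda>x h. exp_bump ?q (x \<bullet> b + c) * (h \<bullet> b)"])
       (auto intro!: bump_algebra.intros)
next
  case (const c)
  then show ?case
    by (intro exI[of _ "\<lambda>x h. 0"]) (auto intro: bump_algebra.const)
next
  case (add f g)
  then obtain f' g' where
    "\<forall>x. (f has_derivative f' x) (at x)" "\<forall>h. bump_algebra (\<lambda>x. f' x h)"
    "\<forall>x. (g has_derivative g' x) (at x)" "\<forall>h. bump_algebra (\<lambda>x. g' x h)" by blast
  then show ?case
    by (intro exI[of _ "\<lambda>x h. f' x h + g' x h"]) (auto intro!: derivative_intros bump_algebra.add)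
next
  case (mult f g)
  then obtain f' g' where
    "\<forall>x. (f has_derivative f' x) (at x)" "\<forall>h. bump_algebra (\<lambda>x. f' x h)"
    "\<forall>x. (g has_derivative g' x) (at x)" "\<forall>h. bump_algebra (\<lambda>x. g' x h)" by blast
  then show ?case using mult.hyps
    by (intro exI[of _ "\<lambda>x h. f x * g' x h + f' x h * g x"])
       (auto intro!: has_derivative_mult bump_algebra.intros)
qed

lemma bump_algebra_Ck: "bump_algebra f \<Longrightarrow> Ck_on k UNIV f"
proof (induction k arbitrary: f)
  case 0
  obtain f' where "\<And>x. (f has_derivative f' x) (at x)"
    using bump_algebra_derivative[OF 0] by blast
  then have "isCont f x" for x
    by (rule has_derivative_continuous)
  then show ?case
    by (simp add: continuous_at_imp_continuous_on)
next
  case (Suc k)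
  obtain f' where f': "\<And>x. (f has_derivative f' x) (at x)" "\<And>h. bump_algebra (\<lambda>x. f' x h)"
    using bump_algebra_derivative[OF Suc.prems] by blast
  then have "frechet_derivative f (at x) = f' x" for x
    using frechet_derivative_at by metis
  then show ?case
    using f' Suc.IH by (auto simp: differentiable_def)
qed

lemma bump_algebra_prod:
  "finite I \<Longrightarrow> (\<And>i. i \<in> I \<Longrightarrow> bump_algebra (f i)) \<Longrightarrow> bump_algebra (\<lambda>x. \<Prod>i\<in>I. f i x)"
proof (induction I rule: finite_induct)
  case (insert i I)
  then show ?case
    using bump_algebra.mult[of "f i" "\<lambda>x. \<Prod>i\<in>I. f i x"] by simp
qed (simp add: bump_algebra.const)

text \<open>For t > 0 the factors exp(-1/((n + 1) t)) tend to 1, and for t \<le> 0 they are replaced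
  by 0. These smooth functions thus tend to the indicator of the open box.\<close>

definition box_bump :: "'a::euclidean_space \<Rightarrow> 'a \<Rightarrow> nat \<Rightarrow> 'a \<Rightarrow> real" where
  "box_bump a c n x = (\<Prod>i\<in>Basis. exp_bump 1 (real (Suc n) * ((x - a) \<bullet> i)) * exp_bump 1 (real (Suc n) * ((c - x) \<bullet> i)))"

lemma exp_bump_1: "0 \<le> exp_bump 1 t" "exp_bump 1 t \<le> 1" "t \<le> 0 \<Longrightarrow> exp_bump 1 t = 0"
  by (auto simp: exp_bump_def)

lemma exp_bump_scaled_tendsto:
  assumes "t > 0"
  shows "(\<lambda>n. exp_bump 1 (real (Suc n) * t)) \<longlonglongrightarrow> 1"
proof -
  have "(\<lambda>n. exp (- (1 / t * inverse (real (Suc n))))) \<longlonglongrightarrow> exp (- (1 / t * 0))"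
    by (intro tendsto_intros LIMSEQ_inverse_real_of_nat)
  moreover have "exp_bump 1 (real (Suc n) * t) = exp (- (1 / t * inverse (real (Suc n))))" for n
    using assms by (simp add: exp_bump_def field_simps add_pos_nonneg)
  ultimately show ?thesis by simp
qed

lemma box_bump_algebra: "bump_algebra (box_bump a c n)"
proof -
  have 1: "bump_algebra (\<lambda>x. exp_bump 1 (real (Suc n) * ((x - a) \<bullet> i)))" for i
    using bump_algebra.bump[of 1 "real (Suc n) *\<^sub>R i" "- real (Suc n) * (a \<bullet> i)"]
    by (simp add: inner_diff_left algebra_simps)
  have 2: "bump_algebra (\<lambda>x. exp_bump 1 (real (Suc n) * ((c - x) \<bullet> i)))" for i
    using bump_algebra.bump[of 1 "- real (Suc n) *\<^sub>R i" "real (Suc n) * (c \<bullet> i)"]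
    by (simp add: inner_diff_left algebra_simps)
  show ?thesis
    unfolding box_bump_def by (intro bump_algebra_prod bump_algebra.mult 1 2) auto
qed

lemma box_bump_outside: "x \<notin> box a c \<Longrightarrow> box_bump a c n x = 0"
  by (auto simp: box_bump_def mem_box not_less inner_diff_left zero_less_mult_iff mult_le_0_iff
      intro!: prod_zero exp_bump_1(3) bexI)

lemma box_bump_bounds: "0 \<le> box_bump a c n x" "box_bump a c n x \<le> 1"
  unfolding box_bump_def
  by (auto intro!: prod_nonneg prod_le_1 mult_nonneg_nonneg mult_le_one exp_bump_1)

lemma box_bump_tendsto: "(\<lambda>n. box_bump a c n x) \<longlonglongrightarrow> indicat_real (box a c) x"
proof (cases "x \<in> box a c")
  case True
  have "(\<lambda>n. box_bump a c n x) \<longlonglongrightarrow> (\<Prod>i\<in>(Basis::'a set). 1 * 1)"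
    unfolding box_bump_def using True
    by (intro tendsto_prod tendsto_mult exp_bump_scaled_tendsto) (auto simp: mem_box inner_diff_left)
  then show ?thesis using True by simp
qed (simp add: box_bump_outside)

lemma box_bump_test_function:
  assumes "cbox a c \<subseteq> U"
  shows "test_function U (box_bump a c n)"
proof -
  have "box_bump a c n x = 0" if "x \<notin> cbox a c" for x
    using that box_bump_outside box_subset_cbox by blast
  then show ?thesis
    unfolding test_function_def using bump_algebra_Ck[OF box_bump_algebra] assms
    by (intro conjI allI exI[of _ "cbox a c"]) auto
qed

text \<open>Testing with \<open>box_bump\<close> and passing to the limit shows that h has integral
  0 over every box whose closure lies in U. The Lebesgue differentiation theorem then gives h = 0
  almost everywhere.\<close>

lemma fundamental_lemma_calculus_of_variations:
  fixes h :: "'a::euclidean_space \<Rightarrow> real"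
  assumes U: "open U" and h: "locally_integrable_on U h"
    and zero: "\<And>\<phi>. test_function U \<phi> \<Longrightarrow> (LINT x:U|lebesgue. h x * \<phi> x) = 0"
  shows "AE x in lebesgue. x \<in> U \<longrightarrow> h x = 0"
proof -
  have box0: "(LINT x:box a c|lebesgue. h x) = 0" if ac: "cbox a c \<subseteq> U" for a c
  proof -
    have int: "set_integrable lebesgue (cbox a c) h"
      using h ac by (auto simp: locally_integrable_on_def)
    have "(\<lambda>n. LINT x|lebesgue. box_bump a c n x * (indicat_real (cbox a c) x * h x)) \<longlonglongrightarrow>
        (LINT x|lebesgue. indicat_real (box a c) x * (indicat_real (cbox a c) x * h x))"
    proof (rule integral_dominated_convergence[where w="\<lambda>x. \<bar>indicat_real (cbox a c) x * h x\<bar>"])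
      have m: "(\<lambda>x. indicat_real (cbox a c) x * h x) \<in> borel_measurable lebesgue"
        using int by (simp add: set_integrable_def borel_measurable_integrable)
      then show "(\<lambda>x. indicat_real (box a c) x * (indicat_real (cbox a c) x * h x)) \<in> borel_measurable lebesgue"
        by (rule borel_measurable_times[OF borel_measurable_indicator, rotated]) auto
      have "box_bump a c n \<in> borel_measurable lebesgue" for n
        using bump_algebra_Ck[OF box_bump_algebra, of 0 a c n]
        by (simp add: borel_measurable_continuous_onI measurable_completion)
      then show "(\<lambda>x. box_bump a c n x * (indicat_real (cbox a c) x * h x)) \<in> borel_measurable lebesgue" for n
        using m by (rule borel_measurable_times)
      show "integrable lebesgue (\<lambda>x. \<bar>indicat_real (cbox a c) x * h x\<bar>)"
        using int by (simp add: set_integrable_def)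
      show "AE x in lebesgue. (\<lambda>n. box_bump a c n x * (indicat_real (cbox a c) x * h x))
          \<longlonglongrightarrow> indicat_real (box a c) x * (indicat_real (cbox a c) x * h x)"
        by (intro AE_I2 tendsto_intros box_bump_tendsto)
      show "AE x in lebesgue. norm (box_bump a c n x * (indicat_real (cbox a c) x * h x))
          \<le> \<bar>indicat_real (cbox a c) x * h x\<bar>" for n
        using box_bump_bounds[of a c n] by (intro AE_I2) (auto simp: abs_mult intro: mult_left_le_one_le)
    qed
    moreover have "(LINT x|lebesgue. box_bump a c n x * (indicat_real (cbox a c) x * h x)) = 0" for n
    proof -
      \<comment> \<open>The bump vanishes outside the open box, so the indicators of the closed box
        and of U are interchangeable.\<close>
      have "(\<lambda>x. box_bump a c n x * (indicat_real (cbox a c) x * h x)) =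
          (\<lambda>x. indicat_real U x *\<^sub>R (h x * box_bump a c n x))"
      proof
        fix x
        show "box_bump a c n x * (indicat_real (cbox a c) x * h x) = indicat_real U x *\<^sub>R (h x * box_bump a c n x)"
          using ac box_subset_cbox[of a c] box_bump_outside[of x a c n]
          by (cases "x \<in> box a c") (auto simp: indicator_def)
      qed
      then show ?thesis
        using zero[OF box_bump_test_function[OF ac]] by (simp add: set_lebesgue_integral_def)
    qed
    ultimately have "(LINT x|lebesgue. indicat_real (box a c) x * (indicat_real (cbox a c) x * h x)) = 0"
      by (simp add: LIMSEQ_const_iff)
    moreover have "indicat_real (box a c) x * (indicat_real (cbox a c) x * h x) = indicat_real (box a c) x *\<^sub>R h x" for x
      using box_subset_cbox[of a c] by (auto simp: indicator_def)
    ultimately show ?thesis by (simp add: set_lebesgue_integral_def)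
  qed
  have int0: "integral (cbox a c) h = 0" if ac: "cbox a c \<subseteq> U" for a c
  proof -
    have "set_integrable lebesgue (cbox a c) h"
      using h ac by (auto simp: locally_integrable_on_def)
    then have "set_integrable lebesgue (box a c) h"
      by (rule set_integrable_subset) (auto simp: box_subset_cbox)
    then have "integral (box a c) h = 0"
      using box0[OF ac] by (simp add: set_lebesgue_integral_eq_integral(2))
    then show ?thesis
      by (simp add: integral_open_interval)
  qed
  have loc: "\<exists>N. negligible N \<and> (\<forall>x\<in>box a c. x \<notin> N \<longrightarrow> h x = 0)" if ac: "cbox a c \<subseteq> U" for a c
  proof -
    define f where "f x = (if x \<in> cbox a c then h x else 0)" for x
    have "set_integrable lebesgue (cbox a c) h"
      using h ac by (auto simp: locally_integrable_on_def)
    then have "h integrable_on cbox a c"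
      by (rule set_lebesgue_integral_eq_integral(1))
    then have "f integrable_on UNIV"
      unfolding f_def by (simp add: integrable_restrict_UNIV)
    then have "f integrable_on cbox p q" for p q
      by (rule integrable_on_subcbox) auto
    then obtain N where N: "negligible N" "\<And>x e. \<lbrakk>x \<notin> N; 0 < e\<rbrakk> \<Longrightarrow>
               \<exists>d>0. \<forall>h. 0 < h \<and> h < d \<longrightarrow>
                         norm(integral (cbox x (x + h *\<^sub>R One)) f /\<^sub>R h ^ DIM('a) - f x) < e"
      using integrable_ccontinuous_explicit by blast
    have "h x = 0" if x: "x \<in> box a c" "x \<notin> N" for x
    proof (rule ccontr)
      assume "h x \<noteq> 0"
      then obtain d where d: "d > 0" "\<And>r. 0 < r \<Longrightarrow> r < d \<Longrightarrow>
          norm(integral (cbox x (x + r *\<^sub>R One)) f /\<^sub>R r ^ DIM('a) - f x) < \<bar>h x\<bar>"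
        using N(2)[OF x(2), of "\<bar>h x\<bar>"] by auto
      obtain e where e: "e > 0" "ball x e \<subseteq> box a c"
        using x(1) open_box open_contains_ball by metis
      \<comment> \<open>Below d, and so small that the cube with corner x and side r, whose diameter
        is at most \<open>r * DIM('a)\<close>, stays in the ball of radius e.\<close>
      define r where "r = min (d / 2) (e / (2 * real DIM('a)))"
      have r: "0 < r" "r < d" "r * DIM('a) < e"
        using d(1) e(1) by (auto simp: r_def min_def field_simps)
      have sub: "cbox x (x + r *\<^sub>R One) \<subseteq> box a c"
      proof
        fix y assume y: "y \<in> cbox x (x + r *\<^sub>R One)"
        have "norm (y - x) \<le> (\<Sum>i\<in>Basis. \<bar>(y - x) \<bullet> i\<bar>)" by (rule norm_le_l1)
        also have "\<dots> \<le> (\<Sum>i\<in>(Basis::'a set). r)"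
          using y by (intro sum_mono) (auto simp: mem_box inner_diff_left inner_add_left)
        also have "\<dots> < e" using r(3) by (simp add: mult.commute)
        finally show "y \<in> box a c" using e(2) by (auto simp: dist_norm norm_minus_commute)
      qed
      then have "cbox x (x + r *\<^sub>R One) \<subseteq> cbox a c" using box_subset_cbox by blast
      then have "integral (cbox x (x + r *\<^sub>R One)) f = integral (cbox x (x + r *\<^sub>R One)) h"
        by (intro integral_cong) (auto simp: f_def)
      also have "\<dots> = 0" using sub ac box_subset_cbox by (intro int0) blast
      finally show False
        using d(2)[OF r(1,2)] x(1) box_subset_cbox[of a c] by (auto simp: f_def)
    qed
    then show ?thesis using N(1) by blast
  qed
  \<comment> \<open>Being null is a local property, so it suffices to treat a box around each
    point.\<close>
  have "negligible {x \<in> U. h x \<noteq> 0}"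
  proof (subst locally_negligible_alt, rule ballI)
    fix x assume x: "x \<in> {x \<in> U. h x \<noteq> 0}"
    then have "x \<in> U" by simp
    then obtain a c where ac: "cbox a c \<subseteq> U" "x \<in> box a c"
      using open_contains_cbox[OF U] by metis
    obtain N where N: "negligible N" "\<forall>x\<in>box a c. x \<notin> N \<longrightarrow> h x = 0"
      using loc[OF ac(1)] by blast
    have "negligible ({x \<in> U. h x \<noteq> 0} \<inter> box a c)"
      by (rule negligible_subset[OF N(1)]) (use N(2) in auto)
    then show "\<exists>V. openin (top_of_set {x \<in> U. h x \<noteq> 0}) V \<and> x \<in> V \<and> negligible V"
      using x ac(2) by (intro exI[of _ "{x \<in> U. h x \<noteq> 0} \<inter> box a c"]) (auto simp: openin_open_Int)
  qed
  then have "AE x in lebesgue. x \<notin> {x \<in> U. h x \<noteq> 0}"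
    using AE_not_in negligible_iff_null_sets by blast
  then show ?thesis by eventually_elim simp
qed

section \<open>Weak gradients\<close>

lemma locally_integrable_on_bounded_linear:
  assumes "bounded_linear T" "locally_integrable_on \<Omega> v"
  shows "locally_integrable_on \<Omega> (\<lambda>x. T (v x))"
proof -
  interpret bounded_linear T by fact
  show ?thesis
    using assms(2) integrable_bounded_linear[OF assms(1)]
    unfolding locally_integrable_on_def set_integrable_def by (fastforce simp: scaleR)
qed

lemma locally_integrable_on_subset:
  "locally_integrable_on \<Omega> v \<Longrightarrow> U \<subseteq> \<Omega> \<Longrightarrow> locally_integrable_on U v"
  by (auto simp: locally_integrable_on_def)

lemma locally_integrable_on_diff:
  "locally_integrable_on \<Omega> v \<Longrightarrow> locally_integrable_on \<Omega> w \<Longrightarrow> locally_integrable_on \<Omega> (\<lambda>x. v x - w x)"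
  by (auto simp: locally_integrable_on_def intro: set_integral_diff)

lemma integrable_times_compactly_supported:
  fixes f c :: "'a::euclidean_space \<Rightarrow> real"
  assumes f: "locally_integrable_on \<Omega> f" and c: "continuous_on UNIV c"
    and K: "compact K" "K \<subseteq> \<Omega>" "\<And>x. x \<notin> K \<Longrightarrow> c x = 0"
  shows "set_integrable lebesgue \<Omega> (\<lambda>x. f x * c x)"
proof -
  have fK: "integrable lebesgue (\<lambda>x. indicat_real K x * f x)"
    using f K by (simp add: locally_integrable_on_def set_integrable_def)
  have "compact (c ` K)"
    using c K(1) compact_continuous_image continuous_on_subset by blast
  then obtain B where B: "\<And>x. x \<in> K \<Longrightarrow> \<bar>c x\<bar> \<le> B"
    using compact_imp_bounded[of "c ` K"] by (auto simp: bounded_iff)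
  have "integrable lebesgue (\<lambda>x. c x * (indicat_real K x * f x))"
  proof (rule Bochner_Integration.integrable_bound)
    show "integrable lebesgue (\<lambda>x. B * (indicat_real K x * f x))"
      using fK by (rule integrable_mult_right)
    have "c \<in> borel_measurable lebesgue"
      using c by (simp add: borel_measurable_continuous_onI measurable_completion)
    then show "(\<lambda>x. c x * (indicat_real K x * f x)) \<in> borel_measurable lebesgue"
      using borel_measurable_integrable[OF fK] by (rule borel_measurable_times)
    show "AE x in lebesgue. norm (c x * (indicat_real K x * f x)) \<le> norm (B * (indicat_real K x * f x))"
    proof (rule AE_I2)
      fix x
      show "norm (c x * (indicat_real K x * f x)) \<le> norm (B * (indicat_real K x * f x))"
        using B[of x] by (cases "x \<in> K") (auto simp: abs_mult intro!: mult_right_mono)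
    qed
  qed
  moreover have "(\<lambda>x. indicat_real \<Omega> x *\<^sub>R (f x * c x)) = (\<lambda>x. c x * (indicat_real K x * f x))"
  proof
    fix x
    show "indicat_real \<Omega> x *\<^sub>R (f x * c x) = c x * (indicat_real K x * f x)"
      using K(2) K(3)[of x] by (cases "x \<in> K") auto
  qed
  ultimately show ?thesis by (simp add: set_integrable_def)
qed

lemma test_functionE:
  assumes "test_function \<Omega> \<phi>"
  obtains K where "compact K" "K \<subseteq> \<Omega>" "\<And>x. x \<notin> K \<Longrightarrow> \<phi> x = 0"
    "\<And>x h. x \<notin> K \<Longrightarrow> frechet_derivative \<phi> (at x) h = 0"
    "continuous_on UNIV \<phi>" "\<And>h. continuous_on UNIV (\<lambda>x. frechet_derivative \<phi> (at x) h)"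
    "\<And>x. \<phi> differentiable (at x)"
proof -
  from assms obtain K where Ck: "\<And>k. Ck_on k UNIV \<phi>" and K: "compact K" "K \<subseteq> \<Omega>" "\<And>x. x \<notin> K \<Longrightarrow> \<phi> x = 0"
    unfolding test_function_def by blast
  have "frechet_derivative \<phi> (at x) h = 0" if "x \<notin> K" for x h
  proof -
    have "(\<phi> has_derivative (\<lambda>h. 0)) (at x)"
    proof (rule has_derivative_transform_within_open[of "\<lambda>_. 0" _ _ _ "- K"])
      show "open (- K)" using compact_imp_closed[OF K(1)] by (simp add: open_Compl)
    qed (use that K(3) in auto)
    then show ?thesis using frechet_derivative_at by metis
  qed
  then show thesis
    using K Ck[of 0] Ck[of "Suc 0"] by (intro that[of K]) auto
qed

lemma test_function_mono: "test_function U \<phi> \<Longrightarrow> U \<subseteq> \<Omega> \<Longrightarrow> test_function \<Omega> \<phi>"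
  unfolding test_function_def by blast

text \<open>The open subset U is there because a function and its symmetrization agree on one side
  of a hyperplane only. Test functions supported in U are test functions for \<Omega>, so both
  gradients can be tested with them.\<close>

lemma has_weak_gradient_unique:
  fixes D D' :: "real^'N \<Rightarrow> real^'N^'n"
  assumes D: "has_weak_gradient \<Omega> v D" and D': "has_weak_gradient \<Omega> w D'"
    and U: "open U" "U \<subseteq> \<Omega>" and eq: "AE x in lebesgue. x \<in> U \<longrightarrow> v x = w x"
  shows "AE x in lebesgue. x \<in> U \<longrightarrow> D x = D' x"
proof -
  have "AE x in lebesgue. x \<in> U \<longrightarrow> D x $ i $ j - D' x $ i $ j = 0" for i j
  proof (rule fundamental_lemma_calculus_of_variations[OF U(1)])
    have bl: "bounded_linear (\<lambda>A :: real^'N^'n. A $ i $ j)"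
      by (rule bounded_linear_compose[OF bounded_linear_vec_nth bounded_linear_vec_nth])
    have loc: "locally_integrable_on \<Omega> (\<lambda>x. D x $ i $ j)" "locally_integrable_on \<Omega> (\<lambda>x. D' x $ i $ j)"
      using D D' by (auto simp: has_weak_gradient_def intro!: locally_integrable_on_bounded_linear[OF bl])
    then show "locally_integrable_on U (\<lambda>x. D x $ i $ j - D' x $ i $ j)"
      using U(2) by (intro locally_integrable_on_diff) (auto intro: locally_integrable_on_subset)
    fix \<phi> :: "real^'N \<Rightarrow> real" assume \<phi>U: "test_function U \<phi>"
    then have \<phi>: "test_function \<Omega> \<phi>" using U(2) test_function_mono by blast
    obtain K where K: "compact K" "K \<subseteq> U" "\<And>x. x \<notin> K \<Longrightarrow> \<phi> x = 0"
      "\<And>x h. x \<notin> K \<Longrightarrow> frechet_derivative \<phi> (at x) h = 0"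
      "continuous_on UNIV \<phi>" "\<And>h. continuous_on UNIV (\<lambda>x. frechet_derivative \<phi> (at x) h)"
      using test_functionE[OF \<phi>U] by metis
    have K\<Omega>: "K \<subseteq> \<Omega>" using K(2) U(2) by blast
    have int: "set_integrable lebesgue \<Omega> (\<lambda>x. D x $ i $ j * \<phi> x)"
      "set_integrable lebesgue \<Omega> (\<lambda>x. D' x $ i $ j * \<phi> x)"
      using loc K K\<Omega> by (auto intro!: integrable_times_compactly_supported[of \<Omega> _ _ K])
    have "(LINT x:U|lebesgue. (D x $ i $ j - D' x $ i $ j) * \<phi> x) =
          (LINT x:\<Omega>|lebesgue. D x $ i $ j * \<phi> x - D' x $ i $ j * \<phi> x)"
      unfolding set_lebesgue_integral_def
    proof (rule Bochner_Integration.integral_cong[OF refl])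
      fix x
      show "indicat_real U x *\<^sub>R ((D x $ i $ j - D' x $ i $ j) * \<phi> x) =
          indicat_real \<Omega> x *\<^sub>R (D x $ i $ j * \<phi> x - D' x $ i $ j * \<phi> x)"
        using K(2) K(3)[of x] U(2) by (cases "x \<in> K") (auto simp: algebra_simps indicator_def)
    qed
    also have "\<dots> = (LINT x:\<Omega>|lebesgue. D x $ i $ j * \<phi> x) - (LINT x:\<Omega>|lebesgue. D' x $ i $ j * \<phi> x)"
      by (rule set_integral_diff(2)[OF int])
    also have "\<dots> = (LINT x:\<Omega>|lebesgue. w x $ i * frechet_derivative \<phi> (at x) (axis j 1)) -
        (LINT x:\<Omega>|lebesgue. v x $ i * frechet_derivative \<phi> (at x) (axis j 1))"
      using D D' \<phi> by (simp add: has_weak_gradient_def)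
    also have "(LINT x:\<Omega>|lebesgue. w x $ i * frechet_derivative \<phi> (at x) (axis j 1)) =
        (LINT x:\<Omega>|lebesgue. v x $ i * frechet_derivative \<phi> (at x) (axis j 1))"
    proof -
      have bl: "bounded_linear (\<lambda>A :: real^'n. A $ i)" by (rule bounded_linear_vec_nth)
      have "locally_integrable_on \<Omega> (\<lambda>x. v x $ i)" "locally_integrable_on \<Omega> (\<lambda>x. w x $ i)"
        using D D' by (auto simp: has_weak_gradient_def intro!: locally_integrable_on_bounded_linear[OF bl])
      then have int: "set_integrable lebesgue \<Omega> (\<lambda>x. v x $ i * frechet_derivative \<phi> (at x) (axis j 1))"
        "set_integrable lebesgue \<Omega> (\<lambda>x. w x $ i * frechet_derivative \<phi> (at x) (axis j 1))"
        using K K\<Omega> by (auto intro!: integrable_times_compactly_supported[of \<Omega> _ _ K])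
      show ?thesis
        unfolding set_lebesgue_integral_def
      proof (rule integral_cong_AE)
        show "AE x in lebesgue. indicat_real \<Omega> x *\<^sub>R (w x $ i * frechet_derivative \<phi> (at x) (axis j 1)) =
            indicat_real \<Omega> x *\<^sub>R (v x $ i * frechet_derivative \<phi> (at x) (axis j 1))"
          using eq
        proof eventually_elim
          case (elim x)
          then show ?case
            using K(2) K(4)[of x] by (cases "x \<in> K") auto
        qed
      qed (use int in \<open>auto simp: set_integrable_def dest: borel_measurable_integrable\<close>)
    qed
    finally show "(LINT x:U|lebesgue. (D x $ i $ j - D' x $ i $ j) * \<phi> x) = 0" by simp
  qed
  then have "AE x in lebesgue. \<forall>i\<in>UNIV. \<forall>j\<in>UNIV. x \<in> U \<longrightarrow> D x $ i $ j - D' x $ i $ j = 0"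
    by (intro AE_finite_allI) auto
  then show ?thesis
    by eventually_elim (auto simp: vec_eq_iff)
qed

section \<open>Weak gradients under reflections\<close>

lemma Ck_on_comp_linear:
  fixes f :: "'a::euclidean_space \<Rightarrow> 'b::real_normed_vector" and L :: "'a \<Rightarrow> 'a"
  assumes "bounded_linear L"
  shows "Ck_on k UNIV f \<Longrightarrow> Ck_on k UNIV (\<lambda>x. f (L x))"
proof (induction k arbitrary: f)
  case 0
  then show ?case
    using continuous_on_compose2[of UNIV f UNIV L] linear_continuous_on[OF assms] by simp
next
  case (Suc k)
  have d: "((\<lambda>x. f (L x)) has_derivative (\<lambda>h. frechet_derivative f (at (L x)) (L h))) (at x)" for x
  proof (rule has_derivative_compose[OF bounded_linear_imp_has_derivative[OF assms]])
    show "(f has_derivative frechet_derivative f (at (L x))) (at (L x))"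
      using Suc.prems frechet_derivative_works by auto
  qed
  have "frechet_derivative (\<lambda>x. f (L x)) (at x) h = frechet_derivative f (at (L x)) (L h)" for x h
    using frechet_derivative_at[OF d] by metis
  moreover have "Ck_on k UNIV (\<lambda>x. frechet_derivative f (at (L x)) (L h))" for h
    using Suc.IH[of "\<lambda>x. frechet_derivative f (at x) (L h)"] Suc.prems by simp
  moreover have "(\<lambda>x. f (L x)) differentiable (at x)" for x
    using d differentiable_def by blast
  ultimately show ?case by simp
qed

lemma frechet_derivative_reflection:
  assumes "f differentiable (at (hyperplane_reflection a x))"
  shows "frechet_derivative (\<lambda>x. f (hyperplane_reflection a x)) (at x) h =
    frechet_derivative f (at (hyperplane_reflection a x)) (hyperplane_reflection a h)"
proof -
  have "((\<lambda>x. f (hyperplane_reflection a x)) has_derivative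
      (\<lambda>h. frechet_derivative f (at (hyperplane_reflection a x)) (hyperplane_reflection a h))) (at x)"
    using assms frechet_derivative_works
    by (intro has_derivative_compose[OF bounded_linear_imp_has_derivative[OF bounded_linear_hyperplane_reflection]]) blast
  then show ?thesis using frechet_derivative_at by metis
qed

lemma test_function_reflection:
  assumes "test_function \<Omega> \<phi>" and inv: "\<And>x. x \<in> \<Omega> \<Longrightarrow> hyperplane_reflection a x \<in> \<Omega>"
  shows "test_function \<Omega> (\<lambda>x. \<phi> (hyperplane_reflection a x))"
proof -
  from assms obtain K where Ck: "\<And>k. Ck_on k UNIV \<phi>" and K: "compact K" "K \<subseteq> \<Omega>" "\<And>x. x \<notin> K \<Longrightarrow> \<phi> x = 0"
    unfolding test_function_def by blast
  have "\<phi> (hyperplane_reflection a x) = 0" if "x \<notin> hyperplane_reflection a ` K" for x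
    using that K(3) by (metis hyperplane_reflection_involution imageI)
  moreover have "compact (hyperplane_reflection a ` K)"
    using K(1) continuous_hyperplane_reflection compact_continuous_image by blast
  moreover have "hyperplane_reflection a ` K \<subseteq> \<Omega>" using K(2) inv by blast
  ultimately show ?thesis
    unfolding test_function_def
    using Ck_on_comp_linear[OF bounded_linear_hyperplane_reflection Ck] by blast
qed

lemma locally_integrable_on_reflection:
  assumes "locally_integrable_on \<Omega> v" and inv: "\<And>x. x \<in> \<Omega> \<Longrightarrow> hyperplane_reflection a x \<in> \<Omega>"
  shows "locally_integrable_on \<Omega> (\<lambda>x. v (hyperplane_reflection a x))"
  unfolding locally_integrable_on_def
proof (intro allI impI, elim conjE)
  fix K assume K: "compact K" "K \<subseteq> \<Omega>"
  let ?s = "hyperplane_reflection a"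
  have "compact (?s ` K)" "?s ` K \<subseteq> \<Omega>"
    using K inv continuous_hyperplane_reflection compact_continuous_image by blast+
  then have "integrable lebesgue (\<lambda>x. indicat_real (?s ` K) x *\<^sub>R v x)"
    using assms(1) by (auto simp: locally_integrable_on_def set_integrable_def)
  then have "integrable lebesgue (\<lambda>x. indicat_real (?s ` K) (?s x) *\<^sub>R v (?s x))"
    by (rule integrable_hyperplane_reflection)
  moreover have "indicat_real (?s ` K) (?s x) = indicat_real K x" for x
    by (auto simp: indicator_def) (metis hyperplane_reflection_involution)
  ultimately show "set_integrable lebesgue K (\<lambda>x. v (?s x))"
    by (simp add: set_integrable_def)
qed

text \<open>A change of variables in the weak formulation moves the reflection onto the test
  function. As reflections are self-adjoint, it passes from the direction of differentiation to the
  rows of D. With uniqueness, the norm of the gradient of a symmetric function is symmetric almost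
  everywhere.\<close>

lemma has_weak_gradient_reflection:
  fixes v :: "real^'N \<Rightarrow> real^'n"
  assumes D: "has_weak_gradient \<Omega> v D" and inv: "\<And>x. x \<in> \<Omega> \<Longrightarrow> hyperplane_reflection a x \<in> \<Omega>"
    and sym: "\<And>x. x \<in> \<Omega> \<Longrightarrow> v (hyperplane_reflection a x) = v x"
  shows "has_weak_gradient \<Omega> v (\<lambda>x. \<chi> i. hyperplane_reflection a (D (hyperplane_reflection a x) $ i))"
proof -
  let ?s = "hyperplane_reflection a"
  have ind: "indicat_real \<Omega> (?s x) = indicat_real \<Omega> x" for x
    using inv[of x] inv[of "?s x"] by (auto simp: indicator_def)
  have bl: "bounded_linear (\<lambda>A :: real^'N^'n. \<chi> i. ?s (A $ i))"
    unfolding linear_conv_bounded_linear[symmetric]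
    by (rule linearI) (auto simp: vec_eq_iff linear_add[OF linear_hyperplane_reflection] linear_scale[OF linear_hyperplane_reflection])
  have locD: "locally_integrable_on \<Omega> D" and locv: "locally_integrable_on \<Omega> v"
    using D by (auto simp: has_weak_gradient_def)
  have "(LINT x:\<Omega>|lebesgue. v x $ i * frechet_derivative \<phi> (at x) (axis j 1)) =
        - (LINT x:\<Omega>|lebesgue. (\<chi> i. ?s (D (?s x) $ i)) $ i $ j * \<phi> x)"
    if \<phi>: "test_function \<Omega> \<phi>" for \<phi> i j
  proof -
    define \<psi> where "\<psi> x = \<phi> (?s x)" for x
    have \<psi>: "test_function \<Omega> \<psi>"
      unfolding \<psi>_def using test_function_reflection[OF \<phi> inv] .
    obtain K where K: "compact K" "K \<subseteq> \<Omega>" "\<And>x. x \<notin> K \<Longrightarrow> \<psi> x = 0"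
      "\<And>x h. x \<notin> K \<Longrightarrow> frechet_derivative \<psi> (at x) h = 0"
      "continuous_on UNIV \<psi>" "\<And>h. continuous_on UNIV (\<lambda>x. frechet_derivative \<psi> (at x) h)"
      "\<And>x. \<psi> differentiable (at x)"
      using test_functionE[OF \<psi>] by metis
    have d\<phi>: "frechet_derivative \<phi> (at (?s x)) h = frechet_derivative \<psi> (at x) (?s h)" for x h
    proof -
      have "\<phi> differentiable (at (?s x))" using \<phi> test_functionE by metis
      then show ?thesis
        unfolding \<psi>_def by (subst frechet_derivative_reflection) auto
    qed
    \<comment> \<open>The chain rule produces a derivative in the reflected axis direction. It is
      expanded because the weak formulation speaks of axis directions only.\<close>
    define e where "e = ?s (axis j 1)"
    have e: "e = (\<Sum>l\<in>UNIV. e $ l *\<^sub>R axis l 1)"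
      using basis_expansion[of e] by (simp add: scalar_mult_eq_scaleR)
    have de: "frechet_derivative \<psi> (at x) e = (\<Sum>l\<in>UNIV. e $ l * frechet_derivative \<psi> (at x) (axis l 1))" for x
    proof -
      have "linear (frechet_derivative \<psi> (at x))" using K(7) linear_frechet_derivative by blast
      then show ?thesis
        by (subst e) (simp add: linear_sum linear_scale)
    qed
    have bl1: "bounded_linear (\<lambda>A :: real^'N^'n. A $ i $ l)" for l
      by (rule bounded_linear_compose[OF bounded_linear_vec_nth bounded_linear_vec_nth])
    have int1: "set_integrable lebesgue \<Omega> (\<lambda>x. v x $ i * frechet_derivative \<psi> (at x) (axis l 1))" for l
      using K by (intro integrable_times_compactly_supported[of \<Omega> _ _ K]
        locally_integrable_on_bounded_linear[OF bounded_linear_vec_nth locv]) auto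
    have int2: "set_integrable lebesgue \<Omega> (\<lambda>x. D x $ i $ l * \<psi> x)" for l
      using K by (intro integrable_times_compactly_supported[of \<Omega> _ _ K]
        locally_integrable_on_bounded_linear[OF bl1 locD]) auto
    have "(LINT x:\<Omega>|lebesgue. v x $ i * frechet_derivative \<phi> (at x) (axis j 1)) =
        (LINT x|lebesgue. indicat_real \<Omega> (?s x) *\<^sub>R (v (?s x) $ i * frechet_derivative \<phi> (at (?s x)) (axis j 1)))"
      unfolding set_lebesgue_integral_def
      by (rule integral_hyperplane_reflection[symmetric])
    also have "\<dots> = (LINT x|lebesgue. (\<Sum>l\<in>UNIV. e $ l * (indicat_real \<Omega> x *\<^sub>R (v x $ i * frechet_derivative \<psi> (at x) (axis l 1)))))"
    proof (rule Bochner_Integration.integral_cong[OF refl])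
      fix x
      show "indicat_real \<Omega> (?s x) *\<^sub>R (v (?s x) $ i * frechet_derivative \<phi> (at (?s x)) (axis j 1)) =
        (\<Sum>l\<in>UNIV. e $ l * (indicat_real \<Omega> x *\<^sub>R (v x $ i * frechet_derivative \<psi> (at x) (axis l 1))))"
        using sym[of x]
        by (cases "x \<in> \<Omega>") (auto simp: ind d\<phi> de e_def[symmetric] sum_distrib_left algebra_simps)
    qed
    also have "\<dots> = (\<Sum>l\<in>UNIV. e $ l * (LINT x:\<Omega>|lebesgue. v x $ i * frechet_derivative \<psi> (at x) (axis l 1)))"
      using int1 by (simp add: set_integrable_def set_lebesgue_integral_def)
    also have "\<dots> = (\<Sum>l\<in>UNIV. e $ l * - (LINT x:\<Omega>|lebesgue. D x $ i $ l * \<psi> x))"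
      using D \<psi> by (simp add: has_weak_gradient_def)
    also have "\<dots> = - (LINT x|lebesgue. (\<Sum>l\<in>UNIV. e $ l * (indicat_real \<Omega> x *\<^sub>R (D x $ i $ l * \<psi> x))))"
      using int2 by (simp add: set_integrable_def set_lebesgue_integral_def sum_negf)
    also have "(LINT x|lebesgue. (\<Sum>l\<in>UNIV. e $ l * (indicat_real \<Omega> x *\<^sub>R (D x $ i $ l * \<psi> x)))) =
        (LINT x|lebesgue. indicat_real \<Omega> (?s x) *\<^sub>R (?s (D (?s (?s x)) $ i) $ j * \<phi> (?s x)))"
    proof (rule Bochner_Integration.integral_cong[OF refl])
      fix x
      have "?s (D x $ i) $ j = ?s (D x $ i) \<bullet> axis j 1"
        by (simp add: inner_axis)
      also have "\<dots> = D x $ i \<bullet> e"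
        by (simp add: e_def inner_hyperplane_reflection)
      also have "\<dots> = (\<Sum>l\<in>UNIV. e $ l * D x $ i $ l)"
        by (simp add: inner_vec_def mult.commute)
      finally show "(\<Sum>l\<in>UNIV. e $ l * (indicat_real \<Omega> x *\<^sub>R (D x $ i $ l * \<psi> x))) =
        indicat_real \<Omega> (?s x) *\<^sub>R (?s (D (?s (?s x)) $ i) $ j * \<phi> (?s x))"
        by (simp add: ind \<psi>_def[symmetric] sum_distrib_left sum_distrib_right algebra_simps)
    qed
    also have "\<dots> = (LINT x:\<Omega>|lebesgue. ?s (D (?s x) $ i) $ j * \<phi> x)"
      unfolding set_lebesgue_integral_def
      by (rule integral_hyperplane_reflection)
    finally show ?thesis by simp
  qed
  moreover have "locally_integrable_on \<Omega> (\<lambda>x. \<chi> i. ?s (D (?s x) $ i))"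
    by (rule locally_integrable_on_bounded_linear[OF bl locally_integrable_on_reflection[OF locD inv]])
  ultimately show ?thesis
    using locv by (simp add: has_weak_gradient_def)
qed

lemma norm_rowwise_reflection:
  fixes A :: "real^'N^'n"
  shows "norm (\<chi> i. hyperplane_reflection a (A $ i)) = norm A"
proof -
  have "norm B = L2_set (\<lambda>i. norm (B $ i)) UNIV" for B :: "real^'N^'n"
    by (rule norm_vec_def)
  then show ?thesis by simp
qed

section \<open>Symmetrization of integral functionals\<close>

text \<open>The integral over the side into which \<open>e\<close> points minus that over the other
  side. The sign makes it odd in \<open>e\<close>, as Borsuk-Ulam requires.\<close>

definition imbalance ::
    "(real^'N) set \<Rightarrow> (real \<Rightarrow> real^'n \<Rightarrow> real \<Rightarrow> real) \<Rightarrow> (real^'N \<Rightarrow> real^'n) \<Rightarrow> real^'N \<Rightarrow> real" where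
  "imbalance \<Omega> G v e = (LINT x:\<Omega>|lebesgue. sgn (e \<bullet> x) * integrand \<Omega> G v x)"

lemma imbalance_uminus: "imbalance \<Omega> G v (- e) = - imbalance \<Omega> G v e"
  by (simp add: imbalance_def set_lebesgue_integral_def sgn_minus)

lemma sgn_inner_measurable: "(\<lambda>x. sgn (e \<bullet> x) :: real) \<in> borel_measurable lebesgue"
  by (intro measurable_completion) measurable

lemma AE_not_hyperplane:
  fixes e :: "'a::euclidean_space"
  assumes "e \<noteq> 0"
  shows "AE x in lebesgue. e \<bullet> x \<noteq> 0"
proof -
  have "negligible {x. e \<bullet> x = 0}" using assms by (intro negligible_hyperplane) auto
  then have "AE x in lebesgue. x \<notin> {x. e \<bullet> x = 0}"
    using AE_not_in negligible_iff_null_sets by blast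
  then show ?thesis by simp
qed

lemma set_integrable_sgn_times:
  fixes g :: "'a::euclidean_space \<Rightarrow> real"
  assumes "set_integrable lebesgue \<Omega> g"
  shows "set_integrable lebesgue \<Omega> (\<lambda>x. sgn (e \<bullet> x) * g x)"
proof -
  have g: "integrable lebesgue (\<lambda>x. indicat_real \<Omega> x * g x)"
    using assms by (simp add: set_integrable_def)
  have "integrable lebesgue (\<lambda>x. sgn (e \<bullet> x) * (indicat_real \<Omega> x * g x))"
  proof (rule Bochner_Integration.integrable_bound[OF g])
    show "(\<lambda>x. sgn (e \<bullet> x) * (indicat_real \<Omega> x * g x)) \<in> borel_measurable lebesgue"
      using sgn_inner_measurable borel_measurable_integrable[OF g] by (rule borel_measurable_times)
  qed (auto simp: abs_mult sgn_real_def)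
  then show ?thesis by (simp add: set_integrable_def mult.left_commute)
qed

text \<open>When the directions converge to a \<noteq> 0, the signs converge off the hyperplane
  orthogonal to a, which is a null set; dominated convergence does the rest.\<close>

lemma imbalance_continuous:
  assumes g: "set_integrable lebesgue \<Omega> (integrand \<Omega> G v)"
  shows "continuous_on (- {0}) (imbalance \<Omega> G v)"
  unfolding continuous_on_sequentially
proof (intro allI ballI impI, elim conjE)
  fix e :: "nat \<Rightarrow> real^'a" and a
  assume a: "a \<in> - {0}" and e: "e \<longlonglongrightarrow> a"
  have g': "integrable lebesgue (\<lambda>x. indicat_real \<Omega> x * integrand \<Omega> G v x)"
    using g by (simp add: set_integrable_def)
  have "(\<lambda>n. LINT x|lebesgue. sgn (e n \<bullet> x) * (indicat_real \<Omega> x * integrand \<Omega> G v x)) \<longlonglongrightarrow>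
      (LINT x|lebesgue. sgn (a \<bullet> x) * (indicat_real \<Omega> x * integrand \<Omega> G v x))"
  proof (rule integral_dominated_convergence)
    show "integrable lebesgue (\<lambda>x. \<bar>indicat_real \<Omega> x * integrand \<Omega> G v x\<bar>)"
      using g' by (rule integrable_abs)
    show "(\<lambda>x. sgn (b \<bullet> x) * (indicat_real \<Omega> x * integrand \<Omega> G v x)) \<in> borel_measurable lebesgue" for b
      using sgn_inner_measurable borel_measurable_integrable[OF g'] by (rule borel_measurable_times)
    then show "(\<lambda>x. sgn (b \<bullet> x) * (indicat_real \<Omega> x * integrand \<Omega> G v x)) \<in> borel_measurable lebesgue" for b .
    show "AE x in lebesgue. (\<lambda>n. sgn (e n \<bullet> x) * (indicat_real \<Omega> x * integrand \<Omega> G v x))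
        \<longlonglongrightarrow> sgn (a \<bullet> x) * (indicat_real \<Omega> x * integrand \<Omega> G v x)"
    proof -
      have "a \<noteq> 0" using a by simp
      from AE_not_hyperplane[OF this] show ?thesis
        by eventually_elim (intro tendsto_mult tendsto_sgn tendsto_inner e tendsto_const)
    qed
    show "AE x in lebesgue. norm (sgn (e n \<bullet> x) * (indicat_real \<Omega> x * integrand \<Omega> G v x))
        \<le> \<bar>indicat_real \<Omega> x * integrand \<Omega> G v x\<bar>" for n
      by (intro AE_I2) (auto simp: abs_mult sgn_real_def)
  qed
  then show "(imbalance \<Omega> G v \<circ> e) \<longlonglongrightarrow> imbalance \<Omega> G v a"
    by (simp add: imbalance_def set_lebesgue_integral_def o_def mult.left_commute)
qed

locale reflection_space =
  fixes \<Omega> :: "(real^'N) set" and X :: "(real^'N \<Rightarrow> real^'n) set"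
  assumes open_\<Omega>: "open \<Omega>"
    and rotation_invariant: "rotation_invariant \<Omega>"
    and function_space: "function_space \<Omega> X"
    and two_le_dim: "2 \<le> CARD('N)"
    and reflect_plus_in: "v \<in> X \<Longrightarrow> a \<noteq> 0 \<Longrightarrow> reflect_plus a v \<in> X"
begin

lemma in_\<Omega>_norm_eq: "x \<in> \<Omega> \<Longrightarrow> norm x = norm y \<Longrightarrow> y \<in> \<Omega>"
  using rotation_invariant_norm_eq rotation_invariant two_le_dim by blast

lemma reflection_in_\<Omega>: "x \<in> \<Omega> \<Longrightarrow> hyperplane_reflection a x \<in> \<Omega>"
  using in_\<Omega>_norm_eq by simp

lemma indicator_\<Omega>_reflection: "indicat_real \<Omega> (hyperplane_reflection a x) = indicat_real \<Omega> x"
  using reflection_in_\<Omega>[of x a] reflection_in_\<Omega>[of "hyperplane_reflection a x" a]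
  by (auto simp: indicator_def)

lemma has_weak_gradient_weak_gradient:
  "v \<in> X \<Longrightarrow> has_weak_gradient \<Omega> v (weak_gradient \<Omega> v)"
  using function_space unfolding function_space_def weak_gradient_def by (metis someI_ex)

text \<open>\<open>weak_gradient\<close> is an arbitrary choice made for each function separately,
  so agreement of v and w passes to the integrands through uniqueness, and only almost
  everywhere.\<close>

lemma integrand_eq_AE:
  assumes "v \<in> X" "w \<in> X" "open U" "U \<subseteq> \<Omega>" "AE x in lebesgue. x \<in> U \<longrightarrow> v x = w x"
  shows "AE x in lebesgue. x \<in> U \<longrightarrow> integrand \<Omega> G v x = integrand \<Omega> G w x"
proof -
  have "AE x in lebesgue. x \<in> U \<longrightarrow> weak_gradient \<Omega> v x = weak_gradient \<Omega> w x"
    using assms has_weak_gradient_weak_gradient by (intro has_weak_gradient_unique) auto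
  with assms(5) show ?thesis
    by eventually_elim (simp add: integrand_def)
qed

lemma integrand_reflection_AE:
  assumes "v \<in> X" "\<And>x. x \<in> \<Omega> \<Longrightarrow> v (hyperplane_reflection a x) = v x"
  shows "AE x in lebesgue. x \<in> \<Omega> \<longrightarrow>
    integrand \<Omega> G v (hyperplane_reflection a x) = integrand \<Omega> G v x"
proof -
  let ?D = "weak_gradient \<Omega> v"
  have "AE x in lebesgue. x \<in> \<Omega> \<longrightarrow> ?D x = (\<chi> i. hyperplane_reflection a (?D (hyperplane_reflection a x) $ i))"
    using has_weak_gradient_weak_gradient[OF assms(1)] reflection_in_\<Omega> assms(2)
    by (intro has_weak_gradient_unique[of \<Omega> v _ v] has_weak_gradient_reflection open_\<Omega>) auto
  then show ?thesis
  proof eventually_elim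
    case (elim x)
    show ?case
    proof
      assume x: "x \<in> \<Omega>"
      then have "norm (?D x) = norm (?D (hyperplane_reflection a x))"
        using elim norm_rowwise_reflection by metis
      then show "integrand \<Omega> G v (hyperplane_reflection a x) = integrand \<Omega> G v x"
        using assms(2)[OF x] by (simp add: integrand_def)
    qed
  qed
qed

lemma functional_ae_eq:
  assumes "v \<in> X" "ae_eq_on \<Omega> v w"
    and "set_integrable lebesgue \<Omega> (integrand \<Omega> G v)" "set_integrable lebesgue \<Omega> (integrand \<Omega> G w)"
  shows "w \<in> X" "functional \<Omega> G v = functional \<Omega> G w"
proof -
  show w: "w \<in> X"
    using assms(1,2) function_space unfolding function_space_def by blast
  have "AE x in lebesgue. x \<in> \<Omega> \<longrightarrow> integrand \<Omega> G v x = integrand \<Omega> G w x"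
    using assms w by (intro integrand_eq_AE open_\<Omega>) (auto simp: ae_eq_on_def)
  then show "functional \<Omega> G v = functional \<Omega> G w"
    unfolding functional_def set_lebesgue_integral_def using assms(3,4)
    by (intro integral_cong_AE) (auto simp: set_integrable_def borel_measurable_integrable elim: eventually_mono)
qed

text \<open>The substitution by mirror images leaves the integrand unchanged and moves the
  reflection to the direction. For c = b this forces imbalance 0; iterated over orthogonal
  symmetries it yields further splitting directions.\<close>

lemma imbalance_reflection:
  assumes v: "v \<in> X" "\<And>x. x \<in> \<Omega> \<Longrightarrow> v (hyperplane_reflection b x) = v x"
    and int: "set_integrable lebesgue \<Omega> (integrand \<Omega> G v)"
  shows "imbalance \<Omega> G v (hyperplane_reflection b c) = imbalance \<Omega> G v c"
proof -
  let ?s = "hyperplane_reflection b"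
  have sym: "AE x in lebesgue. x \<in> \<Omega> \<longrightarrow> integrand \<Omega> G v (?s x) = integrand \<Omega> G v x"
    by (rule integrand_reflection_AE) (use v in auto)
  have i: "integrable lebesgue (\<lambda>x. indicat_real \<Omega> x *\<^sub>R (sgn (c \<bullet> x) * integrand \<Omega> G v x))" for c
    using set_integrable_sgn_times[OF int] by (simp add: set_integrable_def)
  have "imbalance \<Omega> G v (?s c) =
      (LINT x|lebesgue. indicat_real \<Omega> (?s x) *\<^sub>R (sgn (?s c \<bullet> ?s x) * integrand \<Omega> G v (?s x)))"
    unfolding imbalance_def set_lebesgue_integral_def by (rule integral_hyperplane_reflection[symmetric])
  also have "\<dots> = imbalance \<Omega> G v c"
    unfolding imbalance_def set_lebesgue_integral_def
  proof (rule integral_cong_AE)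
    show "AE x in lebesgue. indicat_real \<Omega> (?s x) *\<^sub>R (sgn (?s c \<bullet> ?s x) * integrand \<Omega> G v (?s x)) =
        indicat_real \<Omega> x *\<^sub>R (sgn (c \<bullet> x) * integrand \<Omega> G v x)"
      using sym
    proof eventually_elim
      case (elim x)
      then show ?case
        by (cases "x \<in> \<Omega>") (auto simp: indicator_\<Omega>_reflection inner_hyperplane_reflection)
    qed
  qed (use i integrable_hyperplane_reflection[OF i] in \<open>auto dest: borel_measurable_integrable\<close>)
  finally show ?thesis .
qed

text \<open>The symmetrization has twice the integral of v over the positive side, and
  \<open>1 + sgn (a \<bullet> x)\<close> equals 2 there and 0 on the other side.\<close>

lemma functional_reflect_plus:
  assumes v: "v \<in> X" and a: "a \<noteq> 0"
    and int: "\<And>w. w \<in> X \<Longrightarrow> set_integrable lebesgue \<Omega> (integrand \<Omega> G w)"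
  shows "functional \<Omega> G (reflect_plus a v) = functional \<Omega> G v + imbalance \<Omega> G v a"
proof -
  let ?s = "hyperplane_reflection a"
  let ?w = "reflect_plus a v"
  let ?g = "integrand \<Omega> G v" and ?h = "integrand \<Omega> G ?w"
  have w: "?w \<in> X" using reflect_plus_in[OF v a] .
  have U: "open (\<Omega> \<inter> {x. a \<bullet> x > 0})" by (intro open_Int open_\<Omega> open_halfspace_gt)
  have eq: "AE x in lebesgue. x \<in> \<Omega> \<inter> {x. a \<bullet> x > 0} \<longrightarrow> ?h x = ?g x"
    using v w U by (intro integrand_eq_AE) (auto simp: reflect_plus_def)
  have sym: "AE x in lebesgue. x \<in> \<Omega> \<longrightarrow> ?h (?s x) = ?h x"
    using w by (intro integrand_reflection_AE) auto
  have ig: "integrable lebesgue (\<lambda>x. indicat_real \<Omega> x *\<^sub>R ?g x)"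
    and ih: "integrable lebesgue (\<lambda>x. indicat_real \<Omega> x *\<^sub>R ?h x)"
    and ish: "integrable lebesgue (\<lambda>x. indicat_real \<Omega> x *\<^sub>R (sgn (a \<bullet> x) * ?h x))"
    and isg: "integrable lebesgue (\<lambda>x. indicat_real \<Omega> x *\<^sub>R (sgn (a \<bullet> x) * ?g x))"
    using int[OF v] int[OF w] set_integrable_sgn_times[OF int[OF v], of a] set_integrable_sgn_times[OF int[OF w], of a]
    by (simp_all add: set_integrable_def)
  have "imbalance \<Omega> G ?w a = imbalance \<Omega> G ?w (?s a)"
    using w int by (intro imbalance_reflection[symmetric]) auto
  then have "imbalance \<Omega> G ?w a = 0"
    by (simp add: hyperplane_reflection_self imbalance_uminus)
  \<comment> \<open>Adding the vanishing imbalance supplies the weight 1 + sgn, which sees only the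
    side where the two functions agree.\<close>
  then have "functional \<Omega> G ?w = functional \<Omega> G ?w + imbalance \<Omega> G ?w a" by simp
  also have "\<dots> = (LINT x|lebesgue. indicat_real \<Omega> x *\<^sub>R ?h x + indicat_real \<Omega> x *\<^sub>R (sgn (a \<bullet> x) * ?h x))"
    unfolding functional_def imbalance_def set_lebesgue_integral_def
    by (rule Bochner_Integration.integral_add[symmetric, OF ih ish])
  also have "\<dots> = (LINT x|lebesgue. indicat_real \<Omega> x *\<^sub>R ?g x + indicat_real \<Omega> x *\<^sub>R (sgn (a \<bullet> x) * ?g x))"
  proof (rule integral_cong_AE)
    show "AE x in lebesgue. indicat_real \<Omega> x *\<^sub>R ?h x + indicat_real \<Omega> x *\<^sub>R (sgn (a \<bullet> x) * ?h x) =
        indicat_real \<Omega> x *\<^sub>R ?g x + indicat_real \<Omega> x *\<^sub>R (sgn (a \<bullet> x) * ?g x)"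
      using eq AE_not_hyperplane[OF a]
      by eventually_elim (auto simp: indicator_def sgn_real_def)
  qed (use ig ih ish isg in \<open>auto intro!: borel_measurable_add dest: borel_measurable_integrable\<close>)
  also have "\<dots> = functional \<Omega> G v + imbalance \<Omega> G v a"
    unfolding functional_def imbalance_def set_lebesgue_integral_def
    by (rule Bochner_Integration.integral_add[OF ig isg])
  finally show ?thesis .
qed

end

section \<open>Minimizers and splitting directions\<close>

locale constrained_problem = reflection_space \<Omega> X
  for \<Omega> :: "(real^'N) set" and X :: "(real^'N \<Rightarrow> real^'n) set" +
  fixes F :: "real \<Rightarrow> real^'n \<Rightarrow> real \<Rightarrow> real"
    and k :: nat and G :: "nat \<Rightarrow> real \<Rightarrow> real^'n \<Rightarrow> real \<Rightarrow> real" and lam :: "nat \<Rightarrow> real"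
  assumes F_int: "v \<in> X \<Longrightarrow> set_integrable lebesgue \<Omega> (integrand \<Omega> F v)"
    and G_int: "v \<in> X \<Longrightarrow> j \<in> {1..k} \<Longrightarrow> set_integrable lebesgue \<Omega> (integrand \<Omega> (G j) v)"
    and codim: "k + 2 \<le> CARD('N)"
    and regular: "minimizer \<Omega> X F k G lam v \<Longrightarrow> \<exists>w. C1_representative \<Omega> v w"
begin

abbreviation "is_minimizer \<equiv> minimizer \<Omega> X F k G lam"

definition splitting :: "(real^'N \<Rightarrow> real^'n) \<Rightarrow> (real^'N) set" where
  "splitting v = {e. e \<noteq> 0 \<and> (\<forall>j\<in>{1..k}. imbalance \<Omega> (G j) v e = 0)}"

lemma minimizer_in: "is_minimizer v \<Longrightarrow> v \<in> X"
  by (simp add: minimizer_def admissible_def)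

lemma splitting_uminus: "e \<in> splitting v \<Longrightarrow> - e \<in> splitting v"
  by (simp add: splitting_def imbalance_uminus)

text \<open>The two symmetrizations are admissible and the mean of their energies is that of \<open>v\<close>.\<close>

lemma minimizer_reflect_plus:
  assumes v: "is_minimizer v" and e: "e \<in> splitting v"
  shows "is_minimizer (reflect_plus e v)"
proof -
  have vX: "v \<in> X" using minimizer_in[OF v] .
  have adm: "reflect_plus c v \<in> admissible \<Omega> X k G lam" if "c \<in> splitting v" for c
  proof -
    have c: "c \<noteq> 0" "\<And>j. j \<in> {1..k} \<Longrightarrow> imbalance \<Omega> (G j) v c = 0"
      using that by (auto simp: splitting_def)
    have "functional \<Omega> (G j) (reflect_plus c v) = lam j" if j: "j \<in> {1..k}" for j
      using functional_reflect_plus[OF vX c(1) G_int[OF _ j]] c(2)[OF j] v j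
      by (simp add: minimizer_def admissible_def)
    then show ?thesis
      using reflect_plus_in[OF vX c(1)] by (simp add: admissible_def)
  qed
  have e0: "e \<noteq> 0" using e by (simp add: splitting_def)
  have 1: "functional \<Omega> F (reflect_plus e v) = functional \<Omega> F v + imbalance \<Omega> F v e"
    using functional_reflect_plus[OF vX e0 F_int] .
  \<comment> \<open>The direction - e has the same mirror and keeps the values on the other
    side.\<close>
  have 2: "functional \<Omega> F (reflect_plus (- e) v) = functional \<Omega> F v - imbalance \<Omega> F v e"
    using functional_reflect_plus[OF vX _ F_int, of "- e"] e0 by (simp add: imbalance_uminus)
  have "functional \<Omega> F v \<le> functional \<Omega> F (reflect_plus (- e) v)"
    using v adm[OF splitting_uminus[OF e]] by (simp add: minimizer_def)
  then show ?thesis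
    using v adm[OF e] 1 2 unfolding minimizer_def by force
qed

lemma minimizer_ae_eq:
  assumes v: "is_minimizer v" and w: "ae_eq_on \<Omega> v w"
  shows "is_minimizer w"
proof -
  have vX: "v \<in> X" using minimizer_in[OF v] .
  have wX: "w \<in> X" using vX w function_space unfolding function_space_def by blast
  have "functional \<Omega> (G j) v = functional \<Omega> (G j) w" if "j \<in> {1..k}" for j
    using functional_ae_eq(2)[OF vX w G_int[OF vX that] G_int[OF wX that]] .
  moreover have "functional \<Omega> F v = functional \<Omega> F w"
    using functional_ae_eq(2)[OF vX w F_int[OF vX] F_int[OF wX]] .
  ultimately show ?thesis
    using v wX by (simp add: minimizer_def admissible_def)
qed

end

section \<open>Rotational invariance and the differential\<close>

text \<open>Points of equal norm in one coset of P form an orbit of the orthogonal maps fixing the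
  orthogonal complement of P. Stated by points, invariance makes sense also on half-spaces S, which
  these maps do not preserve.\<close>

definition sphere_invariant :: "'a::euclidean_space set \<Rightarrow> 'a set \<Rightarrow> ('a \<Rightarrow> 'b) \<Rightarrow> bool" where
  "sphere_invariant S P f \<longleftrightarrow> (\<forall>x\<in>S. \<forall>y\<in>S. norm x = norm y \<and> x - y \<in> P \<longrightarrow> f x = f y)"

text \<open>If x is not orthogonal to P, this says that on P the map l is a multiple of the inner
  product with x. The cross-multiplied form passes to limits in x.\<close>

definition gradient_radial :: "('a::euclidean_space \<Rightarrow> 'b::real_normed_vector) \<Rightarrow> 'a \<Rightarrow> 'a set \<Rightarrow> bool" where
  "gradient_radial l x P \<longleftrightarrow> (\<forall>a\<in>P. \<forall>b\<in>P. (b \<bullet> x) *\<^sub>R l a = (a \<bullet> x) *\<^sub>R l b)"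

lemma sphere_invariantD:
  "sphere_invariant S P f \<Longrightarrow> x \<in> S \<Longrightarrow> y \<in> S \<Longrightarrow> norm x = norm y \<Longrightarrow> x - y \<in> P \<Longrightarrow> f x = f y"
  by (auto simp: sphere_invariant_def)

lemma sphere_invariant_mono:
  "sphere_invariant S P f \<Longrightarrow> T \<subseteq> S \<Longrightarrow> Q \<subseteq> P \<Longrightarrow> sphere_invariant T Q f"
  unfolding sphere_invariant_def by blast

lemma sphere_invariant_cong:
  "(\<And>x. x \<in> S \<Longrightarrow> f x = g x) \<Longrightarrow> sphere_invariant S P f = sphere_invariant S P g"
  by (simp add: sphere_invariant_def)

lemma sphere_invariant_reflection:
  assumes "sphere_invariant S P f" "subspace P" "c \<in> P" "x \<in> S" "hyperplane_reflection c x \<in> S"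
  shows "f (hyperplane_reflection c x) = f x"
proof -
  have "hyperplane_reflection c x - x \<in> P"
    using assms(2,3) by (simp add: hyperplane_reflection_eq subspace_neg subspace_scale)
  then show ?thesis using assms by (intro sphere_invariantD[of S P f]) auto
qed

lemma reflection_invariant_derivative:
  assumes S: "open S" "x \<in> S" "hyperplane_reflection c x \<in> S"
    and sym: "\<And>y. y \<in> S \<Longrightarrow> hyperplane_reflection c y \<in> S \<Longrightarrow> f (hyperplane_reflection c y) = f y"
    and d: "f differentiable (at x)" "f differentiable (at (hyperplane_reflection c x))"
  shows "frechet_derivative f (at (hyperplane_reflection c x)) (hyperplane_reflection c h) = frechet_derivative f (at x) h"
proof -
  let ?s = "hyperplane_reflection c"
  define T where "T = S \<inter> ?s -` S"
  have T: "open T" "x \<in> T"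
    using S continuous_hyperplane_reflection[of UNIV c]
    by (auto simp: T_def intro!: open_Int open_vimage)
  have "((\<lambda>y. f (?s y)) has_derivative (\<lambda>h. frechet_derivative f (at (?s x)) (?s h))) (at x)"
    using d(2) frechet_derivative_works
    by (intro has_derivative_compose[OF bounded_linear_imp_has_derivative[OF bounded_linear_hyperplane_reflection]]) blast
  then have "(f has_derivative (\<lambda>h. frechet_derivative f (at (?s x)) (?s h))) (at x)"
    by (rule has_derivative_transform_within_open[OF _ T]) (auto simp: T_def sym)
  then show ?thesis using frechet_derivative_at by metis
qed

text \<open>The vector c below lies in P and is orthogonal to x, so the reflection along c fixes x
  and preserves f. The derivative along c therefore equals its own negative.\<close>

lemma sphere_invariant_gradient_radial:
  assumes S: "open S" "x \<in> S" and inv: "sphere_invariant S P f" and P: "subspace P"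
    and d: "f differentiable (at x)"
  shows "gradient_radial (frechet_derivative f (at x)) x P"
  unfolding gradient_radial_def
proof (intro ballI)
  fix a b assume ab: "a \<in> P" "b \<in> P"
  let ?l = "frechet_derivative f (at x)"
  have lin: "linear ?l" using d by (rule linear_frechet_derivative)
  define c where "c = (b \<bullet> x) *\<^sub>R a - (a \<bullet> x) *\<^sub>R b"
  have c: "c \<in> P" using ab P by (simp add: c_def subspace_diff subspace_scale)
  have "c \<bullet> x = 0" by (simp add: c_def inner_diff_left)
  then have sx: "hyperplane_reflection c x = x" by simp
  have "?l (hyperplane_reflection c c) = ?l c"
    using reflection_invariant_derivative[of S x c f c] S d sphere_invariant_reflection[OF inv P c]
    by (simp add: sx)
  then have "?l c = - ?l c"
    by (simp add: hyperplane_reflection_self linear_neg[OF lin])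
  then have "2 *\<^sub>R ?l c = 0" by (simp add: scaleR_2 eq_neg_iff_add_eq_0)
  then have "?l c = 0" by simp
  then show "(b \<bullet> x) *\<^sub>R ?l a = (a \<bullet> x) *\<^sub>R ?l b"
    by (simp add: c_def linear_diff[OF lin] linear_scale[OF lin])
qed

text \<open>By symmetry the normal derivative of the symmetrization vanishes on the hyperplane. It
  agrees with f along the ray from x in direction c, and a one-sided derivative already determines
  the derivative of f.\<close>

lemma reflect_plus_normal_derivative:
  fixes f :: "'a::euclidean_space \<Rightarrow> 'b::real_normed_vector"
  assumes c: "c \<bullet> x = 0" "c \<noteq> 0"
    and d: "f differentiable (at x)" "reflect_plus c f differentiable (at x)"
  shows "frechet_derivative f (at x) c = 0"
proof -
  let ?w = "reflect_plus c f"
  have sx: "hyperplane_reflection c x = x" using c(1) by simp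
  have lin: "linear (frechet_derivative ?w (at x))" using d(2) by (rule linear_frechet_derivative)
  have "frechet_derivative ?w (at x) (hyperplane_reflection c c) = frechet_derivative ?w (at x) c"
    using reflection_invariant_derivative[of UNIV x c ?w c] d(2) by (simp add: sx)
  then have "frechet_derivative ?w (at x) c = - frechet_derivative ?w (at x) c"
    by (simp add: hyperplane_reflection_self linear_neg[OF lin])
  then have "2 *\<^sub>R frechet_derivative ?w (at x) c = 0" by (simp add: scaleR_2 eq_neg_iff_add_eq_0)
  then have w0: "frechet_derivative ?w (at x) c = 0" by simp
  have vd: "((\<lambda>t. g (x + t *\<^sub>R c)) has_vector_derivative frechet_derivative g (at x) c) (at 0 within {0..})"
    if "g differentiable (at x)" for g :: "'a \<Rightarrow> 'b"
  proof -
    have lin: "linear (frechet_derivative g (at x))" using that by (rule linear_frechet_derivative)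
    have "((\<lambda>t. g (x + t *\<^sub>R c)) has_derivative (\<lambda>t. frechet_derivative g (at x) (t *\<^sub>R c))) (at 0 within {0..})"
    proof (rule has_derivative_compose[where g=g])
      show "((\<lambda>t. x + t *\<^sub>R c) has_derivative (\<lambda>t. t *\<^sub>R c)) (at 0 within {0..})"
        by (auto intro!: derivative_eq_intros)
      show "(g has_derivative frechet_derivative g (at x)) (at (x + 0 *\<^sub>R c))"
        using that frechet_derivative_works by auto
    qed
    then show ?thesis by (simp add: has_vector_derivative_def linear_scale[OF lin])
  qed
  have "f (x + t *\<^sub>R c) = ?w (x + t *\<^sub>R c)" if "t \<ge> 0" for t
    using c that by (simp add: reflect_plus_def inner_add_right)
  then have "((\<lambda>t. f (x + t *\<^sub>R c)) has_vector_derivative 0) (at 0 within {0..})"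
    using has_vector_derivative_transform[of "0::real" "{0..}", OF _ _ vd[OF d(2)]] w0 by simp
  then show ?thesis
    using vector_derivative_unique_within[OF _ vd[OF d(1)]] by (simp add: at_within_Ici_at_right)
qed

lemma subspace_ex_orthogonal:
  fixes P :: "'a::euclidean_space set"
  assumes "subspace P" "dim P \<ge> 2"
  shows "\<exists>d\<in>P. d \<noteq> 0 \<and> d \<bullet> x = 0"
proof (rule ccontr)
  assume no: "\<not> ?thesis"
  have lin: "linear (\<lambda>y. y \<bullet> x)" by (rule linearI) (auto simp: inner_left_distrib)
  have "inj_on (\<lambda>y. y \<bullet> x) P"
  proof (rule inj_onI)
    fix y z assume "y \<in> P" "z \<in> P" "y \<bullet> x = z \<bullet> x"
    then have "y - z \<in> P" "(y - z) \<bullet> x = 0"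
      using assms(1) by (auto simp: subspace_diff inner_diff_left)
    then show "y = z" using no by auto
  qed
  then have "dim ((\<lambda>y. y \<bullet> x) ` P) = dim P"
    using lin assms(1) by (intro dim_image_eq) (auto simp: span_eq_iff[THEN iffD2])
  then show False
    using assms(2) dim_subset_UNIV[of "(\<lambda>y. y \<bullet> x) ` P"] by simp
qed

lemma subspace_ex_orthogonal_unit:
  fixes P :: "'a::euclidean_space set"
  assumes "subspace P" "dim P \<ge> 2"
  obtains d where "d \<in> P" "norm d = 1" "d \<bullet> x = 0"
proof -
  obtain d where "d \<in> P" "d \<noteq> 0" "d \<bullet> x = 0"
    using subspace_ex_orthogonal[OF assms] by blast
  then show thesis
    using assms(1) by (intro that[of "d /\<^sub>R norm d"]) (auto simp: subspace_scale)
qed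

lemma norm_sum_orthogonal_eq:
  fixes v z :: "'a::real_inner"
  assumes "v \<bullet> z = 0" "v \<bullet> w = 0"
  shows "norm (v + z) = norm (v + w) \<longleftrightarrow> norm z = norm w"
  using assms by (simp add: norm_eq inner_add_left inner_add_right inner_commute)

text \<open>Any two points of a sphere in a coset of \<open>D\<close> are joined by an arc of a great circle, on
  which the velocity is orthogonal to the position.\<close>

lemma gradient_radial_imp_constant:
  fixes f :: "'a::euclidean_space \<Rightarrow> 'b::real_normed_vector"
  assumes \<Omega>: "\<And>x y. x \<in> \<Omega> \<Longrightarrow> norm x = norm y \<Longrightarrow> y \<in> \<Omega>"
    and d: "\<And>x. x \<in> \<Omega> \<Longrightarrow> f differentiable (at x)"
    and D: "subspace D" "dim D \<ge> 2" and T: "subspace T" "D \<subseteq> T"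
    and rad: "\<And>x. x \<in> \<Omega> \<inter> T \<Longrightarrow> gradient_radial (frechet_derivative f (at x)) x D"
  shows "sphere_invariant (\<Omega> \<inter> T) D f"
  unfolding sphere_invariant_def
proof (intro ballI impI, elim conjE)
  fix x y assume xy: "x \<in> \<Omega> \<inter> T" "y \<in> \<Omega> \<inter> T" "norm x = norm y" "x - y \<in> D"
  obtain z v where zv: "z \<in> D" "\<And>w. w \<in> D \<Longrightarrow> v \<bullet> w = 0" "x = z + v"
    using orthogonal_subspace_decomp_exists[of D x] D(1)
    by (auto simp: orthogonal_def span_eq_iff[THEN iffD2])
  define z' where "z' = z - (x - y)"
  have z': "z' \<in> D" "y = z' + v"
    using subspace_diff[OF D(1) zv(1) xy(4)] zv(3) by (simp_all add: z'_def)
  have nz: "norm z' = norm z"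
    using norm_sum_orthogonal_eq[of v z z'] xy(3) zv(1,2) z' zv(3) by (simp add: add.commute)
  show "f x = f y"
  proof (cases "z = 0")
    case True
    then show ?thesis using nz z' zv(3) by simp
  next
    case False
    define r where "r = norm z"
    have r: "r > 0" using False by (simp add: r_def)
    define p where "p = z /\<^sub>R r"
    have "norm p = 1" using r by (simp add: p_def r_def)
    then have "p \<bullet> p = 1" by (simp only: norm_eq_1)
    moreover have "p \<in> D" "z = r *\<^sub>R p"
      using r zv(1) D(1) by (auto simp: p_def subspace_scale)
    ultimately have p: "p \<in> D" "p \<bullet> p = 1" "z = r *\<^sub>R p" by auto
    \<comment> \<open>A plane in D containing p and z'. If z' is a multiple of p, as for antipodal
      points, any unit vector of D orthogonal to p serves; it exists because D has dimension at
      least 2.\<close>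
    obtain q where q: "q \<in> D" "q \<bullet> q = 1" "p \<bullet> q = 0" "z' = (z' \<bullet> p) *\<^sub>R p + (z' \<bullet> q) *\<^sub>R q"
    proof (cases "z' = (z' \<bullet> p) *\<^sub>R p")
      case True
      obtain q where "q \<in> D" "norm q = 1" "q \<bullet> p = 0"
        using subspace_ex_orthogonal_unit[OF D] by metis
      moreover have "z' \<bullet> q = (z' \<bullet> p) * (p \<bullet> q)"
        using arg_cong[OF True, of "\<lambda>w. w \<bullet> q"] by simp
      ultimately show ?thesis using True by (intro that[of q]) (auto simp: norm_eq_1 inner_commute[of p q])
    next
      case False
      define s where "s = z' - (z' \<bullet> p) *\<^sub>R p"
      define q where "q = s /\<^sub>R norm s"
      have s: "s \<noteq> 0" "s \<in> D" "s \<bullet> p = 0"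
        using False z'(1) p D(1) by (auto simp: s_def subspace_diff subspace_scale inner_diff_left)
      have "z' \<bullet> s = s \<bullet> s"
        using s(3) by (simp add: s_def inner_diff_left inner_diff_right inner_commute p(2))
      then have "(z' \<bullet> q) *\<^sub>R q = s"
      proof -
        have "inverse (norm s) * (norm s * norm s) * inverse (norm s) = 1"
          using s(1) by (simp add: field_simps)
        moreover have "z' \<bullet> s = norm s * norm s"
          using \<open>z' \<bullet> s = s \<bullet> s\<close> by (simp add: power2_norm_eq_inner[symmetric] power2_eq_square)
        ultimately show ?thesis by (simp add: q_def)
      qed
      then have "z' = (z' \<bullet> p) *\<^sub>R p + (z' \<bullet> q) *\<^sub>R q" by (simp add: s_def)
      moreover have "norm q = 1" using s(1) by (simp add: q_def)
      moreover have "q \<in> D" "p \<bullet> q = 0"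
        using s D(1) by (auto simp: q_def subspace_scale inner_commute)
      ultimately show ?thesis by (intro that[of q]) (auto simp: norm_eq_1)
    qed
    have "z' \<bullet> z' = z' \<bullet> ((z' \<bullet> p) *\<^sub>R p + (z' \<bullet> q) *\<^sub>R q)"
      using q(4) by simp
    then have "(z' \<bullet> p)\<^sup>2 + (z' \<bullet> q)\<^sup>2 = z' \<bullet> z'"
      by (simp add: inner_add_right power2_eq_square)
    also have "\<dots> = r\<^sup>2" using nz by (simp add: r_def power2_norm_eq_inner norm_eq)
    finally have "((z' \<bullet> p) / r)\<^sup>2 + ((z' \<bullet> q) / r)\<^sup>2 = 1"
      using r by (simp add: power_divide add_divide_distrib[symmetric])
    then obtain t1 where t1: "(z' \<bullet> p) / r = cos t1" "(z' \<bullet> q) / r = sin t1"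
      using sincos_total_2pi by metis
    define \<gamma> where "\<gamma> t = v + (r * cos t) *\<^sub>R p + (r * sin t) *\<^sub>R q" for t
    have \<gamma>0: "\<gamma> 0 = x" using zv(3) p(3) by (simp add: \<gamma>_def)
    have \<gamma>1: "\<gamma> t1 = y"
    proof -
      have "z' \<bullet> p = r * cos t1" "z' \<bullet> q = r * sin t1"
        using t1 r by (auto simp: field_simps)
      then have "z' = (r * cos t1) *\<^sub>R p + (r * sin t1) *\<^sub>R q" using q(4) by simp
      then show ?thesis using z'(2) by (simp add: \<gamma>_def add.commute add.left_commute)
    qed
    have vpq: "v \<bullet> p = 0" "v \<bullet> q = 0" using zv(2) p(1) q(1) by auto
    have rcs: "(r * cos t)\<^sup>2 + (r * sin t)\<^sup>2 = r\<^sup>2" for t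
      by (simp add: power_mult_distrib distrib_left[symmetric])
    have "\<gamma> t \<in> \<Omega> \<inter> T" for t
    proof
      have "\<gamma> t \<bullet> \<gamma> t = v \<bullet> v + ((r * cos t)\<^sup>2 + (r * sin t)\<^sup>2)"
        using vpq q(2,3) p(2)
        by (simp add: \<gamma>_def inner_add_left inner_add_right inner_commute power2_eq_square)
      also have "\<dots> = v \<bullet> v + r\<^sup>2" by (simp only: rcs)
      also have "\<dots> = x \<bullet> x"
        using vpq by (simp add: zv(3) p(3) inner_add_left inner_add_right inner_commute p(2) power2_eq_square)
      finally have "norm x = norm (\<gamma> t)" by (simp add: norm_eq)
      then show "\<gamma> t \<in> \<Omega>" using \<Omega> xy(1) by blast
      have "v = x - z" using zv(3) by simp
      then have "v \<in> T" using xy(1) zv(1) T by (auto intro: subspace_diff)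
      then show "\<gamma> t \<in> T"
        unfolding \<gamma>_def using T p(1) q(1) by (auto intro!: subspace_add subspace_scale)
    qed
    then have \<gamma>: "\<gamma> t \<in> \<Omega>" "gradient_radial (frechet_derivative f (at (\<gamma> t))) (\<gamma> t) D" for t
      using rad by auto
    have "((\<lambda>t. f (\<gamma> t)) has_vector_derivative 0) (at t within UNIV)" for t
    proof -
      let ?l = "frechet_derivative f (at (\<gamma> t))"
      have lin: "linear ?l" using d[OF \<gamma>(1)] by (rule linear_frechet_derivative)
      define w where "w = (- r * sin t) *\<^sub>R p + (r * cos t) *\<^sub>R q"
      \<comment> \<open>The velocity w is orthogonal to \<open>\<gamma> t\<close>, while the
        component b of \<open>\<gamma> t\<close> in D has inner product r^2 with it. The radial
        condition for w and b thus annihilates the derivative along w.\<close>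
      define b where "b = (r * cos t) *\<^sub>R p + (r * sin t) *\<^sub>R q"
      have wb: "w \<in> D" "b \<in> D"
        unfolding w_def b_def using D(1) p(1) q(1) by (auto intro!: subspace_add subspace_diff subspace_scale)
      have "w \<bullet> \<gamma> t = 0"
        using vpq p(2) q(2,3)
        by (simp add: w_def \<gamma>_def inner_add_left inner_add_right inner_diff_left inner_commute algebra_simps)
      moreover have "b \<bullet> \<gamma> t = (r * cos t)\<^sup>2 + (r * sin t)\<^sup>2"
        using vpq p(2) q(2,3)
        by (simp add: b_def \<gamma>_def inner_add_left inner_add_right inner_commute power2_eq_square)
      ultimately have "r\<^sup>2 *\<^sub>R ?l w = 0"
        using \<gamma>(2)[of t] wb by (auto simp: gradient_radial_def rcs)
      then have lw: "?l w = 0" using r by simp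
      have "(\<gamma> has_derivative (\<lambda>h. h *\<^sub>R w)) (at t)"
        unfolding \<gamma>_def w_def by (auto intro!: derivative_eq_intros simp: algebra_simps)
      then have "((\<lambda>t. f (\<gamma> t)) has_derivative (\<lambda>h. ?l (h *\<^sub>R w))) (at t)"
        by (rule has_derivative_compose[where g=f])
           (use d[OF \<gamma>(1)] frechet_derivative_works in blast)
      then show ?thesis by (simp add: has_vector_derivative_def linear_scale[OF lin] lw)
    qed
    then obtain c where "\<And>t. t \<in> UNIV \<Longrightarrow> f (\<gamma> t) = c"
      using has_vector_derivative_zero_constant[OF convex_UNIV, of "\<lambda>t. f (\<gamma> t)"] by blast
    then have "f (\<gamma> 0) = f (\<gamma> t1)" by simp
    then show ?thesis by (simp add: \<gamma>0 \<gamma>1)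
  qed
qed

text \<open>Let \<open>m\<close> be the differential minus its radial part along \<open>P\<close>, so that \<open>m\<close> vanishes on \<open>P\<close>
  and is unchanged by reflections along \<open>P\<close>. Such reflections move \<open>x\<close>, and comparing the
  condition on \<open>Q\<close> at \<open>x\<close> and at its mirror images forces \<open>m\<close> to vanish on \<open>Q\<close> as well.\<close>

lemma gradient_radial_union:
  fixes f :: "'a::euclidean_space \<Rightarrow> 'b::real_normed_vector"
  assumes U: "open U" "x \<in> U" and d: "\<And>y. y \<in> U \<Longrightarrow> f differentiable (at y)"
    and P: "subspace P" "sphere_invariant U P f" and Q: "subspace Q" "sphere_invariant U Q f"
    and e: "e \<in> P" "e \<bullet> x \<noteq> 0" and dd: "dd \<in> P" "dd \<noteq> 0" "dd \<bullet> x = 0"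
    and e': "e' \<in> Q" "e' \<bullet> e \<noteq> 0" and b0: "b0 \<in> Q" "b0 \<bullet> e = 0" "b0 \<bullet> x \<noteq> 0"
  shows "\<exists>\<mu>. \<forall>a\<in>P \<union> Q. frechet_derivative f (at x) a = (a \<bullet> x) *\<^sub>R \<mu>"
proof -
  let ?l = "\<lambda>y. frechet_derivative f (at y)"
  have lin: "linear (?l y)" if "y \<in> U" for y using d[OF that] by (rule linear_frechet_derivative)
  define \<mu> where "\<mu> = ?l x e /\<^sub>R (e \<bullet> x)"
  have radP: "?l x a = (a \<bullet> x) *\<^sub>R \<mu>" if "a \<in> P" for a
  proof -
    have "(e \<bullet> x) *\<^sub>R ?l x a = (a \<bullet> x) *\<^sub>R ?l x e"
      using sphere_invariant_gradient_radial[OF U P(2,1) d[OF U(2)]] that e(1) by (auto simp: gradient_radial_def)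
    then have "(1 / (e \<bullet> x)) *\<^sub>R ((e \<bullet> x) *\<^sub>R ?l x a) = (1 / (e \<bullet> x)) *\<^sub>R ((a \<bullet> x) *\<^sub>R ?l x e)" by simp
    then show ?thesis using e(2) by (simp add: \<mu>_def divide_inverse mult.commute)
  qed
  define m where "m h = ?l x h - (h \<bullet> x) *\<^sub>R \<mu>" for h
  have mlin: "linear m"
    unfolding m_def by (rule linearI)
      (auto simp: linear_add[OF lin[OF U(2)]] linear_scale[OF lin[OF U(2)]] inner_left_distrib algebra_simps)
  have mP: "m a = 0" if "a \<in> P" for a using radP[OF that] by (simp add: m_def)
  have radQ: "(b \<bullet> y) *\<^sub>R ?l y a = (a \<bullet> y) *\<^sub>R ?l y b" if "y \<in> U" "a \<in> Q" "b \<in> Q" for y a b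
    using sphere_invariant_gradient_radial[OF U(1) that(1) Q(2,1) d[OF that(1)]] that by (auto simp: gradient_radial_def)
  have mx: "(b \<bullet> x) *\<^sub>R m a = (a \<bullet> x) *\<^sub>R m b" if "a \<in> Q" "b \<in> Q" for a b
    using radQ[OF U(2) that] by (simp add: m_def algebra_simps)
  have mc: "(b \<bullet> c) *\<^sub>R m a = (a \<bullet> c) *\<^sub>R m b"
    if ab: "a \<in> Q" "b \<in> Q" and c: "c \<in> P" "c \<bullet> x \<noteq> 0" "hyperplane_reflection c x \<in> U" for a b c
  proof -
    let ?y = "hyperplane_reflection c x"
    have ly: "?l ?y h = m h + (h \<bullet> ?y) *\<^sub>R \<mu>" for h
    proof -
      have "?l ?y h = ?l x (hyperplane_reflection c h)"
        using reflection_invariant_derivative[OF U c(3) _ d[OF U(2)] d[OF c(3)], of "hyperplane_reflection c h"]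
          sphere_invariant_reflection[OF P(2,1) c(1)] by simp
      also have "\<dots> = m (hyperplane_reflection c h) + (hyperplane_reflection c h \<bullet> x) *\<^sub>R \<mu>"
        by (simp add: m_def)
      also have "m (hyperplane_reflection c h) = m h"
        by (simp add: hyperplane_reflection_eq linear_diff[OF mlin] linear_scale[OF mlin] mP[OF c(1)])
      finally show ?thesis by (simp add: inner_hyperplane_reflection)
    qed
    have "(b \<bullet> ?y) *\<^sub>R m a = (a \<bullet> ?y) *\<^sub>R m b"
      using radQ[OF c(3) ab] by (simp add: ly algebra_simps)
    then have "(2 / (c \<bullet> c) * (c \<bullet> x)) *\<^sub>R ((b \<bullet> c) *\<^sub>R m a) = (2 / (c \<bullet> c) * (c \<bullet> x)) *\<^sub>R ((a \<bullet> c) *\<^sub>R m b)"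
      using mx[OF ab] by (simp add: hyperplane_reflection_eq inner_diff_right scaleR_diff_left)
    moreover have "2 / (c \<bullet> c) * (c \<bullet> x) \<noteq> 0" using c(2) by auto
    ultimately show ?thesis by (simp only: scaleR_cancel_left) blast
  qed
  \<comment> \<open>Reflection along dd fixes x. Adding a small multiple of e makes the mirror image
    differ from x and yet stay in U.\<close>
  have "((\<lambda>t. hyperplane_reflection (dd + t *\<^sub>R e) x) \<longlongrightarrow> hyperplane_reflection (dd + 0 *\<^sub>R e) x) (at_right 0)"
    unfolding hyperplane_reflection_def using dd(2)
    by (intro tendsto_intros) auto
  then have "\<forall>\<^sub>F t in at_right 0. hyperplane_reflection (dd + t *\<^sub>R e) x \<in> U"
    using U dd(3) by (intro topological_tendstoD) auto
  then obtain r where r: "r > 0" "\<And>t. 0 < t \<Longrightarrow> t < r \<Longrightarrow> hyperplane_reflection (dd + t *\<^sub>R e) x \<in> U"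
    unfolding eventually_at_right_field by auto
  have mt: "(b \<bullet> dd) *\<^sub>R m a + t *\<^sub>R ((b \<bullet> e) *\<^sub>R m a) = (a \<bullet> dd) *\<^sub>R m b + t *\<^sub>R ((a \<bullet> e) *\<^sub>R m b)"
    if "a \<in> Q" "b \<in> Q" "0 < t" "t < r" for a b t
  proof -
    have "dd + t *\<^sub>R e \<in> P" using dd(1) e(1) P(1) by (simp add: subspace_add subspace_scale)
    moreover have "(dd + t *\<^sub>R e) \<bullet> x \<noteq> 0" using dd(3) e(2) that(3) by (simp add: inner_add_left)
    ultimately show ?thesis
      using mc[OF that(1,2) _ _ r(2)[OF that(3,4)]] by (simp add: inner_add_right scaleR_add_left)
  qed
  \<comment> \<open>Both sides of \<open>mt\<close> are affine in t, so subtracting the instances at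
    r / 2 and r / 3 isolates the coefficients of t.\<close>
  have me: "(b \<bullet> e) *\<^sub>R m a = (a \<bullet> e) *\<^sub>R m b" if ab: "a \<in> Q" "b \<in> Q" for a b
  proof -
    have "(r / 2) *\<^sub>R ((b \<bullet> e) *\<^sub>R m a) - (r / 3) *\<^sub>R ((b \<bullet> e) *\<^sub>R m a) =
        (r / 2) *\<^sub>R ((a \<bullet> e) *\<^sub>R m b) - (r / 3) *\<^sub>R ((a \<bullet> e) *\<^sub>R m b)"
    proof -
      have "((b \<bullet> dd) *\<^sub>R m a + (r / 2) *\<^sub>R ((b \<bullet> e) *\<^sub>R m a)) - ((b \<bullet> dd) *\<^sub>R m a + (r / 3) *\<^sub>R ((b \<bullet> e) *\<^sub>R m a)) =
          ((a \<bullet> dd) *\<^sub>R m b + (r / 2) *\<^sub>R ((a \<bullet> e) *\<^sub>R m b)) - ((a \<bullet> dd) *\<^sub>R m b + (r / 3) *\<^sub>R ((a \<bullet> e) *\<^sub>R m b))"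
        using mt[OF ab, of "r / 2"] mt[OF ab, of "r / 3"] r(1) by simp
      then show ?thesis by (simp only: add_diff_cancel_left)
    qed
    then have "(r / 2 - r / 3) *\<^sub>R ((b \<bullet> e) *\<^sub>R m a) = (r / 2 - r / 3) *\<^sub>R ((a \<bullet> e) *\<^sub>R m b)"
      by (simp only: scaleR_diff_left)
    then have "(b \<bullet> e) *\<^sub>R m a = (a \<bullet> e) *\<^sub>R m b \<or> r / 2 - r / 3 = 0"
      by (simp only: scaleR_cancel_left)
    then show ?thesis using r(1) by auto
  qed
  \<comment> \<open>Pairing e' with b0 leaves only the term with m b0, since b0 is orthogonal to e.
    Then \<open>mx\<close>, paired with b0, clears the rest of Q.\<close>
  have "m b0 = 0" using me[OF e'(1) b0(1)] b0(2) e'(2) by simp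
  then have mQ: "m a = 0" if "a \<in> Q" for a
    using mx[OF that b0(1)] b0(3) by simp
  have "?l x a = (a \<bullet> x) *\<^sub>R \<mu>" if "a \<in> P \<union> Q" for a
    using that radP mQ[of a] by (auto simp: m_def)
  then show ?thesis by blast
qed

text \<open>Close to x, on the side where \<open>e \<bullet> y > 0\<close>, both invariances hold,
  and \<open>gradient_radial_union\<close> passes to x by continuity of the derivative. The
  conclusion refers to e' alone so that the identities from the two sides of the hyperplane can
  later be added.\<close>

lemma gradient_radial_at_interface:
  fixes f :: "'a::euclidean_space \<Rightarrow> 'b::real_normed_vector"
  assumes \<Omega>: "open \<Omega>" and d: "\<And>y. y \<in> \<Omega> \<Longrightarrow> f differentiable (at y)"
    and C1: "\<And>h. continuous_on \<Omega> (\<lambda>y. frechet_derivative f (at y) h)"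
    and P: "subspace P" "dim P \<ge> 2" "e \<in> P" "sphere_invariant (\<Omega> \<inter> {y. e \<bullet> y > 0}) P f"
    and Q: "subspace Q" "dim Q \<ge> 2" "e' \<in> Q" "sphere_invariant (\<Omega> \<inter> {y. e' \<bullet> y > 0}) Q f"
    and ee': "e' \<bullet> e \<noteq> 0"
    and x: "x \<in> \<Omega>" "e \<bullet> x = 0" "e' \<bullet> x > 0" and a: "a \<in> P"
  shows "(e' \<bullet> x) *\<^sub>R frechet_derivative f (at x) a = (a \<bullet> x) *\<^sub>R frechet_derivative f (at x) e'"
proof -
  let ?l = "\<lambda>y. frechet_derivative f (at y)"
  define U where "U = \<Omega> \<inter> {y. e \<bullet> y > 0} \<inter> {y. e' \<bullet> y > 0}"
  have U: "open U" unfolding U_def by (intro open_Int \<Omega> open_halfspace_gt)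
  have inv: "sphere_invariant U P f" "sphere_invariant U Q f"
    by (rule sphere_invariant_mono[OF P(4)] sphere_invariant_mono[OF Q(4)]; auto simp: U_def)+
  obtain b0 where b0: "b0 \<in> Q" "b0 \<noteq> 0" "b0 \<bullet> e = 0"
    using subspace_ex_orthogonal[OF Q(1,2)] by blast
  have e0: "e \<bullet> e > 0" using ee' by auto
  have b00: "b0 \<bullet> b0 > 0" using b0(2) by simp
  \<comment> \<open>The summand e moves the point into the half-space. The summand b0, orthogonal to
    e, makes \<open>b0 \<bullet> g t\<close> nonzero for small t > 0, as
    \<open>gradient_radial_union\<close> demands.\<close>
  define g where "g t = x + t *\<^sub>R (e + b0)" for t :: real
  have gt: "(g \<longlongrightarrow> x) (at_right 0)"
  proof -
    have "(g \<longlongrightarrow> x + 0 *\<^sub>R (e + b0)) (at_right 0)" unfolding g_def by (intro tendsto_intros)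
    then show ?thesis by simp
  qed
  have "\<forall>\<^sub>F t in at_right 0. g t \<in> \<Omega> \<inter> {y. e' \<bullet> y > 0}"
    using gt x by (intro topological_tendstoD open_Int \<Omega> open_halfspace_gt) auto
  moreover have "\<forall>\<^sub>F t in at_right 0. b0 \<bullet> g t \<noteq> 0"
  proof (cases "b0 \<bullet> x = 0")
    case True
    have "\<forall>\<^sub>F t in at_right (0::real). t > 0" by (rule eventually_at_right_less)
    then show ?thesis
      by eventually_elim (use True b0 b00 in \<open>auto simp: g_def inner_add_right\<close>)
  next
    case False
    have "((\<lambda>t. b0 \<bullet> g t) \<longlongrightarrow> b0 \<bullet> x) (at_right 0)" by (intro tendsto_intros gt)
    then show ?thesis using False tendsto_imp_eventually_ne by blast
  qed
  moreover have "\<forall>\<^sub>F t in at_right (0::real). t > 0" by (rule eventually_at_right_less)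
  ultimately have ev: "\<forall>\<^sub>F t in at_right 0. (e' \<bullet> g t) *\<^sub>R ?l (g t) a = (a \<bullet> g t) *\<^sub>R ?l (g t) e'"
  proof eventually_elim
    case (elim t)
    have eg: "e \<bullet> g t > 0"
      using x(2) e0 elim(3) b0(3) by (simp add: g_def inner_add_right inner_commute)
    then have gU: "g t \<in> U" using elim by (auto simp: U_def)
    obtain dd where dd: "dd \<in> P" "dd \<noteq> 0" "dd \<bullet> g t = 0"
      using subspace_ex_orthogonal[OF P(1,2)] by blast
    obtain \<mu> where "\<forall>a\<in>P \<union> Q. ?l (g t) a = (a \<bullet> g t) *\<^sub>R \<mu>"
      using gradient_radial_union[OF U gU _ P(1) inv(1) Q(1) inv(2) P(3) _ dd Q(3) ee' b0(1,3) elim(2)] eg d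
      by (auto simp: U_def)
    then show ?case using a Q(3) by (simp add: mult.commute)
  qed
  have lt: "((\<lambda>t. ?l (g t) h) \<longlongrightarrow> ?l x h) (at_right 0)" for h
  proof -
    have "isCont (\<lambda>y. ?l y h) x"
      using C1 \<Omega> x(1) by (simp add: continuous_on_eq_continuous_at)
    then show ?thesis using gt isCont_tendsto_compose by blast
  qed
  have "((\<lambda>t. (e' \<bullet> g t) *\<^sub>R ?l (g t) a) \<longlongrightarrow> (e' \<bullet> x) *\<^sub>R ?l x a) (at_right 0)"
    by (intro tendsto_intros gt lt)
  moreover have "((\<lambda>t. (a \<bullet> g t) *\<^sub>R ?l (g t) e') \<longlongrightarrow> (a \<bullet> x) *\<^sub>R ?l x e') (at_right 0)"
    by (intro tendsto_intros gt lt)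
  ultimately show ?thesis
    using tendsto_unique[OF trivial_limit_at_right_real] tendsto_cong[OF ev] by blast
qed

definition subspace_sum :: "'a::real_vector set \<Rightarrow> 'a set \<Rightarrow> 'a set" where
  "subspace_sum P Q = {a + b |a b. a \<in> P \<and> b \<in> Q}"

lemma subspace_subspace_sum: "subspace P \<Longrightarrow> subspace Q \<Longrightarrow> subspace (subspace_sum P Q)"
  unfolding subspace_sum_def by (rule subspace_sums)

lemma subspace_sum_superset:
  assumes "subspace P" "subspace Q"
  shows "P \<subseteq> subspace_sum P Q" "Q \<subseteq> subspace_sum P Q"
  using subspace_0[OF assms(1)] subspace_0[OF assms(2)]
  by (force simp: subspace_sum_def)+

text \<open>Where \<open>e' \<bullet> x \<noteq> 0\<close>, the identities obtained from the two
  sides express the differential on P1 and on P2 through the same value, so they add up on the sum.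
  Points with \<open>e' \<bullet> x = 0\<close> are limits of such points within the
  hyperplane.\<close>

lemma gradient_radial_on_hyperplane:
  fixes f :: "'a::euclidean_space \<Rightarrow> 'b::real_normed_vector"
  assumes \<Omega>: "open \<Omega>" and d: "\<And>y. y \<in> \<Omega> \<Longrightarrow> f differentiable (at y)"
    and C1: "\<And>h. continuous_on \<Omega> (\<lambda>y. frechet_derivative f (at y) h)"
    and P1: "subspace P1" "dim P1 \<ge> 2" "e \<in> P1" "sphere_invariant (\<Omega> \<inter> {y. e \<bullet> y > 0}) P1 f"
    and P2: "subspace P2" "dim P2 \<ge> 2" "e \<in> P2" "sphere_invariant (\<Omega> \<inter> {y. e \<bullet> y < 0}) P2 f"
    and Q1: "subspace Q1" "dim Q1 \<ge> 2" "e' \<in> Q1" "sphere_invariant (\<Omega> \<inter> {y. e' \<bullet> y > 0}) Q1 f"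
    and Q2: "subspace Q2" "dim Q2 \<ge> 2" "e' \<in> Q2" "sphere_invariant (\<Omega> \<inter> {y. e' \<bullet> y < 0}) Q2 f"
    and ee': "e' \<bullet> e \<noteq> 0" and indep: "e' \<notin> span {e}"
    and x: "x \<in> \<Omega>" "e \<bullet> x = 0"
  shows "gradient_radial (frechet_derivative f (at x)) x (subspace_sum P1 P2)"
proof -
  let ?l = "\<lambda>y. frechet_derivative f (at y)"
  have lin: "linear (?l y)" if "y \<in> \<Omega>" for y using d[OF that] by (rule linear_frechet_derivative)
  have P: "(s *\<^sub>R e' \<bullet> y) *\<^sub>R ?l y a = (a \<bullet> y) *\<^sub>R ?l y (s *\<^sub>R e')"
    if y: "y \<in> \<Omega>" "e \<bullet> y = 0" and s: "s = 1 \<or> s = -1" "s *\<^sub>R e' \<bullet> y > 0" and a: "a \<in> P1 \<or> a \<in> P2" for y s a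
  proof -
    \<comment> \<open>The sign s records on which side of the second hyperplane y lies, and hence
      which subspace acts there.\<close>
    define R where "R = (if s = 1 then Q1 else Q2)"
    have R: "subspace R" "dim R \<ge> 2" "s *\<^sub>R e' \<in> R" "sphere_invariant (\<Omega> \<inter> {y. s *\<^sub>R e' \<bullet> y > 0}) R f"
      using Q1 Q2 s(1) by (auto simp: R_def subspace_neg)
    have s0: "s \<noteq> 0" using s(1) by auto
    from a show ?thesis
    proof
      assume "a \<in> P1"
      then show ?thesis
        using gradient_radial_at_interface[OF \<Omega> d C1 P1 R _ y s(2)] ee' s0 by simp
    next
      assume "a \<in> P2"
      moreover have "- e \<in> P2" "sphere_invariant (\<Omega> \<inter> {y. - e \<bullet> y > 0}) P2 f"
        using P2 by (auto simp: subspace_neg)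
      ultimately show ?thesis
        using gradient_radial_at_interface[OF \<Omega> d C1 P2(1,2) _ _ R _ y(1) _ s(2), of "- e"] ee' s0 y(2) by simp
    qed
  qed
  have rad: "gradient_radial (?l y) y (subspace_sum P1 P2)" if y: "y \<in> \<Omega>" "e \<bullet> y = 0" "e' \<bullet> y \<noteq> 0" for y
  proof -
    define s :: real where "s = (if e' \<bullet> y > 0 then 1 else -1)"
    have s: "s = 1 \<or> s = -1" "s *\<^sub>R e' \<bullet> y > 0" using y(3) by (auto simp: s_def)
    have sum: "(s *\<^sub>R e' \<bullet> y) *\<^sub>R ?l y a = (a \<bullet> y) *\<^sub>R ?l y (s *\<^sub>R e')" if a: "a \<in> subspace_sum P1 P2" for a
    proof -
      obtain p q where pq: "a = p + q" "p \<in> P1" "q \<in> P2" using a by (auto simp: subspace_sum_def)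
      show ?thesis
        using P[OF y(1,2) s disjI1[OF pq(2)]] P[OF y(1,2) s disjI2[OF pq(3)]] pq(1)
        by (simp only: linear_add[OF lin[OF y(1)]] inner_add_left scaleR_add_left scaleR_add_right)
    qed
    show ?thesis
      unfolding gradient_radial_def
    proof (intro ballI)
      fix a b assume ab: "a \<in> subspace_sum P1 P2" "b \<in> subspace_sum P1 P2"
      have "(s *\<^sub>R e' \<bullet> y) *\<^sub>R ((b \<bullet> y) *\<^sub>R ?l y a) = (b \<bullet> y) *\<^sub>R ((a \<bullet> y) *\<^sub>R ?l y (s *\<^sub>R e'))"
        using sum[OF ab(1)] by (metis scaleR_left_commute)
      also have "\<dots> = (s *\<^sub>R e' \<bullet> y) *\<^sub>R ((a \<bullet> y) *\<^sub>R ?l y b)"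
        using sum[OF ab(2)] by (metis scaleR_left_commute)
      finally have "(b \<bullet> y) *\<^sub>R ?l y a = (a \<bullet> y) *\<^sub>R ?l y b \<or> s *\<^sub>R e' \<bullet> y = 0"
        by (simp only: scaleR_cancel_left)
      then show "(b \<bullet> y) *\<^sub>R ?l y a = (a \<bullet> y) *\<^sub>R ?l y b"
        using s(2) by (metis less_irrefl)
    qed
  qed
  show ?thesis
  proof (cases "e' \<bullet> x = 0")
    case False
    then show ?thesis using rad x by blast
  next
    case True
    \<comment> \<open>The part of e' orthogonal to e: moving along it stays in the hyperplane of e
      but leaves that of e'.\<close>
    define q where "q = e' - ((e' \<bullet> e) / (e \<bullet> e)) *\<^sub>R e"
    have e0: "e \<noteq> 0" using ee' by auto
    have eq: "e \<bullet> q = 0" using e0 by (simp add: q_def inner_diff_right inner_commute)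
    have "q \<noteq> 0"
    proof
      assume "q = 0"
      then have "e' = ((e' \<bullet> e) / (e \<bullet> e)) *\<^sub>R e" by (simp add: q_def)
      then show False using indep by (metis span_base span_mul singletonI)
    qed
    moreover have "e' \<bullet> q = q \<bullet> q" using eq by (simp add: q_def inner_diff_left)
    ultimately have e'q: "e' \<bullet> q > 0" by simp
    define g where "g t = x + t *\<^sub>R q" for t :: real
    have gt: "(g \<longlongrightarrow> x) (at_right 0)"
    proof -
      have "(g \<longlongrightarrow> x + 0 *\<^sub>R q) (at_right 0)" unfolding g_def by (intro tendsto_intros)
      then show ?thesis by simp
    qed
    have "\<forall>\<^sub>F t in at_right 0. g t \<in> \<Omega>"
      using gt x \<Omega> by (intro topological_tendstoD) auto
    moreover have "\<forall>\<^sub>F t in at_right (0::real). t > 0" by (rule eventually_at_right_less)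
    ultimately have ev: "\<forall>\<^sub>F t in at_right 0. gradient_radial (?l (g t)) (g t) (subspace_sum P1 P2)"
    proof eventually_elim
      case (elim t)
      have "e \<bullet> g t = 0" using x(2) eq by (simp add: g_def inner_add_right)
      moreover have "e' \<bullet> g t \<noteq> 0" using True e'q elim(2) by (simp add: g_def inner_add_right)
      ultimately show ?case using rad elim(1) by blast
    qed
    have lt: "((\<lambda>t. ?l (g t) h) \<longlongrightarrow> ?l x h) (at_right 0)" for h
    proof -
      have "isCont (\<lambda>y. ?l y h) x"
        using C1 \<Omega> x(1) by (simp add: continuous_on_eq_continuous_at)
      then show ?thesis using gt isCont_tendsto_compose by blast
    qed
    show ?thesis
      unfolding gradient_radial_def
    proof (intro ballI)
      fix a b assume ab: "a \<in> subspace_sum P1 P2" "b \<in> subspace_sum P1 P2"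
      have ev': "\<forall>\<^sub>F t in at_right 0. (b \<bullet> g t) *\<^sub>R ?l (g t) a = (a \<bullet> g t) *\<^sub>R ?l (g t) b"
        using ev by eventually_elim (use ab in \<open>simp add: gradient_radial_def\<close>)
      have "((\<lambda>t. (b \<bullet> g t) *\<^sub>R ?l (g t) a) \<longlongrightarrow> (b \<bullet> x) *\<^sub>R ?l x a) (at_right 0)"
        by (intro tendsto_intros gt lt)
      moreover have "((\<lambda>t. (a \<bullet> g t) *\<^sub>R ?l (g t) b) \<longlongrightarrow> (a \<bullet> x) *\<^sub>R ?l x b) (at_right 0)"
        by (intro tendsto_intros gt lt)
      ultimately show "(b \<bullet> x) *\<^sub>R ?l x a = (a \<bullet> x) *\<^sub>R ?l x b"
        using tendsto_unique[OF trivial_limit_at_right_real] tendsto_cong[OF ev'] by blast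
    qed
  qed
qed

section \<open>Gluing invariances across a hyperplane\<close>

lemma sphere_project_to_hyperplane:
  fixes P :: "'a::euclidean_space set"
  assumes P: "subspace P" "dim P \<ge> 2" "e \<in> P"
  obtains x' where "norm x' = norm x" "x - x' \<in> P" "e \<bullet> x' = 0"
proof -
  obtain z v where zv: "z \<in> P" "\<And>w. w \<in> P \<Longrightarrow> v \<bullet> w = 0" "x = z + v"
    using orthogonal_subspace_decomp_exists[of P x] P(1)
    by (auto simp: orthogonal_def span_eq_iff[THEN iffD2])
  obtain d where d: "d \<in> P" "norm d = 1" "d \<bullet> e = 0"
    using subspace_ex_orthogonal_unit[OF P(1,2)] by metis
  \<comment> \<open>The component of x in P is turned, without changing its length, into a direction
    of P orthogonal to e.\<close>
  define z' where "z' = norm z *\<^sub>R d"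
  have z': "z' \<in> P" "norm z' = norm z" "e \<bullet> z' = 0"
    using d P(1) by (auto simp: z'_def subspace_scale inner_commute)
  have "norm (v + z') = norm (v + z)"
    using norm_sum_orthogonal_eq[of v z' z] zv(1,2) z' by simp
  moreover have "x - (v + z') \<in> P" using zv z' P(1) by (simp add: subspace_diff)
  moreover have "e \<bullet> (v + z') = 0" using zv(2)[OF P(3)] z'(3) by (simp add: inner_add_right inner_commute)
  ultimately show thesis using zv(3) by (intro that[of "v + z'"]) (auto simp: add.commute)
qed

text \<open>Both points are moved into the hyperplane, each by the subspace that acts on its side.
  Their difference then lies in D and in the hyperplane, which is why the interface needs invariance
  along the intersection only.\<close>

lemma sphere_invariant_glue:
  fixes f :: "'a::euclidean_space \<Rightarrow> 'b"
  assumes \<Omega>: "\<And>x y. x \<in> \<Omega> \<Longrightarrow> norm x = norm y \<Longrightarrow> y \<in> \<Omega>"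
    and P1: "subspace P1" "dim P1 \<ge> 2" "e \<in> P1" "sphere_invariant (\<Omega> \<inter> {y. e \<bullet> y \<ge> 0}) P1 f"
    and P2: "subspace P2" "dim P2 \<ge> 2" "e \<in> P2" "sphere_invariant (\<Omega> \<inter> {y. e \<bullet> y \<le> 0}) P2 f"
    and D: "subspace D" "P1 \<subseteq> D" "P2 \<subseteq> D"
    and inv: "sphere_invariant (\<Omega> \<inter> {y. e \<bullet> y = 0}) (D \<inter> {y. e \<bullet> y = 0}) f"
  shows "sphere_invariant \<Omega> D f"
  unfolding sphere_invariant_def
proof (intro ballI impI, elim conjE)
  have proj: "\<exists>x'\<in>\<Omega>. norm x' = norm x \<and> x - x' \<in> D \<and> e \<bullet> x' = 0 \<and> f x' = f x" if x: "x \<in> \<Omega>" for x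
  proof (cases "e \<bullet> x \<ge> 0")
    case True
    obtain x' where x': "norm x' = norm x" "x - x' \<in> P1" "e \<bullet> x' = 0"
      using sphere_project_to_hyperplane[OF P1(1-3)] by metis
    then have "x' \<in> \<Omega>" using \<Omega>[OF x] by simp
    moreover have "f x = f x'"
      using x x' True calculation by (intro sphere_invariantD[OF P1(4)]) auto
    ultimately show ?thesis using x' D(2) by (intro bexI[of _ x']) auto
  next
    case False
    obtain x' where x': "norm x' = norm x" "x - x' \<in> P2" "e \<bullet> x' = 0"
      using sphere_project_to_hyperplane[OF P2(1-3)] by metis
    then have "x' \<in> \<Omega>" using \<Omega>[OF x] by simp
    moreover have "f x = f x'"
      using x x' False calculation by (intro sphere_invariantD[OF P2(4)]) auto
    ultimately show ?thesis using x' D(3) by (intro bexI[of _ x']) auto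
  qed
  fix x y assume xy: "x \<in> \<Omega>" "y \<in> \<Omega>" "norm x = norm y" "x - y \<in> D"
  obtain x' y' where x': "x' \<in> \<Omega>" "norm x' = norm x" "x - x' \<in> D" "e \<bullet> x' = 0" "f x' = f x"
    and y': "y' \<in> \<Omega>" "norm y' = norm y" "y - y' \<in> D" "e \<bullet> y' = 0" "f y' = f y"
    using proj[OF xy(1)] proj[OF xy(2)] by blast
  have "x' - y' = (x - y) - (x - x') + (y - y')" by simp
  then have "x' - y' \<in> D"
    using xy(4) x'(3) y'(3) D(1) by (metis subspace_add subspace_diff)
  then have "f x' = f y'"
    using x' y' xy(3) by (intro sphere_invariantD[OF inv]) (auto simp: inner_diff_right)
  then show "f x = f y" using x'(5) y'(5) by simp
qed

section \<open>Symmetry of minimizers\<close>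

lemma Ck_on_1D:
  assumes "Ck_on 1 \<Omega> f"
  shows "\<And>x. x \<in> \<Omega> \<Longrightarrow> f differentiable (at x)"
    and "\<And>h. continuous_on \<Omega> (\<lambda>y. frechet_derivative f (at y) h)"
    and "continuous_on \<Omega> f"
proof -
  show d: "f differentiable (at x)" if "x \<in> \<Omega>" for x using assms that by simp
  show "continuous_on \<Omega> (\<lambda>y. frechet_derivative f (at y) h)" for h using assms by simp
  show "continuous_on \<Omega> f"
    using d differentiable_imp_continuous_within continuous_at_imp_continuous_on by blast
qed

lemma Ck_on_1_cong:
  assumes \<Omega>: "open \<Omega>" and g: "Ck_on 1 \<Omega> g" and eq: "\<And>x. x \<in> \<Omega> \<Longrightarrow> f x = g x"
  shows "Ck_on 1 \<Omega> f"
proof -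
  have d: "(f has_derivative frechet_derivative g (at x)) (at x)" if x: "x \<in> \<Omega>" for x
  proof (rule has_derivative_transform_within_open[OF _ \<Omega> x])
    show "(g has_derivative frechet_derivative g (at x)) (at x)"
      using Ck_on_1D(1)[OF g x] frechet_derivative_works by blast
  qed (simp add: eq)
  then have fd: "frechet_derivative f (at x) = frechet_derivative g (at x)" if "x \<in> \<Omega>" for x
    using that frechet_derivative_at by metis
  have "continuous_on \<Omega> (\<lambda>x. frechet_derivative f (at x) h)" for h
    using Ck_on_1D(2)[OF g, of h] by (subst continuous_on_cong[OF refl]) (auto simp: fd)
  then show ?thesis using d by (auto simp: differentiable_def)
qed

lemma continuous_ae_eq_imp_eq:
  fixes f g :: "'a::euclidean_space \<Rightarrow> 'b::real_normed_vector"
  assumes \<Omega>: "open \<Omega>" and f: "continuous_on \<Omega> f" and g: "continuous_on \<Omega> g"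
    and eq: "ae_eq_on \<Omega> f g" and x: "x \<in> \<Omega>"
  shows "f x = g x"
proof (rule ccontr)
  assume ne: "f x \<noteq> g x"
  define S where "S = \<Omega> \<inter> (\<lambda>y. f y - g y) -` (- {0})"
  have "open S"
    unfolding S_def using \<Omega> by (intro continuous_open_preimage continuous_intros f g) auto
  moreover have "S \<noteq> {}" using x ne by (auto simp: S_def)
  moreover have "negligible S"
  proof -
    have "AE y in lebesgue. y \<notin> S"
      using eq unfolding ae_eq_on_def by eventually_elim (auto simp: S_def)
    moreover have "S \<in> sets lebesgue" using \<open>open S\<close> by auto
    ultimately show ?thesis
      by (simp add: negligible_iff_null_sets AE_iff_null_sets)
  qed
  ultimately show False using open_not_negligible by blast
qed

text \<open>Two distinct points of equal norm on a line parallel to b are mirror images of each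
  other.\<close>

lemma sphere_invariant_spanI:
  assumes "\<And>x. x \<in> S \<Longrightarrow> f (hyperplane_reflection b x) = f x"
  shows "sphere_invariant S (span {b}) f"
  unfolding sphere_invariant_def
proof (intro ballI impI, elim conjE)
  fix x y assume xy: "x \<in> S" "y \<in> S" "norm x = norm y" "x - y \<in> span {b}"
  show "f x = f y"
  proof (cases "x = y")
    case False
    obtain t where t: "x - y = t *\<^sub>R b" using xy(4) by (auto simp: span_singleton)
    then have "t \<noteq> 0" using False by auto
    then have "hyperplane_reflection (t *\<^sub>R b) = hyperplane_reflection b"
      by (auto simp: hyperplane_reflection_def fun_eq_iff)
    then have "hyperplane_reflection b x = y"
      using hyperplane_reflection_swap[OF xy(3)] t by simp
    then show ?thesis using assms[OF xy(1)] by simp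
  qed simp
qed

lemma subspace_orthogonal_set: "subspace {y. \<forall>b\<in>B. orthogonal b y}"
  by (auto simp: subspace_def orthogonal_def inner_add_right)

lemma dim_inter_hyperplane:
  fixes A :: "'a::euclidean_space set"
  assumes "subspace A" "c \<in> A"
  shows "dim (A \<inter> {y. c \<bullet> y = 0}) + 1 \<ge> dim A"
proof -
  have "dim {y \<in> A. \<forall>x\<in>span {c}. orthogonal x y} + dim (span {c}) = dim A"
    using assms by (intro dim_subspace_orthogonal_to_vectors) (auto simp: span_minimal)
  moreover have "{y \<in> A. \<forall>x\<in>span {c}. orthogonal x y} = A \<inter> {y. c \<bullet> y = 0}"
    by (auto simp: orthogonal_def span_singleton)
  moreover have "dim (span {c}) \<le> 1"
    using dim_le_card'[of "{c}"] by simp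
  ultimately show ?thesis by simp
qed

context reflection_space
begin

lemma continuous_on_reflect_plus:
  assumes "continuous_on \<Omega> f" "e \<noteq> 0"
  shows "continuous_on \<Omega> (reflect_plus e f)"
proof -
  \<comment> \<open>This folds the space onto the half-space \<open>e \<bullet> x \<ge> 0\<close>:
    the coefficient is 0 there and that of the reflection elsewhere. The absolute value makes
    continuity evident.\<close>
  define r where "r x = x - ((e \<bullet> x - \<bar>e \<bullet> x\<bar>) / (e \<bullet> e)) *\<^sub>R e" for x
  have r: "r x = (if e \<bullet> x \<ge> 0 then x else hyperplane_reflection e x)" for x
    by (simp add: r_def hyperplane_reflection_def)
  have "continuous_on \<Omega> r"
    unfolding r_def using assms(2) by (intro continuous_intros) auto
  moreover have "r ` \<Omega> \<subseteq> \<Omega>" using reflection_in_\<Omega> by (auto simp: r)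
  ultimately have "continuous_on \<Omega> (\<lambda>x. f (r x))"
    using assms(1) continuous_on_compose2 by blast
  moreover have "(\<lambda>x. f (r x)) = reflect_plus e f"
    by (auto simp: r reflect_plus_def)
  ultimately show ?thesis by (rule back_subst)
qed

end

context constrained_problem
begin

definition C1_minimizer :: "(real^'N \<Rightarrow> real^'n) \<Rightarrow> bool" where
  "C1_minimizer f \<longleftrightarrow> is_minimizer f \<and> Ck_on 1 \<Omega> f"

text \<open>Regularity only yields some representative. As f is continuous, so is its
  symmetrization, which therefore equals that representative on all of \<Omega>.\<close>

lemma C1_minimizer_reflect_plus:
  assumes f: "C1_minimizer f" and e: "e \<in> splitting f"
  shows "C1_minimizer (reflect_plus e f)"
proof -
  have m: "is_minimizer (reflect_plus e f)"
    using minimizer_reflect_plus f e by (simp add: C1_minimizer_def)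
  then obtain w where w: "ae_eq_on \<Omega> (reflect_plus e f) w" "Ck_on 1 \<Omega> w"
    using regular unfolding C1_representative_def by blast
  have f1: "Ck_on 1 \<Omega> f" using f by (simp add: C1_minimizer_def)
  have e0: "e \<noteq> 0" using e by (simp add: splitting_def)
  have "reflect_plus e f x = w x" if "x \<in> \<Omega>" for x
    by (rule continuous_ae_eq_imp_eq[OF open_\<Omega> continuous_on_reflect_plus[OF Ck_on_1D(3)[OF f1] e0] Ck_on_1D(3)[OF w(2)] w(1) that])
  then show ?thesis
    using m Ck_on_1_cong[OF open_\<Omega> w(2)] by (simp add: C1_minimizer_def)
qed

section \<open>Existence of splitting directions\<close>

lemma splitting_exists:
  assumes v: "v \<in> X" and A: "subspace A" "k < dim A"
  obtains e where "e \<in> A" "norm e = 1" "e \<in> splitting v"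
proof -
  \<comment> \<open>Constraints are numbered from 1, the functions in Borsuk-Ulam from 0.\<close>
  have "\<exists>x\<in>A. norm x = 1 \<and> (\<forall>j<k. imbalance \<Omega> (G (Suc j)) v x = 0)"
  proof (rule Borsuk_Ulam[OF A])
    fix j assume "j < k"
    then have "set_integrable lebesgue \<Omega> (integrand \<Omega> (G (Suc j)) v)" using G_int[OF v] by simp
    then show "continuous_on (A \<inter> sphere 0 1) (imbalance \<Omega> (G (Suc j)) v)"
      by (rule continuous_on_subset[OF imbalance_continuous]) auto
  qed (rule imbalance_uminus)
  then obtain e where e: "e \<in> A" "norm e = 1" "\<forall>j<k. imbalance \<Omega> (G (Suc j)) v e = 0" by blast
  have "imbalance \<Omega> (G j) v e = 0" if "j \<in> {1..k}" for j
    using e(3)[rule_format, of "j - 1"] that by auto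
  then show thesis using e by (intro that[of e]) (auto simp: splitting_def)
qed

text \<open>If any two non-parallel splitting directions in \<open>A\<close> were orthogonal, there would be finitely
  many of them up to scaling, and the hyperplane orthogonal to their sum would contain none.\<close>

lemma splitting_pair_exists:
  assumes v: "v \<in> X" and A: "subspace A" "k + 2 \<le> dim A"
  obtains e e' where "e \<in> A" "e \<in> splitting v" "e' \<in> A" "e' \<in> splitting v" "e' \<bullet> e \<noteq> 0" "e' \<notin> span {e}"
proof -
  define Z where "Z = {e \<in> A. norm e = 1 \<and> e \<in> splitting v}"
  \<comment> \<open>The argument is run on an orthogonal family of greatest size. A splitting
    direction orthogonal to the sum of its members is parallel to none of them and, by maximality,
    not orthogonal to all of them.\<close>
  define orth where "orth E \<longleftrightarrow> finite E \<and> E \<subseteq> Z \<and> pairwise orthogonal E" for E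
  have "card E \<le> DIM(real^'N)" if "orth E" for E
  proof -
    have "0 \<notin> E" using that by (auto simp: orth_def Z_def)
    then have "independent E" using that pairwise_orthogonal_independent by (auto simp: orth_def)
    then show ?thesis using independent_bound by blast
  qed
  moreover have "orth {}" by (simp add: orth_def)
  ultimately obtain E where E: "orth E" "\<And>E'. orth E' \<Longrightarrow> card E' \<le> card E"
    using ex_has_greatest_nat[of orth "{}" card "Suc DIM(real^'N)"] by (metis le_imp_less_Suc)
  have EZ: "finite E" "E \<subseteq> Z" "pairwise orthogonal E" using E(1) by (auto simp: orth_def)
  define c where "c = \<Sum>E"
  have cA: "c \<in> A" unfolding c_def using EZ(2) A(1) by (intro subspace_sum) (auto simp: Z_def)
  have ec: "e \<bullet> c = 1" if e: "e \<in> E" for e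
  proof -
    have "e \<bullet> c = (\<Sum>x\<in>E. if x = e then 1 else 0)"
      unfolding c_def inner_sum_right
    proof (intro sum.cong refl)
      fix x assume x: "x \<in> E"
      have "norm e = 1" using e EZ(2) by (auto simp: Z_def)
      then have "e \<bullet> e = 1" by (simp only: norm_eq_1)
      then show "e \<bullet> x = (if x = e then 1 else 0)"
        using e x EZ(3) by (auto simp: pairwise_def orthogonal_def)
    qed
    then show ?thesis using e EZ(1) by simp
  qed
  have "k < dim (A \<inter> {y. c \<bullet> y = 0})"
    using dim_inter_hyperplane[OF A(1) cA] A(2) by simp
  then obtain z where z: "z \<in> A" "c \<bullet> z = 0" "norm z = 1" "z \<in> splitting v"
    using splitting_exists[OF v subspace_inter[OF A(1) subspace_hyperplane]] by blast
  have npar: "z \<notin> span {e}" if "e \<in> E" for e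
  proof
    assume "z \<in> span {e}"
    then obtain t where t: "z = t *\<^sub>R e" by (auto simp: span_singleton)
    then have "t = 0" using z(2) ec[OF that] by (simp add: inner_commute)
    then show False using t z(3) by simp
  qed
  have "\<exists>e\<in>E. z \<bullet> e \<noteq> 0"
  proof (rule ccontr)
    assume "\<not> ?thesis"
    then have "pairwise orthogonal (insert z E)"
      by (intro pairwise_orthogonal_insert EZ(3)) (auto simp: orthogonal_def)
    moreover have "z \<notin> E" using npar span_base by blast
    ultimately have "orth (insert z E)" "card (insert z E) = card E + 1"
      using EZ z by (auto simp: orth_def Z_def)
    then show False using E(2) by fastforce
  qed
  then obtain e where e: "e \<in> E" "z \<bullet> e \<noteq> 0" by blast
  then show thesis
    using EZ(2) z npar by (intro that[of e z]) (auto simp: Z_def)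
qed

text \<open>Reflecting c along the members of B one after the other leads to -c, because B is an
  orthogonal basis of its span. Each of these symmetries of f preserves the imbalance, which is odd
  and hence 0.\<close>

lemma splitting_span:
  assumes f: "f \<in> X" and B: "finite B" "pairwise orthogonal B" "0 \<notin> B"
    and inv: "\<And>b. b \<in> B \<Longrightarrow> sphere_invariant \<Omega> (span {b}) f"
    and c: "c \<in> span B" "c \<noteq> 0"
  shows "c \<in> splitting f"
proof -
  \<comment> \<open>\<open>c - T C c\<close> is c reflected along all members of C; orthogonality
    makes the order irrelevant.\<close>
  define T where "T C c = (\<Sum>b\<in>C. (2 / (b \<bullet> b) * (b \<bullet> c)) *\<^sub>R b)" for C and c :: "real^'N"
  have sym: "f (hyperplane_reflection b x) = f x" if "b \<in> B" "x \<in> \<Omega>" for b x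
    using sphere_invariant_reflection[OF inv[OF that(1)] subspace_span span_base that(2)] reflection_in_\<Omega>[OF that(2)] by simp
  have lin: "linear (T B)"
    unfolding T_def by (rule linearI) (auto simp: inner_right_distrib algebra_simps scaleR_sum_right sum.distrib add_divide_distrib)
  have "T B c = 2 *\<^sub>R c"
  proof (rule linear_eq_on_span[OF lin _ _ c(1)])
    show "linear ((*\<^sub>R) (2::real) :: real^'N \<Rightarrow> _)" by (rule linear_scaleR)
    fix b assume b: "b \<in> B"
    have "T B b = (\<Sum>x\<in>B. if x = b then 2 *\<^sub>R b else 0)"
      unfolding T_def using b B(2,3) by (intro sum.cong) (auto simp: pairwise_def orthogonal_def)
    then show "T B b = 2 *\<^sub>R b" using b B(1) by simp
  qed
  have "imbalance \<Omega> (G j) f c = 0" if j: "j \<in> {1..k}" for j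
  proof -
    have "C \<subseteq> B \<Longrightarrow> imbalance \<Omega> (G j) f (c - T C c) = imbalance \<Omega> (G j) f c" if "finite C" for C
      using that
    proof (induction C rule: finite_induct)
      case (insert b C)
      have "b \<bullet> T C c = 0"
        unfolding T_def inner_sum_right
      proof (intro sum.neutral ballI)
        fix x assume "x \<in> C"
        then have "b \<noteq> x" "b \<in> B" "x \<in> B" using insert.hyps insert.prems by auto
        then have "b \<bullet> x = 0" using B(2) by (simp add: pairwise_def orthogonal_def)
        then show "b \<bullet> (2 / (x \<bullet> x) * (x \<bullet> c)) *\<^sub>R x = 0" by simp
      qed
      then have "hyperplane_reflection b (c - T C c) = c - T (insert b C) c"
        using insert.hyps by (simp add: hyperplane_reflection_eq T_def inner_diff_right)
      then show ?case
        using imbalance_reflection[OF f sym G_int[OF f j], of b "c - T C c"] insert by auto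
    qed (simp add: T_def)
    from this[OF B(1) subset_refl] have "imbalance \<Omega> (G j) f (- c) = imbalance \<Omega> (G j) f c"
      using \<open>T B c = 2 *\<^sub>R c\<close> by (simp add: scaleR_2)
    then show ?thesis by (simp add: imbalance_uminus)
  qed
  then show ?thesis using c(2) by (simp add: splitting_def)
qed

section \<open>Rotational invariance of minimizers\<close>

lemma invariant_span:
  assumes f: "C1_minimizer f" and B: "finite B" "pairwise orthogonal B" "0 \<notin> B"
    and inv: "\<And>b. b \<in> B \<Longrightarrow> sphere_invariant \<Omega> (span {b}) f" and dim: "2 \<le> dim (span B)"
  shows "sphere_invariant \<Omega> (span B) f"
proof -
  have fX: "f \<in> X" and f1: "Ck_on 1 \<Omega> f" using f minimizer_in by (auto simp: C1_minimizer_def)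
  \<comment> \<open>Here c is normal to a hyperplane through x across which the symmetrization of f
    is again differentiable.\<close>
  have normal: "frechet_derivative f (at x) c = 0" if x: "x \<in> \<Omega>" "c \<in> span B" "c \<bullet> x = 0" for x c
  proof (cases "c = 0")
    case True
    then show ?thesis using linear_0[OF linear_frechet_derivative[OF Ck_on_1D(1)[OF f1 x(1)]]] by simp
  next
    case False
    then have "c \<in> splitting f" using splitting_span[OF fX B inv x(2)] by simp
    then have "Ck_on 1 \<Omega> (reflect_plus c f)"
      using C1_minimizer_reflect_plus[OF f] by (simp add: C1_minimizer_def)
    then show ?thesis
      using reflect_plus_normal_derivative[OF x(3) False Ck_on_1D(1)[OF f1 x(1)]] Ck_on_1D(1) x(1) by blast
  qed
  have "sphere_invariant (\<Omega> \<inter> UNIV) (span B) f"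
  proof (rule gradient_radial_imp_constant)
    fix x assume "x \<in> \<Omega> \<inter> UNIV"
    then have x: "x \<in> \<Omega>" by simp
    have lin: "linear (frechet_derivative f (at x))" using Ck_on_1D(1)[OF f1 x] by (rule linear_frechet_derivative)
    show "gradient_radial (frechet_derivative f (at x)) x (span B)"
      unfolding gradient_radial_def
    proof (intro ballI)
      fix a b assume ab: "a \<in> span B" "b \<in> span B"
      define c where "c = (b \<bullet> x) *\<^sub>R a - (a \<bullet> x) *\<^sub>R b"
      have "c \<in> span B" unfolding c_def using ab by (intro span_diff span_scale)
      moreover have "c \<bullet> x = 0" by (simp add: c_def inner_diff_left)
      ultimately have "frechet_derivative f (at x) c = 0" using normal[OF x] by blast
      then show "(b \<bullet> x) *\<^sub>R frechet_derivative f (at x) a = (a \<bullet> x) *\<^sub>R frechet_derivative f (at x) b"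
        by (simp add: c_def linear_diff[OF lin] linear_scale[OF lin])
    qed
  qed (use in_\<Omega>_norm_eq Ck_on_1D(1)[OF f1] dim in auto)
  then show ?thesis by simp
qed

text \<open>Reflections along orthogonal directions commute, and the one along b preserves the sides
  of the hyperplane of e. Symmetries already gained thus survive a new symmetrization.\<close>

lemma sphere_invariant_reflect_plus:
  assumes f: "sphere_invariant \<Omega> (span {b}) f" and be: "b \<bullet> e = 0"
  shows "sphere_invariant \<Omega> (span {b}) (reflect_plus e f)"
proof (rule sphere_invariant_spanI)
  fix x assume x: "x \<in> \<Omega>"
  let ?s = "hyperplane_reflection"
  have sym: "f (?s b y) = f y" if "y \<in> \<Omega>" for y
    using sphere_invariant_reflection[OF f subspace_span span_base that] reflection_in_\<Omega>[OF that] by simp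
  have "e \<bullet> ?s b x = e \<bullet> x"
    using be by (simp add: hyperplane_reflection_eq inner_diff_right inner_commute)
  moreover have "?s e (?s b x) = ?s b (?s e x)"
    using be by (simp add: hyperplane_reflection_eq inner_diff_right inner_commute)
  ultimately show "reflect_plus e f (?s b x) = reflect_plus e f x"
    using sym[OF x] sym[OF reflection_in_\<Omega>[OF x]] by (simp add: reflect_plus_def)
qed

text \<open>Here n counts the symmetries missing from N - k, and f varies because the induction
  hypothesis is used for symmetrizations. \<open>B \<subseteq> D\<close> is carried along so that
  both subspaces to be glued contain e. The dimension is only bounded below, since adding two
  subspaces may exceed N - k.\<close>

lemma C1_minimizer_invariant:
  assumes "C1_minimizer f" "finite B" "pairwise orthogonal B" "0 \<notin> B"
    and "\<And>b. b \<in> B \<Longrightarrow> sphere_invariant \<Omega> (span {b}) f" and "card B + n + k = CARD('N)"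
  shows "\<exists>D. subspace D \<and> B \<subseteq> D \<and> CARD('N) \<le> dim D + k \<and> sphere_invariant \<Omega> D f"
  using assms
proof (induction n arbitrary: f B)
  case 0
  have "independent B" using pairwise_orthogonal_independent[OF 0(3,4)] .
  then have dim: "dim (span B) = card B" by (simp add: dim_eq_card_independent)
  have "card B + k = CARD('N)" using 0(6) by simp
  then have dim': "2 \<le> dim (span B)" "CARD('N) \<le> dim (span B) + k" using codim dim by auto
  have "sphere_invariant \<Omega> (span B) f"
    by (rule invariant_span[OF 0(1-4) _ dim'(1)]) (rule 0(5))
  then show ?case
    using dim'(2) span_superset subspace_span by blast
next
  case (Suc n)
  have fX: "f \<in> X" and f1: "Ck_on 1 \<Omega> f" using Suc.prems(1) minimizer_in by (auto simp: C1_minimizer_def)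
  define A where "A = {y :: real^'N. \<forall>b\<in>B. orthogonal b y}"
  have A: "subspace A" unfolding A_def by (rule subspace_orthogonal_set)
  have dimA: "dim A = k + Suc n"
  proof -
    have "dim {y \<in> UNIV. \<forall>x\<in>span B. orthogonal x y} + dim (span B) = dim (UNIV :: (real^'N) set)"
      by (rule dim_subspace_orthogonal_to_vectors) auto
    moreover have "{y \<in> UNIV. \<forall>x\<in>span B. orthogonal x y} = A"
      unfolding A_def by (auto simp: span_base orthogonal_commute intro: orthogonal_to_span)
    moreover have "dim (span B) = card B"
      using pairwise_orthogonal_independent[OF Suc.prems(3,4)] by (simp add: dim_eq_card_independent)
    ultimately show ?thesis using Suc.prems(6) by simp
  qed
  \<comment> \<open>The induction hypothesis concerns the symmetrization, which has the symmetries
    along B and e and coincides with f on the closed half-space.\<close>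
  have half: "\<exists>D. subspace D \<and> insert e B \<subseteq> D \<and> CARD('N) \<le> dim D + k \<and>
      sphere_invariant (\<Omega> \<inter> {y. e \<bullet> y \<ge> 0}) D f" if e: "e \<in> A" "e \<in> splitting f" for e
  proof -
    have e0: "e \<noteq> 0" using e(2) by (simp add: splitting_def)
    have orth: "b \<bullet> e = 0" if "b \<in> B" for b using e(1) that by (auto simp: A_def orthogonal_def)
    have "e \<notin> B" using orth e0 by fastforce
    have "\<exists>D. subspace D \<and> insert e B \<subseteq> D \<and> CARD('N) \<le> dim D + k \<and> sphere_invariant \<Omega> D (reflect_plus e f)"
    proof (rule Suc.IH)
      show "C1_minimizer (reflect_plus e f)" using C1_minimizer_reflect_plus[OF Suc.prems(1) e(2)] .
      show "pairwise orthogonal (insert e B)"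
        using orth by (intro pairwise_orthogonal_insert Suc.prems(3)) (simp add: orthogonal_def inner_commute[of e])
      show "sphere_invariant \<Omega> (span {b}) (reflect_plus e f)" if "b \<in> insert e B" for b
      proof (cases "b = e")
        case True
        then show ?thesis by (auto intro: sphere_invariant_spanI)
      next
        case False
        then show ?thesis
          using that orth Suc.prems(5) by (auto intro: sphere_invariant_reflect_plus)
      qed
    qed (use Suc.prems(2,4,6) e0 \<open>e \<notin> B\<close> in auto)
    then obtain D where D: "subspace D" "insert e B \<subseteq> D" "CARD('N) \<le> dim D + k"
      "sphere_invariant \<Omega> D (reflect_plus e f)" by blast
    have "sphere_invariant (\<Omega> \<inter> {y. e \<bullet> y \<ge> 0}) D (reflect_plus e f)"
      by (rule sphere_invariant_mono[OF D(4)]) auto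
    then have "sphere_invariant (\<Omega> \<inter> {y. e \<bullet> y \<ge> 0}) D f"
      by (subst sphere_invariant_cong[of _ f "reflect_plus e f"]) (auto simp: reflect_plus_def)
    then show ?thesis using D by blast
  qed
  have halves: "\<exists>P1 P2. subspace P1 \<and> subspace P2 \<and> insert e B \<subseteq> P1 \<and> insert e B \<subseteq> P2 \<and>
      CARD('N) \<le> dim P1 + k \<and> CARD('N) \<le> dim P2 + k \<and>
      sphere_invariant (\<Omega> \<inter> {y. e \<bullet> y \<ge> 0}) P1 f \<and> sphere_invariant (\<Omega> \<inter> {y. e \<bullet> y \<le> 0}) P2 f"
    if e: "e \<in> A" "e \<in> splitting f" for e
  proof -
    have "- e \<in> A" "- e \<in> splitting f"
      using e A splitting_uminus by (auto simp: subspace_neg)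
    from half[OF e] half[OF this] obtain P1 P2 where
      P: "subspace P1" "insert e B \<subseteq> P1" "CARD('N) \<le> dim P1 + k" "sphere_invariant (\<Omega> \<inter> {y. e \<bullet> y \<ge> 0}) P1 f"
      "subspace P2" "insert (- e) B \<subseteq> P2" "CARD('N) \<le> dim P2 + k" "sphere_invariant (\<Omega> \<inter> {y. - e \<bullet> y \<ge> 0}) P2 f"
      by blast
    have "e \<in> P2" using P(5,6) subspace_neg[of P2 "- e"] by simp
    moreover have "{y. - e \<bullet> y \<ge> 0} = {y. e \<bullet> y \<le> 0}" by auto
    ultimately show ?thesis using P by (intro exI[of _ P1] exI[of _ P2]) auto
  qed
  have glue: "sphere_invariant \<Omega> P f"
    if "subspace P" "2 \<le> dim P" "e \<in> P"
      "sphere_invariant (\<Omega> \<inter> {y. e \<bullet> y \<ge> 0}) P f" "sphere_invariant (\<Omega> \<inter> {y. e \<bullet> y \<le> 0}) P f" for P e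
  proof (rule sphere_invariant_glue[OF in_\<Omega>_norm_eq that(1-4) that(1-3,5) that(1) subset_refl subset_refl])
    show "sphere_invariant (\<Omega> \<inter> {y. e \<bullet> y = 0}) (P \<inter> {y. e \<bullet> y = 0}) f"
      by (rule sphere_invariant_mono[OF that(4)]) auto
  qed
  show ?case
  proof (cases n)
    case 0
    \<comment> \<open>With one symmetry missing, A has dimension k + 1, too small to guarantee a
      second direction. But e and B then already span a subspace of dimension N - k that lies in
      both P1 and P2.\<close>
    obtain e where e: "e \<in> A" "norm e = 1" "e \<in> splitting f"
      using splitting_exists[OF fX A] dimA by auto
    obtain P1 P2 where P: "subspace P1" "subspace P2" "insert e B \<subseteq> P1" "insert e B \<subseteq> P2"
      "sphere_invariant (\<Omega> \<inter> {y. e \<bullet> y \<ge> 0}) P1 f" "sphere_invariant (\<Omega> \<inter> {y. e \<bullet> y \<le> 0}) P2 f"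
      using halves[OF e(1,3)] by blast
    have sub: "span (insert e B) \<subseteq> P1" "span (insert e B) \<subseteq> P2"
      using span_minimal[OF P(3,1)] span_minimal[OF P(4,2)] by auto
    have orth: "b \<bullet> e = 0" if "b \<in> B" for b using e(1) that by (auto simp: A_def orthogonal_def)
    have "e \<notin> B" using orth e(2) by fastforce
    have "pairwise orthogonal (insert e B)"
      using orth by (intro pairwise_orthogonal_insert Suc.prems(3)) (simp add: orthogonal_def inner_commute[of e])
    moreover have "0 \<notin> insert e B" using e(2) Suc.prems(4) by auto
    ultimately have "independent (insert e B)" by (rule pairwise_orthogonal_independent)
    then have "dim (span (insert e B)) = card (insert e B)"
      by (simp add: dim_eq_card_independent)
    then have dim: "dim (span (insert e B)) + k = CARD('N)"
      using Suc.prems(2,6) \<open>e \<notin> B\<close> 0 by simp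
    have "sphere_invariant \<Omega> (span (insert e B)) f"
    proof (rule glue)
      show "sphere_invariant (\<Omega> \<inter> {y. e \<bullet> y \<ge> 0}) (span (insert e B)) f"
        by (rule sphere_invariant_mono[OF P(5) subset_refl sub(1)])
      show "sphere_invariant (\<Omega> \<inter> {y. e \<bullet> y \<le> 0}) (span (insert e B)) f"
        by (rule sphere_invariant_mono[OF P(6) subset_refl sub(2)])
    qed (use dim codim in \<open>auto simp: span_base\<close>)
    then show ?thesis
      using dim span_superset[of "insert e B"] by (intro exI[of _ "span (insert e B)"]) auto
  next
    case (Suc n')
    \<comment> \<open>With at least two symmetries missing, A has dimension at least k + 2, enough
      for an oblique pair.\<close>
    obtain e e' where e: "e \<in> A" "e \<in> splitting f" "e' \<in> A" "e' \<in> splitting f" "e' \<bullet> e \<noteq> 0" "e' \<notin> span {e}"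
      using splitting_pair_exists[OF fX A] dimA Suc by auto
    obtain P1 P2 where P: "subspace P1" "subspace P2" "insert e B \<subseteq> P1" "insert e B \<subseteq> P2"
      "CARD('N) \<le> dim P1 + k" "CARD('N) \<le> dim P2 + k"
      "sphere_invariant (\<Omega> \<inter> {y. e \<bullet> y \<ge> 0}) P1 f" "sphere_invariant (\<Omega> \<inter> {y. e \<bullet> y \<le> 0}) P2 f"
      using halves[OF e(1,2)] by blast
    obtain Q1 Q2 where Q: "subspace Q1" "subspace Q2" "insert e' B \<subseteq> Q1" "insert e' B \<subseteq> Q2"
      "CARD('N) \<le> dim Q1 + k" "CARD('N) \<le> dim Q2 + k"
      "sphere_invariant (\<Omega> \<inter> {y. e' \<bullet> y \<ge> 0}) Q1 f" "sphere_invariant (\<Omega> \<inter> {y. e' \<bullet> y \<le> 0}) Q2 f"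
      using halves[OF e(3,4)] by blast
    have dims: "2 \<le> dim P1" "2 \<le> dim P2" "2 \<le> dim Q1" "2 \<le> dim Q2" using P(5,6) Q(5,6) codim by auto
    have eP: "e \<in> P1" "e \<in> P2" "e' \<in> Q1" "e' \<in> Q2" using P(3,4) Q(3,4) by auto
    show ?thesis
    proof (cases "P1 = P2")
      case True
      then have "sphere_invariant \<Omega> P1 f" using glue[OF P(1) dims(1) eP(1) P(7)] P(8) by simp
      then show ?thesis using P by blast
    next
      case False
      define D where "D = subspace_sum P1 P2"
      have D: "subspace D" "P1 \<subseteq> D" "P2 \<subseteq> D"
        using subspace_subspace_sum[OF P(1,2)] subspace_sum_superset[OF P(1,2)] by (auto simp: D_def)
      \<comment> \<open>Then D still has dimension at least 2 after intersection with the
        hyperplane, so great circles are available there.\<close>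
      have "dim D \<ge> 3"
      proof (rule ccontr)
        assume "\<not> ?thesis"
        then have "dim D \<le> dim P1" "dim D \<le> dim P2" using dims by auto
        then have "P1 = D" "P2 = D"
          using subspace_dim_equal[OF P(1) D(1,2)] subspace_dim_equal[OF P(2) D(1,3)] by auto
        then show False using False by simp
      qed
      then have dimDe: "2 \<le> dim (D \<inter> {y. e \<bullet> y = 0})"
        using dim_inter_hyperplane[OF D(1), of e] eP(1) D(2) by auto
      have open_half: "sphere_invariant (\<Omega> \<inter> {y. c \<bullet> y > 0}) R f" if "sphere_invariant (\<Omega> \<inter> {y. c \<bullet> y \<ge> 0}) R f" for c R
        by (rule sphere_invariant_mono[OF that]) auto
      have open_half': "sphere_invariant (\<Omega> \<inter> {y. c \<bullet> y < 0}) R f" if "sphere_invariant (\<Omega> \<inter> {y. c \<bullet> y \<le> 0}) R f" for c R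
        by (rule sphere_invariant_mono[OF that]) auto
      have rad: "gradient_radial (frechet_derivative f (at x)) x D" if "x \<in> \<Omega>" "e \<bullet> x = 0" for x
        unfolding D_def
        by (rule gradient_radial_on_hyperplane[OF open_\<Omega> Ck_on_1D(1,2)[OF f1]
            P(1) dims(1) eP(1) open_half[OF P(7)] P(2) dims(2) eP(2) open_half'[OF P(8)]
            Q(1) dims(3) eP(3) open_half[OF Q(7)] Q(2) dims(4) eP(4) open_half'[OF Q(8)] e(5,6) that])
      \<comment> \<open>Directions of D orthogonal to e keep the great circles inside the
        hyperplane, the place where \<open>rad\<close> gives information.\<close>
      have interface: "sphere_invariant (\<Omega> \<inter> {y. e \<bullet> y = 0}) (D \<inter> {y. e \<bullet> y = 0}) f"
      proof (rule gradient_radial_imp_constant[OF in_\<Omega>_norm_eq Ck_on_1D(1)[OF f1] _ dimDe])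
        show "gradient_radial (frechet_derivative f (at x)) x (D \<inter> {y. e \<bullet> y = 0})"
          if "x \<in> \<Omega> \<inter> {y. e \<bullet> y = 0}" for x
          using rad[of x] that by (auto simp: gradient_radial_def)
      qed (auto simp: subspace_hyperplane subspace_inter D(1) intro: in_\<Omega>_norm_eq)
      have "sphere_invariant \<Omega> D f"
        by (rule sphere_invariant_glue[OF in_\<Omega>_norm_eq P(1) dims(1) eP(1) P(7) P(2) dims(2) eP(2) P(8) D interface])
      moreover have "CARD('N) \<le> dim D + k"
        using P(5) dim_subset[OF D(2)] by simp
      ultimately show ?thesis using D P(3) by (intro exI[of _ D]) auto
    qed
  qed
qed

end

section \<open>From rotational invariance to radial symmetry\<close>

lemma orth_proj_eqI:
  assumes "subspace V" "p \<in> V" "\<And>w. w \<in> V \<Longrightarrow> (x - p) \<bullet> w = 0"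
  shows "orth_proj V x = p"
  unfolding orth_proj_def
proof (rule the_equality)
  show "p \<in> V \<and> (\<forall>y\<in>V. orthogonal (x - p) (y - p))"
    using assms by (auto simp: orthogonal_def subspace_diff)
  fix q assume q: "q \<in> V \<and> (\<forall>y\<in>V. orthogonal (x - q) (y - q))"
  then have "(x - q) \<bullet> (p - q) = 0" using assms(2) by (auto simp: orthogonal_def)
  moreover have "(x - p) \<bullet> (p - q) = 0" using assms q by (simp add: subspace_diff)
  ultimately have "((x - q) - (x - p)) \<bullet> (p - q) = 0" by (simp only: inner_diff_left)
  then show "q = p" by simp
qed

text \<open>Points with the same projection onto V and the same distance from it differ by an
  element of D and, by Pythagoras, have equal norm.\<close>

lemma sphere_invariant_imp_radially_symmetric:
  fixes f :: "'a::euclidean_space \<Rightarrow> 'b"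
  assumes D: "subspace D" and inv: "sphere_invariant \<Omega> D f"
  defines "V \<equiv> {y. \<forall>x\<in>D. orthogonal x y}"
  shows "radially_symmetric_on \<Omega> V f"
proof -
  have V: "subspace V" unfolding V_def by (rule subspace_orthogonal_set)
  have proj: "x - orth_proj V x \<in> D \<and> orth_proj V x \<in> V" for x
  proof -
    obtain z v where zv: "z \<in> D" "\<And>w. w \<in> D \<Longrightarrow> orthogonal v w" "x = z + v"
      using orthogonal_subspace_decomp_exists[of D x] D by (auto simp: span_eq_iff[THEN iffD2])
    have "v \<in> V" using zv(2) by (auto simp: V_def orthogonal_commute)
    moreover have "orth_proj V x = v"
      using zv(1,3) \<open>v \<in> V\<close> by (intro orth_proj_eqI V) (auto simp: V_def orthogonal_def)
    ultimately show ?thesis using zv by simp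
  qed
  have eq: "f x = f y" if xy: "x \<in> \<Omega>" "y \<in> \<Omega>" "orth_proj V x = orth_proj V y"
    "norm (x - orth_proj V x) = norm (y - orth_proj V y)" for x y
  proof (rule sphere_invariantD[OF inv xy(1,2)])
    let ?p = "orth_proj V x"
    have p: "x - ?p \<in> D" "y - ?p \<in> D" "?p \<in> V" using proj[of x] proj[of y] xy(3) by auto
    then have "?p \<bullet> (x - ?p) = 0" "?p \<bullet> (y - ?p) = 0" by (auto simp: V_def orthogonal_def inner_commute)
    then have "norm (?p + (x - ?p)) = norm (?p + (y - ?p))"
      using norm_sum_orthogonal_eq xy(3,4) by metis
    then show "norm x = norm y" by simp
    have "(x - ?p) - (y - ?p) \<in> D" using subspace_diff[OF D p(1,2)] .
    then show "x - y \<in> D" by simp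
  qed
  define ft where "ft p r = f (SOME y. y \<in> \<Omega> \<and> orth_proj V y = p \<and> norm (y - orth_proj V y) = r)" for p r
  have "f x = ft (orth_proj V x) (norm (x - orth_proj V x))" if x: "x \<in> \<Omega>" for x
  proof -
    define y where "y = (SOME y. y \<in> \<Omega> \<and> orth_proj V y = orth_proj V x \<and> norm (y - orth_proj V y) = norm (x - orth_proj V x))"
    have "y \<in> \<Omega> \<and> orth_proj V y = orth_proj V x \<and> norm (y - orth_proj V y) = norm (x - orth_proj V x)"
      unfolding y_def by (rule someI[of _ x]) (use x in simp)
    then have "f x = f y" using x by (intro eq) auto
    then show ?thesis by (simp add: ft_def y_def)
  qed
  then show ?thesis unfolding radially_symmetric_on_def by blast
qed

theorem theorem1:
  fixes \<Omega> :: "(real^'N) set"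
    and X :: "(real^'N \<Rightarrow> real^'n) set"
    and F :: "real \<Rightarrow> real^'n \<Rightarrow> real \<Rightarrow> real"
    and G :: "nat \<Rightarrow> real \<Rightarrow> real^'n \<Rightarrow> real \<Rightarrow> real"
    and lam :: "nat \<Rightarrow> real"
    and k :: nat
    and u :: "real^'N \<Rightarrow> real^'n"
  assumes "open \<Omega>"
    and "rotation_invariant \<Omega>"
    and "function_space \<Omega> X"
    and "\<And>v. v \<in> X \<Longrightarrow> set_integrable lebesgue \<Omega> (integrand \<Omega> F v)"
    and "\<And>v j. v \<in> X \<Longrightarrow> j \<in> {1..k} \<Longrightarrow> set_integrable lebesgue \<Omega> (integrand \<Omega> (G j) v)"
    and "k + 2 \<le> CARD('N)"
    and A1: "\<And>v a. v \<in> X \<Longrightarrow> a \<noteq> 0 \<Longrightarrow> reflect_plus a v \<in> X \<and> reflect_minus a v \<in> X"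
    and A2_existence: "\<exists>v. minimizer \<Omega> X F k G lam v"
    and A2_regularity: "\<And>v. minimizer \<Omega> X F k G lam v \<Longrightarrow> \<exists>w. C1_representative \<Omega> v w"
    and "minimizer \<Omega> X F k G lam u"
  shows "\<exists>V w. subspace V \<and> dim V = k \<and> C1_representative \<Omega> u w \<and> radially_symmetric_on \<Omega> V w"
proof -
  interpret constrained_problem \<Omega> X F k G lam
    using assms by unfold_locales auto
  obtain w where w: "ae_eq_on \<Omega> u w" "Ck_on 1 \<Omega> w"
    using A2_regularity[OF assms(10)] by (auto simp: C1_representative_def)
  then have "C1_minimizer w"
    using minimizer_ae_eq[OF assms(10)] by (simp add: C1_minimizer_def)
  then obtain D where D: "subspace D" "CARD('N) \<le> dim D + k" "sphere_invariant \<Omega> D w"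
    using C1_minimizer_invariant[of w "{}" "CARD('N) - k"] codim by (auto simp: pairwise_def)
  \<comment> \<open>D may have dimension above N - k; shrinking it makes the dimension of its
    orthogonal complement exactly k.\<close>
  obtain D' where D': "subspace D'" "D' \<subseteq> span D" "dim D' = CARD('N) - k"
  proof -
    have "CARD('N) - k \<le> dim D" using D(2) by simp
    from choose_subspace_of_subspace[OF this] show thesis using that by blast
  qed
  have sub: "D' \<subseteq> D" using D'(2) D(1) by (simp add: span_eq_iff[THEN iffD2])
  define V where "V = {y :: real^'N. \<forall>x\<in>D'. orthogonal x y}"
  have "dim {y \<in> UNIV. \<forall>x\<in>D'. orthogonal x y} + dim D' = dim (UNIV :: (real^'N) set)"
    using D'(1) by (intro dim_subspace_orthogonal_to_vectors) auto
  then have "dim V = k" using D'(3) codim by (simp add: V_def)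
  moreover have "subspace V" unfolding V_def by (rule subspace_orthogonal_set)
  moreover have "radially_symmetric_on \<Omega> V w"
    unfolding V_def
    by (rule sphere_invariant_imp_radially_symmetric[OF D'(1) sphere_invariant_mono[OF D(3) subset_refl sub]])
  ultimately show ?thesis using w by (auto simp: C1_representative_def)
qed

end
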